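(* (1) The theory $\mathrm{RCA}_0^{\Omega}$ proves $\mathrm{FAN}^{\mathrm{st}}\leftrightarrow\mathrm{UFAN}_2^{\mathrm{st}}\leftrightarrow\mathrm{FAN}^{*}$. (2) The theory $\mathrm{RCA}_0^{\Omega}+\mathrm{QF\text{-}AC}^{2,0}$ proves $\mathrm{FAN}^{\mathrm{st}}\leftrightarrow\mathrm{FAN}\leftrightarrow\mathrm{UFAN}_2$.
   Context: BASE THEORY. Finite types: $0$ (natural numbers), $\sigma\to\tau$, and $\sigma^{*}$ (finite sequences of objects of type $\sigma$); $1=0\to 0$, $2=1\to 0$, $3=2\to 0$. Superscripts indicate types; tuples are coded as single objects where convenient. Equality $=_0$ is primitive; for $\tau=\tau_1\to\dots\to\tau_k\to 0$, $x=_\tau y$ means $(\forall z_1\dots z_k)(xz_1\dots z_k=_0 yz_1\dots z_k)$. $\mathrm{RCA}_0^{\omega}$ is Kohlenbach's higher-order base theory: classical arithmetic in all finite types with combinators, zero, successor, the recursor $R_0$ (primitive recursion with type $0$ values), quantifier-free induction, extensionality $x=_\rho y\to\varphi(x)=_\tau\varphi(y)$ for all $\varphi^{\rho\to\tau}$, and $\mathrm{QF\text{-}AC}^{1,0}$, where $\mathrm{QF\text{-}AC}^{\sigma,\tau}$ is $(\forall x^\sigma)(\exists y^\tau)A_0(x,y)\to(\exists F^{\sigma\to\tau})(\forall x)A_0(x,F(x))$ for quantifier-free $A_0$. $\mathrm{RCA}_0^{\Omega}$ extends $\mathrm{RCA}_0^{\omega}$ (with the types $\sigma^*$) by a predicate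 $\mathrm{st}$ ("is standard") for each type. A formula is internal if it does not contain $\mathrm{st}$; $(\forall^{\mathrm{st}}x)A$ is $(\forall x)(\mathrm{st}(x)\to A)$, $(\exists^{\mathrm{st}}x)A$ is $(\exists x)(\mathrm{st}(x)\wedge A)$; $N\in\Omega$ means $\neg\mathrm{st}(N^0)$; $A^{\mathrm{st}}$ is $A$ with all quantifiers (except bounded number quantifiers) relativised to $\mathrm{st}$. Axioms: (i) standardness respects equality, closed terms are standard, a standard functional applied to a standard object is standard, and numbers below a standard number are standard; (ii) Idealization: $(\forall^{\mathrm{st}}x^{\sigma^*})(\exists y^\tau)(\forall z\in x)\varphi(z,y)\to(\exists y)(\forall^{\mathrm{st}}z^{\sigma})\varphi(z,y)$ for internal $\varphi$; (iii) $\mathrm{HAC}_{\mathrm{int}}$: $(\forall^{\mathrm{st}}x^{\rho})(\exists^{\mathrm{st}}y^{\tau})\varphi(x,y)\to(\exists^{\mathrm{st}}\Phi^{\rho\to\tau^*})(\forall^{\mathrm{st}}x)(\exists y\in\Phi(x))\varphi(x,y)$ for internal $\varphi$; (iv) $\mathrm{PF\text{-}TP}_\forall$: $(\forall^{\mathrm{st}}x^\tau)\varphi(x)\to(\forall x^\tau)\varphi(x)$ for internal $\varphi(x)$ with no parameters other than $x$; (v) for certain functionals uniquely specified by a parameter-free internal formula $D$, a constant $\Xi_0$ with the axiom $\mathrm{st}(\Xi_0)\wedge(\forall^{\mathrm{st}}\Xi)[D^{\mathrm{st}}(\Xi)\to \Xi_0$ and $\Xi$ agree on all standard inputs$]$;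 these constants do not count as parameters in (iv). NOTATION. $\alpha\leq_11$ means $\alpha^1$ is a $0$-$1$ sequence; $\overline{\alpha}n$ is the (code of the) initial segment of $\alpha$ of length $n$; "$T^1\leq_11$" means that $T$ represents a binary tree. PRINCIPLES. $\mathrm{FAN}$: for all binary trees $T^1\leq_11$, $(\forall\alpha^1\leq_11)(\exists n^0)(\overline{\alpha}n\notin T)\to(\exists k_0^0)(\forall\alpha^1\leq_11)(\exists n^0\leq k_0)(\overline{\alpha}n\notin T)$. $\mathrm{FAN}^*$: $\mathrm{FAN}^{\mathrm{st}}$ with the quantifier $(\forall^{\mathrm{st}}\alpha\leq_11)$ in the consequent replaced by $(\forall\alpha\leq_11)$. $\mathrm{UFAN}_2$: there is $\Phi^{(1\times2)\to0}$ such that for all $T^1\leq_11$ and $g^2$, $(\forall\alpha\leq_11)(\overline{\alpha}g(\alpha)\notin T)\to(\forall\alpha\leq_11)(\exists n\leq\Phi(T,g))(\overline{\alpha}n\notin T)$. *)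

theory Defs
  imports Main
begin

section \<open>Language\<close>

datatype ftyp = Num | Fun ftyp ftyp (infixr "\<rightarrow>" 65) | Seq ftyp

abbreviation one :: ftyp where "one \<equiv> Num \<rightarrow> Num"
abbreviation two :: ftyp where "two \<equiv> one \<rightarrow> Num"

text \<open>Variables are named and carry their type, so that variables with the same name and
  different types are different.\<close>

type_synonym var = "nat \<times> ftyp"

text \<open>A finite sequence of type \<open>Seq \<sigma>\<close> is given by its length and its entries:
  \<open>CMk \<sigma> n f\<close> is the sequence of the \<open>f i\<close> with \<open>i < n\<close>.  \<open>CXi i \<sigma>\<close> are names for
  the additional standard functionals.\<close>

datatype const =
    CZero | CSucc | CK ftyp ftyp | CS ftyp ftyp ftyp | CRec
  | CLen ftyp | CGet ftyp | CMk ftyp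
  | CXi nat ftyp

primrec cty :: "const \<Rightarrow> ftyp" where
  "cty CZero = Num"
| "cty CSucc = one"
| "cty (CK \<sigma> \<tau>) = \<sigma> \<rightarrow> \<tau> \<rightarrow> \<sigma>"
| "cty (CS \<rho> \<sigma> \<tau>) = (\<rho> \<rightarrow> \<sigma> \<rightarrow> \<tau>) \<rightarrow> (\<rho> \<rightarrow> \<sigma>) \<rightarrow> \<rho> \<rightarrow> \<tau>"
| "cty CRec = Num \<rightarrow> Num \<rightarrow> (Num \<rightarrow> Num \<rightarrow> Num) \<rightarrow> Num"
| "cty (CLen \<sigma>) = Seq \<sigma> \<rightarrow> Num"
| "cty (CGet \<sigma>) = Seq \<sigma> \<rightarrow> Num \<rightarrow> \<sigma>"
| "cty (CMk \<sigma>) = Num \<rightarrow> (Num \<rightarrow> \<sigma>) \<rightarrow> Seq \<sigma>"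
| "cty (CXi i \<sigma>) = \<sigma>"

datatype trm = Var var | Con const | App trm trm (infixl "\<cdot>" 110)

text \<open>The type of a term; the value is arbitrary on terms that are not well-typed.\<close>

primrec ty :: "trm \<Rightarrow> ftyp" where
  "ty (Var v) = snd v"
| "ty (Con c) = cty c"
| "ty (s \<cdot> t) = (case ty s of Fun \<sigma> \<tau> \<Rightarrow> \<tau> | _ \<Rightarrow> Num)"

text \<open>A language is the set of the additional constants it has.\<close>

type_synonym lang = "(nat \<times> ftyp) set"

primrec wt :: "lang \<Rightarrow> trm \<Rightarrow> bool" where
  "wt L (Var v) \<longleftrightarrow> True"
| "wt L (Con c) \<longleftrightarrow> (\<forall>i \<sigma>. c = CXi i \<sigma> \<longrightarrow> (i, \<sigma>) \<in> L)"
| "wt L (s \<cdot> t) \<longleftrightarrow> wt L s \<and> wt L t \<and> (\<exists>\<tau>. ty s = ty t \<rightarrow> \<tau>)"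

definition Tm :: "lang \<Rightarrow> ftyp \<Rightarrow> trm set" where
  "Tm L \<sigma> = {t. wt L t \<and> ty t = \<sigma>}"

primrec fvt :: "trm \<Rightarrow> var set" where
  "fvt (Var v) = {v}"
| "fvt (Con c) = {}"
| "fvt (s \<cdot> t) = fvt s \<union> fvt t"

primrec maxv :: "trm \<Rightarrow> nat" where
  "maxv (Var v) = fst v"
| "maxv (Con c) = 0"
| "maxv (s \<cdot> t) = max (maxv s) (maxv t)"

definition fresh :: "ftyp \<Rightarrow> trm \<Rightarrow> trm \<Rightarrow> var" where
  "fresh \<sigma> s t = (Suc (max (maxv s) (maxv t)), \<sigma>)"

primrec substt :: "var \<Rightarrow> trm \<Rightarrow> trm \<Rightarrow> trm" where
  "substt v u (Var w) = (if v = w then u else Var w)"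
| "substt v u (Con c) = Con c"
| "substt v u (s \<cdot> t) = substt v u s \<cdot> substt v u t"

text \<open>The only atomic equality is that of type 0.  \<open>BAll n t \<phi>\<close> is the bounded number
  quantifier \<open>(\<forall>n \<le> t) \<phi>\<close>; it is a separate formula constructor because relativisation
  to \<open>st\<close> must not change it.\<close>

datatype fm =
    Bot | Eq trm trm (infix "\<doteq>" 70) | St trm
  | Imp fm fm (infixr "\<^bold>\<longrightarrow>" 55)
  | All var fm | BAll var trm fm

abbreviation Neg ("\<^bold>\<not>_" [66] 66) where "\<^bold>\<not> \<phi> \<equiv> \<phi> \<^bold>\<longrightarrow> Bot"
abbreviation And (infixr "\<^bold>\<and>" 62) where "\<phi> \<^bold>\<and> \<psi> \<equiv> \<^bold>\<not> (\<phi> \<^bold>\<longrightarrow> \<^bold>\<not> \<psi>)"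
abbreviation Iff (infix "\<^bold>\<longleftrightarrow>" 53) where "\<phi> \<^bold>\<longleftrightarrow> \<psi> \<equiv> (\<phi> \<^bold>\<longrightarrow> \<psi>) \<^bold>\<and> (\<psi> \<^bold>\<longrightarrow> \<phi>)"
abbreviation Ex where "Ex v \<phi> \<equiv> \<^bold>\<not> (All v (\<^bold>\<not> \<phi>))"
abbreviation BEx where "BEx v t \<phi> \<equiv> \<^bold>\<not> (BAll v t (\<^bold>\<not> \<phi>))"
abbreviation AllSt where "AllSt v \<phi> \<equiv> All v (St (Var v) \<^bold>\<longrightarrow> \<phi>)"
abbreviation ExSt where "ExSt v \<phi> \<equiv> Ex v (St (Var v) \<^bold>\<and> \<phi>)"

primrec wff :: "lang \<Rightarrow> fm \<Rightarrow> bool" where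
  "wff L Bot \<longleftrightarrow> True"
| "wff L (s \<doteq> t) \<longleftrightarrow> s \<in> Tm L Num \<and> t \<in> Tm L Num"
| "wff L (St t) \<longleftrightarrow> wt L t"
| "wff L (\<phi> \<^bold>\<longrightarrow> \<psi>) \<longleftrightarrow> wff L \<phi> \<and> wff L \<psi>"
| "wff L (All v \<phi>) \<longleftrightarrow> wff L \<phi>"
| "wff L (BAll v t \<phi>) \<longleftrightarrow> snd v = Num \<and> t \<in> Tm L Num \<and> v \<notin> fvt t \<and> wff L \<phi>"

primrec fv :: "fm \<Rightarrow> var set" where
  "fv Bot = {}"
| "fv (s \<doteq> t) = fvt s \<union> fvt t"
| "fv (St t) = fvt t"
| "fv (\<phi> \<^bold>\<longrightarrow> \<psi>) = fv \<phi> \<union> fv \<psi>"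
| "fv (All v \<phi>) = fv \<phi> - {v}"
| "fv (BAll v t \<phi>) = fvt t \<union> (fv \<phi> - {v})"

text \<open>Substitution does not rename bound variables; it is used only under \<open>free_for\<close> or on
  quantifier-free formulas.\<close>

primrec subst :: "var \<Rightarrow> trm \<Rightarrow> fm \<Rightarrow> fm" where
  "subst v u Bot = Bot"
| "subst v u (s \<doteq> t) = (substt v u s \<doteq> substt v u t)"
| "subst v u (St t) = St (substt v u t)"
| "subst v u (\<phi> \<^bold>\<longrightarrow> \<psi>) = (subst v u \<phi> \<^bold>\<longrightarrow> subst v u \<psi>)"
| "subst v u (All w \<phi>) = All w (if v = w then \<phi> else subst v u \<phi>)"
| "subst v u (BAll w t \<phi>) = BAll w (substt v u t) (if v = w then \<phi> else subst v u \<phi>)"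

primrec free_for :: "var \<Rightarrow> trm \<Rightarrow> fm \<Rightarrow> bool" where
  "free_for v u Bot \<longleftrightarrow> True"
| "free_for v u (s \<doteq> t) \<longleftrightarrow> True"
| "free_for v u (St t) \<longleftrightarrow> True"
| "free_for v u (\<phi> \<^bold>\<longrightarrow> \<psi>) \<longleftrightarrow> free_for v u \<phi> \<and> free_for v u \<psi>"
| "free_for v u (All w \<phi>) \<longleftrightarrow> v \<notin> fv (All w \<phi>) \<or> w \<notin> fvt u \<and> free_for v u \<phi>"
| "free_for v u (BAll w t \<phi>) \<longleftrightarrow> v \<notin> fv (BAll w t \<phi>) \<or> w \<notin> fvt u \<and> free_for v u \<phi>"

primrec internal :: "fm \<Rightarrow> bool" where
  "internal Bot \<longleftrightarrow> True"
| "internal (s \<doteq> t) \<longleftrightarrow> True"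
| "internal (St t) \<longleftrightarrow> False"
| "internal (\<phi> \<^bold>\<longrightarrow> \<psi>) \<longleftrightarrow> internal \<phi> \<and> internal \<psi>"
| "internal (All v \<phi>) \<longleftrightarrow> internal \<phi>"
| "internal (BAll v t \<phi>) \<longleftrightarrow> internal \<phi>"

primrec qf :: "fm \<Rightarrow> bool" where
  "qf Bot \<longleftrightarrow> True"
| "qf (s \<doteq> t) \<longleftrightarrow> True"
| "qf (St t) \<longleftrightarrow> False"
| "qf (\<phi> \<^bold>\<longrightarrow> \<psi>) \<longleftrightarrow> qf \<phi> \<and> qf \<psi>"
| "qf (All v \<phi>) \<longleftrightarrow> False"
| "qf (BAll v t \<phi>) \<longleftrightarrow> False"

text \<open>The relativisation of \<open>A\<close> to \<open>A\<^sup>s\<^sup>t\<close>.\<close>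

primrec rel :: "fm \<Rightarrow> fm" where
  "rel Bot = Bot"
| "rel (s \<doteq> t) = (s \<doteq> t)"
| "rel (St t) = St t"
| "rel (\<phi> \<^bold>\<longrightarrow> \<psi>) = (rel \<phi> \<^bold>\<longrightarrow> rel \<psi>)"
| "rel (All v \<phi>) = AllSt v (rel \<phi>)"
| "rel (BAll v t \<phi>) = BAll v t (rel \<phi>)"


section \<open>Arithmetical terms\<close>

text \<open>Abstraction over a variable, by the usual translation into combinators.\<close>

primrec lam :: "var \<Rightarrow> trm \<Rightarrow> trm" where
  "lam v (Var w) =
     (if v = w
      then Con (CS (snd v) (snd v \<rightarrow> snd v) (snd v)) \<cdot> Con (CK (snd v) (snd v \<rightarrow> snd v))
             \<cdot> Con (CK (snd v) (snd v))
      else Con (CK (snd w) (snd v)) \<cdot> Var w)"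
| "lam v (Con c) = Con (CK (cty c) (snd v)) \<cdot> Con c"
| "lam v (s \<cdot> t) =
     (if v \<notin> fvt (s \<cdot> t) then Con (CK (ty (s \<cdot> t)) (snd v)) \<cdot> (s \<cdot> t)
      else Con (CS (snd v) (ty t) (ty (s \<cdot> t))) \<cdot> lam v s \<cdot> lam v t)"

abbreviation zero where "zero \<equiv> Con CZero"
abbreviation succ where "succ t \<equiv> Con CSucc \<cdot> t"
abbreviation len where "len \<sigma> s \<equiv> Con (CLen \<sigma>) \<cdot> s"
abbreviation get where "get \<sigma> s i \<equiv> Con (CGet \<sigma>) \<cdot> s \<cdot> i"

definition plus_tm :: trm where
  "plus_tm = (let m = (0, Num); n = (1, Num); a = (2, Num); b = (3, Num) in
     lam m (lam n (Con CRec \<cdot> Var n \<cdot> Var m \<cdot> lam a (lam b (succ (Var a))))))"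

definition pred_tm :: trm where
  "pred_tm = (let n = (0, Num); a = (1, Num); b = (2, Num) in
     lam n (Con CRec \<cdot> Var n \<cdot> zero \<cdot> lam a (lam b (Var b))))"

definition monus_tm :: trm where
  "monus_tm = (let m = (0, Num); n = (1, Num); a = (2, Num); b = (3, Num) in
     lam m (lam n (Con CRec \<cdot> Var n \<cdot> Var m \<cdot> lam a (lam b (pred_tm \<cdot> Var a)))))"

definition tri_tm :: trm where
  "tri_tm = (let n = (0, Num); a = (1, Num); b = (2, Num) in
     lam n (Con CRec \<cdot> Var n \<cdot> zero \<cdot> lam a (lam b (plus_tm \<cdot> Var a \<cdot> succ (Var b)))))"

text \<open>The Cantor pairing \<open>j(m, n) = (m + n)(m + n + 1) / 2 + n\<close>, a bijection.\<close>

definition pair_tm :: trm where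
  "pair_tm = (let m = (0, Num); n = (1, Num) in
     lam m (lam n (plus_tm \<cdot> (tri_tm \<cdot> (plus_tm \<cdot> Var m \<cdot> Var n)) \<cdot> Var n)))"

text \<open>Finite sequences of numbers are coded by 0 for the empty sequence and \<open>j(s, a) + 1\<close>
  for the sequence with code \<open>s\<close> extended by the last entry \<open>a\<close>; every number is the
  code of exactly one sequence.  \<open>bar \<alpha> n\<close> is the code of the initial segment of
  \<open>\<alpha>\<close> of length \<open>n\<close>.\<close>

abbreviation snoc where "snoc s a \<equiv> succ (pair_tm \<cdot> s \<cdot> a)"

definition bar_tm :: trm where
  "bar_tm = (let \<alpha> = (0, one); n = (1, Num); a = (2, Num); b = (3, Num) in
     lam \<alpha> (lam n (Con CRec \<cdot> Var n \<cdot> zero \<cdot> lam a (lam b (snoc (Var a) (Var \<alpha> \<cdot> Var b))))))"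

abbreviation bar where "bar \<alpha> n \<equiv> bar_tm \<cdot> \<alpha> \<cdot> n"

abbreviation Le where "Le s t \<equiv> (monus_tm \<cdot> s \<cdot> t \<doteq> zero)"
abbreviation Less where "Less s t \<equiv> Le (succ s) t"

text \<open>Equality of higher type: extensional for functionals; for sequences, equality of the
  lengths and of the entries.\<close>

primrec eqn :: "ftyp \<Rightarrow> trm \<Rightarrow> trm \<Rightarrow> fm" where
  "eqn Num s t = (s \<doteq> t)"
| "eqn (\<sigma> \<rightarrow> \<tau>) s t =
     (let z = fresh \<sigma> s t in All z (eqn \<tau> (s \<cdot> Var z) (t \<cdot> Var z)))"
| "eqn (Seq \<sigma>) s t =
     (let i = fresh Num s t in
      (len \<sigma> s \<doteq> len \<sigma> t) \<^bold>\<and>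
      BAll i (len \<sigma> s)
        (Less (Var i) (len \<sigma> s) \<^bold>\<longrightarrow> eqn \<sigma> (get \<sigma> s (Var i)) (get \<sigma> t (Var i))))"

text \<open>\<open>mem \<sigma> z s\<close>: the object \<open>z\<close> of type \<open>\<sigma>\<close> is an entry of the sequence \<open>s\<close>.\<close>

definition mem :: "ftyp \<Rightarrow> trm \<Rightarrow> trm \<Rightarrow> fm" where
  "mem \<sigma> z s =
     (let i = fresh Num z s in
      BEx i (len \<sigma> s) (Less (Var i) (len \<sigma> s) \<^bold>\<and> eqn \<sigma> (get \<sigma> s (Var i)) z))"

primrec zero_tm :: "ftyp \<Rightarrow> trm" where
  "zero_tm Num = zero"
| "zero_tm (\<sigma> \<rightarrow> \<tau>) = Con (CK \<tau> \<sigma>) \<cdot> zero_tm \<tau>"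
| "zero_tm (Seq \<sigma>) = Con (CMk \<sigma>) \<cdot> zero \<cdot> (Con (CK \<sigma> Num) \<cdot> zero_tm \<sigma>)"


section \<open>Provability\<close>

text \<open>Classical many-sorted predicate logic in Hilbert style.  Axioms of a theory may have free
  variables and then stand for their universal closures.\<close>

inductive prv :: "lang \<Rightarrow> fm set \<Rightarrow> fm \<Rightarrow> bool" for L :: lang and Ax :: "fm set" where
  axiom: "\<phi> \<in> Ax \<Longrightarrow> prv L Ax \<phi>"
| imp_K: "wff L \<phi> \<Longrightarrow> wff L \<psi> \<Longrightarrow> prv L Ax (\<phi> \<^bold>\<longrightarrow> \<psi> \<^bold>\<longrightarrow> \<phi>)"
| imp_S: "wff L \<phi> \<Longrightarrow> wff L \<psi> \<Longrightarrow> wff L \<chi> \<Longrightarrow>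
    prv L Ax ((\<phi> \<^bold>\<longrightarrow> \<psi> \<^bold>\<longrightarrow> \<chi>) \<^bold>\<longrightarrow> (\<phi> \<^bold>\<longrightarrow> \<psi>) \<^bold>\<longrightarrow> \<phi> \<^bold>\<longrightarrow> \<chi>)"
| dneg: "wff L \<phi> \<Longrightarrow> prv L Ax (\<^bold>\<not> (\<^bold>\<not> \<phi>) \<^bold>\<longrightarrow> \<phi>)"
| all_inst: "wff L \<phi> \<Longrightarrow> t \<in> Tm L (snd v) \<Longrightarrow> free_for v t \<phi> \<Longrightarrow>
    prv L Ax (All v \<phi> \<^bold>\<longrightarrow> subst v t \<phi>)"
| all_dist: "wff L \<phi> \<Longrightarrow> wff L \<psi> \<Longrightarrow> v \<notin> fv \<phi> \<Longrightarrow>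
    prv L Ax (All v (\<phi> \<^bold>\<longrightarrow> \<psi>) \<^bold>\<longrightarrow> \<phi> \<^bold>\<longrightarrow> All v \<psi>)"
| ball: "wff L (BAll v t \<phi>) \<Longrightarrow>
    prv L Ax (BAll v t \<phi> \<^bold>\<longleftrightarrow> All v (Le (Var v) t \<^bold>\<longrightarrow> \<phi>))"
| mp: "prv L Ax (\<phi> \<^bold>\<longrightarrow> \<psi>) \<Longrightarrow> prv L Ax \<phi> \<Longrightarrow> prv L Ax \<psi>"
| gen: "prv L Ax \<phi> \<Longrightarrow> prv L Ax (All v \<phi>)"


section \<open>The theories\<close>

text \<open>The schema \<open>QF-AC\<^sup>\<sigma>\<^sup>,\<^sup>\<tau>\<close>.\<close>

definition QFAC :: "lang \<Rightarrow> ftyp \<Rightarrow> ftyp \<Rightarrow> fm set" where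
  "QFAC L \<sigma> \<tau> =
     {All x (Ex y A) \<^bold>\<longrightarrow> Ex F (All x (subst y (Var F \<cdot> Var x) A)) | x y F A.
        wff L A \<and> qf A \<and> snd x = \<sigma> \<and> snd y = \<tau> \<and> x \<noteq> y \<and> snd F = \<sigma> \<rightarrow> \<tau> \<and> F \<notin> fv A}"

inductive_set RCA0omega :: "lang \<Rightarrow> fm set" for L :: lang where
  eq_refl: "t \<in> Tm L Num \<Longrightarrow> (t \<doteq> t) \<in> RCA0omega L"
| eq_sym: "s \<in> Tm L Num \<Longrightarrow> t \<in> Tm L Num \<Longrightarrow> (s \<doteq> t \<^bold>\<longrightarrow> t \<doteq> s) \<in> RCA0omega L"
| eq_trans: "s \<in> Tm L Num \<Longrightarrow> t \<in> Tm L Num \<Longrightarrow> u \<in> Tm L Num \<Longrightarrow>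
    (s \<doteq> t \<^bold>\<longrightarrow> t \<doteq> u \<^bold>\<longrightarrow> s \<doteq> u) \<in> RCA0omega L"
| ext: "s \<in> Tm L \<rho> \<Longrightarrow> t \<in> Tm L \<rho> \<Longrightarrow> f \<in> Tm L (\<rho> \<rightarrow> \<tau>) \<Longrightarrow>
    (eqn \<rho> s t \<^bold>\<longrightarrow> eqn \<tau> (f \<cdot> s) (f \<cdot> t)) \<in> RCA0omega L"
| succ_nz: "t \<in> Tm L Num \<Longrightarrow> \<^bold>\<not> (succ t \<doteq> zero) \<in> RCA0omega L"
| succ_inj: "s \<in> Tm L Num \<Longrightarrow> t \<in> Tm L Num \<Longrightarrow>
    (succ s \<doteq> succ t \<^bold>\<longrightarrow> s \<doteq> t) \<in> RCA0omega L"
| qf_ind: "wff L A \<Longrightarrow> qf A \<Longrightarrow> snd n = Num \<Longrightarrow>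
    (subst n zero A \<^bold>\<and> All n (A \<^bold>\<longrightarrow> subst n (succ (Var n)) A) \<^bold>\<longrightarrow> All n A) \<in> RCA0omega L"
| comb_K: "s \<in> Tm L \<sigma> \<Longrightarrow> t \<in> Tm L \<tau> \<Longrightarrow>
    eqn \<sigma> (Con (CK \<sigma> \<tau>) \<cdot> s \<cdot> t) s \<in> RCA0omega L"
| comb_S: "s \<in> Tm L (\<rho> \<rightarrow> \<sigma> \<rightarrow> \<tau>) \<Longrightarrow> t \<in> Tm L (\<rho> \<rightarrow> \<sigma>) \<Longrightarrow> u \<in> Tm L \<rho> \<Longrightarrow>
    eqn \<tau> (Con (CS \<rho> \<sigma> \<tau>) \<cdot> s \<cdot> t \<cdot> u) (s \<cdot> u \<cdot> (t \<cdot> u)) \<in> RCA0omega L"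
| rec_zero: "s \<in> Tm L Num \<Longrightarrow> t \<in> Tm L (Num \<rightarrow> Num \<rightarrow> Num) \<Longrightarrow>
    (Con CRec \<cdot> zero \<cdot> s \<cdot> t \<doteq> s) \<in> RCA0omega L"
| rec_succ: "u \<in> Tm L Num \<Longrightarrow> s \<in> Tm L Num \<Longrightarrow> t \<in> Tm L (Num \<rightarrow> Num \<rightarrow> Num) \<Longrightarrow>
    (Con CRec \<cdot> succ u \<cdot> s \<cdot> t \<doteq> t \<cdot> (Con CRec \<cdot> u \<cdot> s \<cdot> t) \<cdot> u) \<in> RCA0omega L"
| seq_len: "n \<in> Tm L Num \<Longrightarrow> f \<in> Tm L (Num \<rightarrow> \<sigma>) \<Longrightarrow>
    (len \<sigma> (Con (CMk \<sigma>) \<cdot> n \<cdot> f) \<doteq> n) \<in> RCA0omega L"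
| seq_get: "n \<in> Tm L Num \<Longrightarrow> f \<in> Tm L (Num \<rightarrow> \<sigma>) \<Longrightarrow> i \<in> Tm L Num \<Longrightarrow>
    (Less i n \<^bold>\<longrightarrow> eqn \<sigma> (get \<sigma> (Con (CMk \<sigma>) \<cdot> n \<cdot> f) i) (f \<cdot> i)) \<in> RCA0omega L"
| seq_default: "s \<in> Tm L (Seq \<sigma>) \<Longrightarrow> i \<in> Tm L Num \<Longrightarrow>
    (Le (len \<sigma> s) i \<^bold>\<longrightarrow> eqn \<sigma> (get \<sigma> s i) (zero_tm \<sigma>)) \<in> RCA0omega L"
| qf_ac: "\<phi> \<in> QFAC L one Num \<Longrightarrow> \<phi> \<in> RCA0omega L"

text \<open>The part of \<open>RCA\<^sub>0\<^sup>\<Omega>\<close> without the axioms for the additional constants.  The set \<open>L\<close>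
  of additional constants enters as part of the language of the schemata; in \<open>pf_tp\<close> these
  constants are not parameters.\<close>

inductive_set RCA0Omega_core :: "lang \<Rightarrow> fm set" for L :: lang where
  base: "\<phi> \<in> RCA0omega L \<Longrightarrow> \<phi> \<in> RCA0Omega_core L"
| st_eq: "s \<in> Tm L \<sigma> \<Longrightarrow> t \<in> Tm L \<sigma> \<Longrightarrow>
    (eqn \<sigma> s t \<^bold>\<longrightarrow> St s \<^bold>\<longrightarrow> St t) \<in> RCA0Omega_core L"
| st_closed: "wt L t \<Longrightarrow> fvt t = {} \<Longrightarrow> St t \<in> RCA0Omega_core L"
| st_app: "wt L (s \<cdot> t) \<Longrightarrow> (St s \<^bold>\<longrightarrow> St t \<^bold>\<longrightarrow> St (s \<cdot> t)) \<in> RCA0Omega_core L"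
| st_le: "s \<in> Tm L Num \<Longrightarrow> t \<in> Tm L Num \<Longrightarrow>
    (St t \<^bold>\<longrightarrow> Le s t \<^bold>\<longrightarrow> St s) \<in> RCA0Omega_core L"
| idealization: "wff L \<phi> \<Longrightarrow> internal \<phi> \<Longrightarrow> snd z = \<sigma> \<Longrightarrow> snd x = Seq \<sigma> \<Longrightarrow>
    x \<noteq> y \<Longrightarrow> z \<noteq> y \<Longrightarrow> x \<notin> fv \<phi> \<Longrightarrow>
    (AllSt x (Ex y (All z (mem \<sigma> (Var z) (Var x) \<^bold>\<longrightarrow> \<phi>))) \<^bold>\<longrightarrow> Ex y (AllSt z \<phi>))
      \<in> RCA0Omega_core L"
| hac_int: "wff L \<phi> \<Longrightarrow> internal \<phi> \<Longrightarrow> snd x = \<rho> \<Longrightarrow> snd y = \<tau> \<Longrightarrow> x \<noteq> y \<Longrightarrow>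
    snd F = \<rho> \<rightarrow> Seq \<tau> \<Longrightarrow> F \<notin> fv \<phi> \<Longrightarrow>
    (AllSt x (ExSt y \<phi>) \<^bold>\<longrightarrow>
       ExSt F (AllSt x (Ex y (mem \<tau> (Var y) (Var F \<cdot> Var x) \<^bold>\<and> \<phi>)))) \<in> RCA0Omega_core L"
| pf_tp: "wff L \<phi> \<Longrightarrow> internal \<phi> \<Longrightarrow> fv \<phi> \<subseteq> {x} \<Longrightarrow>
    (AllSt x \<phi> \<^bold>\<longrightarrow> All x \<phi>) \<in> RCA0Omega_core L"

text \<open>A choice of the additional constants: \<open>S i = Some (v, D)\<close> gives the constant
  \<open>CXi i (snd v)\<close> for the functional specified by the formula \<open>D\<close> with sole free
  variable \<open>v\<close>.\<close>

type_synonym spec = "nat \<Rightarrow> (var \<times> fm) option"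

definition spec_lang :: "spec \<Rightarrow> lang" where
  "spec_lang S = {(i, snd v) | i v D. S i = Some (v, D)}"

definition spec_axioms :: "spec \<Rightarrow> fm set" where
  "spec_axioms S =
     {St (Con (CXi i (snd v))) \<^bold>\<and>
      AllSt v (rel D \<^bold>\<longrightarrow> rel (eqn (snd v) (Con (CXi i (snd v))) (Var v))) | i v D.
        S i = Some (v, D)}"

text \<open>That \<open>D\<close> specifies at most one functional may be provable for \<open>D\<close> itself or for the
  formula \<open>D\<^sup>s\<^sup>t\<close> that occurs in the axiom for the constant; both kinds of specification are
  admitted.\<close>

definition uniquely_specifies :: "var \<Rightarrow> fm \<Rightarrow> bool" where
  "uniquely_specifies v D \<longleftrightarrow>
     (\<exists>w. snd w = snd v \<and> w \<noteq> v \<and> w \<notin> fv D \<and> free_for v (Var w) D \<and>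
       (prv {} (RCA0Omega_core {})
          (All v (All w (D \<^bold>\<and> subst v (Var w) D \<^bold>\<longrightarrow> eqn (snd v) (Var v) (Var w)))) \<or>
        prv {} (RCA0Omega_core {})
          (AllSt v (AllSt w
             (rel D \<^bold>\<and> rel (subst v (Var w) D) \<^bold>\<longrightarrow> rel (eqn (snd v) (Var v) (Var w)))))))"

definition admissible :: "spec \<Rightarrow> bool" where
  "admissible S \<longleftrightarrow>
     (\<forall>i v D. S i = Some (v, D) \<longrightarrow>
        wff {} D \<and> internal D \<and> fv D \<subseteq> {v} \<and> uniquely_specifies v D)"

definition RCA0Omega :: "spec \<Rightarrow> fm set" where
  "RCA0Omega S = RCA0Omega_core (spec_lang S) \<union> spec_axioms S"


section \<open>The principles\<close>

text \<open>A tree is given by its characteristic function on codes of finite sequences.\<close>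

abbreviation In :: "trm \<Rightarrow> trm \<Rightarrow> fm" where
  "In s T \<equiv> (T \<cdot> s \<doteq> succ zero)"

text \<open>\<open>\<alpha>\<close> is a 0-1 sequence.  The bound variable has type 0 and thus differs from the
  variables of type 1 to which this is applied.\<close>

definition bin :: "var \<Rightarrow> fm" where
  "bin \<alpha> = (let i = (9, Num) in All i (Le (Var \<alpha> \<cdot> Var i) (succ zero)))"

text \<open>\<open>T\<close> is 0-1 valued, its elements have only the entries 0 and 1, and it is closed under
  initial segments (stated for removing the last entry).\<close>

definition tree :: "var \<Rightarrow> fm" where
  "tree T = (let s = (7, Num); a = (8, Num) in
     bin T \<^bold>\<and>
     All s (All a (In (snoc (Var s) (Var a)) (Var T) \<^bold>\<longrightarrow>
       In (Var s) (Var T) \<^bold>\<and> Le (Var a) (succ zero))))"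

definition all_paths_leave :: "var \<Rightarrow> fm" where
  "all_paths_leave T = (let \<alpha> = (1, one); n = (0, Num) in
     All \<alpha> (bin \<alpha> \<^bold>\<longrightarrow> Ex n (\<^bold>\<not> (In (bar (Var \<alpha>) (Var n)) (Var T)))))"

text \<open>The bound \<open>k\<close> must not contain the variables bound here.\<close>

definition all_paths_leave_by :: "var \<Rightarrow> trm \<Rightarrow> fm" where
  "all_paths_leave_by T k = (let \<alpha> = (1, one); n = (0, Num) in
     All \<alpha> (bin \<alpha> \<^bold>\<longrightarrow> BEx n k (\<^bold>\<not> (In (bar (Var \<alpha>) (Var n)) (Var T)))))"

definition FAN :: fm where
  "FAN = (let T = (0, one); k = (1, Num) in
     All T (tree T \<^bold>\<longrightarrow> all_paths_leave T \<^bold>\<longrightarrow> Ex k (all_paths_leave_by T (Var k))))"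

text \<open>As \<open>rel FAN\<close>, but with the quantifier over \<open>\<alpha>\<close> in the conclusion over all 0-1 sequences.\<close>

definition FAN_star :: fm where
  "FAN_star = (let T = (0, one); k = (1, Num) in
     AllSt T (rel (tree T) \<^bold>\<longrightarrow> rel (all_paths_leave T) \<^bold>\<longrightarrow>
       ExSt k (all_paths_leave_by T (Var k))))"

text \<open>The functional of type \<open>(1 \<times> 2) \<rightarrow> 0\<close> is taken in curried form.\<close>

definition UFAN2 :: fm where
  "UFAN2 = (let \<Phi> = (0, one \<rightarrow> two \<rightarrow> Num); T = (0, one); g = (0, two); \<alpha> = (1, one) in
     Ex \<Phi> (All T (All g (tree T \<^bold>\<longrightarrow>
       All \<alpha> (bin \<alpha> \<^bold>\<longrightarrow> \<^bold>\<not> (In (bar (Var \<alpha>) (Var g \<cdot> Var \<alpha>)) (Var T))) \<^bold>\<longrightarrow>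
       all_paths_leave_by T (Var \<Phi> \<cdot> Var T \<cdot> Var g)))))"

end

theory Submission
  imports Defs "HOL-Library.Countable"
begin

text \<open>The calculus is complete for extensional many-sorted models, so one can argue in an arbitrary
  model.  There \<open>FAN\<^sup>s\<^sup>t\<close> and \<open>FAN\<^sup>*\<close> both say that a standard tree that all standard
  binary sequences leave has no binary node of length \<open>k\<close>, for some standard \<open>k\<close>: up to \<open>k\<close>, every binary
  sequence agrees with one that is coded by a number below \<open>2\<^sup>k\<close> and hence standard.  If the
  hypotheses of \<open>UFAN\<^sub>2\<^sup>s\<^sup>t\<close> fail for standard \<open>T\<close> and \<open>g\<close>, then a standard object witnesses it;
  so for all standard \<open>T\<close> and \<open>g\<close> there is a standard object that is a bound or such a witness,
  and \<open>HAC\<^sub>i\<^sub>n\<^sub>t\<close> yields a standard functional.  Applied to pairs \<open>(T, g)\<close>, \<open>PF-TP\<^sub>\<forall>\<close> lifts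
  \<open>FAN\<^sup>s\<^sup>t\<close> to \<open>FAN\<close>.

  From \<open>FAN\<close> to \<open>UFAN\<^sub>2\<close> and \<open>FAN\<^sup>s\<^sup>t\<close> there are two cases.  If some \<open>g\<close> of type 2 is
  discontinuous along the sequences that cut off a binary \<open>\<alpha>\<close>, then Grilliot's trick gives a search
  functional \<open>\<mu>\<close>, by \<open>PF-TP\<^sub>\<forall>\<close> a standard one; it finds the bound for a tree, or else
  computes the leftmost path.  Otherwise the witnesses can be taken to be numbers,
  \<open>QF-AC\<^sup>2\<^sup>,\<^sup>0\<close> applies, and by \<open>PF-TP\<^sub>\<forall>\<close> the functional that it gives can be taken
  to be standard.\<close>


section \<open>Translating constants\<close>

text \<open>Induction and choice admit only quantifier-free formulas, while a bound for a tree
  quantifies over sequences. Counting codes (\<open>paths_tm\<close>) makes a bound an equation of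
  type 0, and \<open>wit_tm\<close> does the same for the whole matrix of \<open>UFAN2\<close>: the
  premises on \<open>T\<close> and \<open>g\<close> are no side conditions of choice, but their
  failure is a further alternative that a witness may realize. \<open>PF-TP\<close> allows no
  parameters, so \<open>T\<close> and \<open>g\<close> are packed into one object of type 2.
  \<open>HAC_int\<close> yields finite lists instead of values; a bound is obtained by summing over
  the list, a modulus by testing its entries.

  \<open>QF-AC\<close> at types 2 and 0 chooses numbers, but the failure of a modulus shows at a
  sequence \<alpha>. If \<open>g\<close> has the same value at some cut-off of \<alpha> at or beyond
  \<open>g \<alpha>\<close>, the code of that cut-off is a witness as well. If no such cut-off
  exists for some \<open>g\<close> and \<alpha>, then this is exactly the discontinuity that
  Grilliot's trick exploits; so the two cases are complementary by definition, and no theory of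
  continuity is involved.\<close>

primrec ctm :: "(nat \<Rightarrow> ftyp \<Rightarrow> trm) \<Rightarrow> trm \<Rightarrow> trm" where
  "ctm h (Var v) = Var v"
| "ctm h (Con c) = (case c of CXi i \<sigma> \<Rightarrow> h i \<sigma> | _ \<Rightarrow> Con c)"
| "ctm h (s \<cdot> t) = ctm h s \<cdot> ctm h t"

primrec cfm :: "(nat \<Rightarrow> ftyp \<Rightarrow> trm) \<Rightarrow> fm \<Rightarrow> fm" where
  "cfm h Bot = Bot"
| "cfm h (s \<doteq> t) = (ctm h s \<doteq> ctm h t)"
| "cfm h (St t) = St (ctm h t)"
| "cfm h (\<phi> \<^bold>\<longrightarrow> \<psi>) = (cfm h \<phi> \<^bold>\<longrightarrow> cfm h \<psi>)"
| "cfm h (All v \<phi>) = All v (cfm h \<phi>)"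
| "cfm h (BAll v t \<phi>) = BAll v (ctm h t) (cfm h \<phi>)"

primrec all_vars :: "fm \<Rightarrow> var set" where
  "all_vars Bot = {}"
| "all_vars (s \<doteq> t) = fvt s \<union> fvt t"
| "all_vars (St t) = fvt t"
| "all_vars (\<phi> \<^bold>\<longrightarrow> \<psi>) = all_vars \<phi> \<union> all_vars \<psi>"
| "all_vars (All v \<phi>) = insert v (all_vars \<phi>)"
| "all_vars (BAll v t \<phi>) = insert v (fvt t \<union> all_vars \<phi>)"

lemma finite_fvt: "finite (fvt t)"
  by (induction t) auto

lemma finite_all_vars: "finite (all_vars \<phi>)"
  by (induction \<phi>) (auto simp: finite_fvt)

lemma fv_all_vars: "fv \<phi> \<subseteq> all_vars \<phi>"
  by (induction \<phi>) auto

lemma not_fv: "v \<notin> all_vars \<phi> \<Longrightarrow> v \<notin> fv \<phi>"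
  using fv_all_vars by blast

lemma finite_fv: "finite (fv \<phi>)"
  using finite_subset[OF fv_all_vars finite_all_vars] .

lemma var_bound:
  assumes "finite (V :: var set)"
  shows "\<exists>N. \<forall>v\<in>V. fst v < N"
  using assms
proof (induction V rule: finite_induct)
  case (insert x F)
  then obtain N where "\<forall>v\<in>F. fst v < N" by blast
  then have "\<forall>v\<in>insert x F. fst v < max N (Suc (fst x))" by (auto simp: less_max_iff_disj)
  then show ?case by blast
qed auto

lemma substt_idle: "v \<notin> fvt t \<Longrightarrow> substt v u t = t"
  by (induction t) auto

lemma subst_idle: "v \<notin> fv \<phi> \<Longrightarrow> subst v u \<phi> = \<phi>"
  by (induction \<phi>) (auto simp: substt_idle)

lemma fvt_substt: "fvt (substt v u t) \<subseteq> (fvt t - {v}) \<union> fvt u"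
  by (induction t) auto

lemma ty_substt: "ty u = snd v \<Longrightarrow> ty (substt v u t) = ty t"
  by (induction t) auto

lemma wt_substt: "wt L t \<Longrightarrow> wt L u \<Longrightarrow> ty u = snd v \<Longrightarrow> wt L (substt v u t)"
  by (induction t) (auto simp: ty_substt)

lemma Tm_substt: "t \<in> Tm L \<sigma> \<Longrightarrow> u \<in> Tm L (snd v) \<Longrightarrow> substt v u t \<in> Tm L \<sigma>"
  by (auto simp: Tm_def ty_substt wt_substt)

lemma wff_subst:
  "wff L \<phi> \<Longrightarrow> u \<in> Tm L (snd v) \<Longrightarrow> free_for v u \<phi> \<Longrightarrow> wff L (subst v u \<phi>)"
proof (induction \<phi>)
  case (St t)
  then show ?case by (simp add: Tm_def wt_substt)
next
  case (BAll w t \<phi>)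
  show ?case
  proof (cases "v \<in> fv (BAll w t \<phi>)")
    case True
    then have "w \<notin> fvt u" "free_for v u \<phi>" using BAll.prems by auto
    then show ?thesis using BAll fvt_substt[of v u t] by (auto simp: Tm_substt)
  qed (use BAll.prems(1) in \<open>metis subst_idle\<close>)
next
  case (All w \<phi>)
  show ?case
    using All by (cases "v \<in> fv \<phi>") (auto simp: subst_idle)
qed (auto simp: Tm_substt)

text \<open>The variables of the images lie beyond \<open>N\<close>, hence beyond those of the
  formulas at hand. This excludes capture when constants are replaced under quantifiers.\<close>

definition translates :: "lang \<Rightarrow> lang \<Rightarrow> nat \<Rightarrow> (nat \<Rightarrow> ftyp \<Rightarrow> trm) \<Rightarrow> bool" where
  "translates L L' N h \<longleftrightarrow> (\<forall>i \<sigma>. (i, \<sigma>) \<in> L \<longrightarrow>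
     wt L' (h i \<sigma>) \<and> ty (h i \<sigma>) = \<sigma> \<and> (\<forall>v\<in>fvt (h i \<sigma>). N \<le> fst v))"

lemma translates_mono: "translates L L' N h \<Longrightarrow> M \<le> N \<Longrightarrow> translates L L' M h"
  by (fastforce simp: translates_def)

lemma ctm_wt: "translates L L' N h \<Longrightarrow> wt L t \<Longrightarrow> wt L' (ctm h t) \<and> ty (ctm h t) = ty t"
  by (induction t) (auto simp: translates_def split: const.splits)

lemma ctm_Tm: "translates L L' N h \<Longrightarrow> t \<in> Tm L \<sigma> \<Longrightarrow> ctm h t \<in> Tm L' \<sigma>"
  using ctm_wt by (fastforce simp: Tm_def)

lemma fvt_ctm: "translates L L' N h \<Longrightarrow> wt L t \<Longrightarrow> fst v < N \<Longrightarrow> v \<in> fvt (ctm h t) \<longleftrightarrow> v \<in> fvt t"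
  by (induction t) (force simp: translates_def split: const.splits)+

lemma fv_cfm: "translates L L' N h \<Longrightarrow> wff L \<phi> \<Longrightarrow> fst v < N \<Longrightarrow> v \<in> fv (cfm h \<phi>) \<longleftrightarrow> v \<in> fv \<phi>"
  by (induction \<phi>) (auto simp: fvt_ctm Tm_def)

lemma ctm_substt:
  "translates L L' N h \<Longrightarrow> wt L s \<Longrightarrow> fst v < N \<Longrightarrow>
    ctm h (substt v u s) = substt v (ctm h u) (ctm h s)"
proof (induction s)
  case (Con c)
  then have "v \<notin> fvt (ctm h (Con c))" using fvt_ctm[of L L' N h "Con c" v] by simp
  then have "substt v (ctm h u) (ctm h (Con c)) = ctm h (Con c)" by (rule substt_idle)
  then show ?case by (simp only: substt.simps)
qed auto

lemma cfm_subst: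
  "translates L L' N h \<Longrightarrow> wff L \<phi> \<Longrightarrow> fst v < N \<Longrightarrow>
    cfm h (subst v u \<phi>) = subst v (ctm h u) (cfm h \<phi>)"
  by (induction \<phi>) (auto simp: ctm_substt Tm_def)

lemma cfm_wff:
  "translates L L' N h \<Longrightarrow> wff L \<phi> \<Longrightarrow> \<forall>v\<in>all_vars \<phi>. fst v < N \<Longrightarrow> wff L' (cfm h \<phi>)"
  by (induction \<phi>) (auto simp: ctm_wt ctm_Tm fvt_ctm, auto simp: fvt_ctm Tm_def)

lemma free_for_cfm:
  "translates L L' N h \<Longrightarrow> wff L \<phi> \<Longrightarrow> wt L t \<Longrightarrow> fst v < N \<Longrightarrow> \<forall>v\<in>all_vars \<phi>. fst v < N \<Longrightarrow>
    free_for v t \<phi> \<Longrightarrow> free_for v (ctm h t) (cfm h \<phi>)"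
  by (induction \<phi>) (auto simp: fvt_ctm fv_cfm Tm_def)

lemma ctm_Le: "ctm h (monus_tm \<cdot> s \<cdot> t) = monus_tm \<cdot> ctm h s \<cdot> ctm h t"
  by (simp add: monus_tm_def pred_tm_def Let_def)

text \<open>A derivation mentions finitely many variables, so some \<open>N\<close> lies beyond all
  of them, and images with larger variables respect the side conditions of its axioms. The bound
  \<open>N\<close> comes before \<open>h\<close>, because both uses build \<open>h\<close> from it:
  turning a fresh constant into a variable, and undoing the doubling of indices.\<close>

lemma prv_cfm:
  assumes "prv L Ax \<phi>"
  shows "\<exists>N. \<forall>L' Ax' h. translates L L' N h \<and> (\<forall>\<psi>\<in>Ax. prv L' Ax' (cfm h \<psi>)) \<longrightarrow> prv L' Ax' (cfm h \<phi>)"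
  using assms
proof (induction rule: prv.induct)
  case (imp_K \<phi> \<psi>)
  obtain N where N: "\<forall>v\<in>all_vars \<phi> \<union> all_vars \<psi>. fst v < N"
    using var_bound[of "all_vars \<phi> \<union> all_vars \<psi>"] finite_all_vars by auto
  show ?case
    by (rule exI[of _ N]) (use N imp_K in \<open>auto intro!: prv.imp_K cfm_wff\<close>)
next
  case (imp_S \<phi> \<psi> \<chi>)
  obtain N where N: "\<forall>v\<in>all_vars \<phi> \<union> all_vars \<psi> \<union> all_vars \<chi>. fst v < N"
    using var_bound[of "all_vars \<phi> \<union> all_vars \<psi> \<union> all_vars \<chi>"] finite_all_vars by auto
  show ?case
    by (rule exI[of _ N]) (use N imp_S in \<open>auto intro!: prv.imp_S cfm_wff\<close>)
next
  case (dneg \<phi>)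
  obtain N where N: "\<forall>v\<in>all_vars \<phi>. fst v < N"
    using var_bound[of "all_vars \<phi>"] finite_all_vars by auto
  show ?case
    by (rule exI[of _ N]) (use N dneg in \<open>auto intro!: prv.dneg cfm_wff\<close>)
next
  case (all_inst \<phi> t v)
  obtain N where N: "\<forall>v\<in>insert v (all_vars \<phi>). fst v < N"
    using var_bound[of "insert v (all_vars \<phi>)"] finite_all_vars by auto
  show ?case
    by (rule exI[of _ N])
      (use N all_inst in \<open>auto simp: cfm_subst Tm_def ctm_wt intro!: prv.all_inst cfm_wff free_for_cfm\<close>)
next
  case (all_dist \<phi> \<psi> v)
  obtain N where N: "\<forall>v\<in>insert v (all_vars \<phi> \<union> all_vars \<psi>). fst v < N"
    using var_bound[of "insert v (all_vars \<phi> \<union> all_vars \<psi>)"] finite_all_vars by auto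
  show ?case
    by (rule exI[of _ N])
      (use N all_dist in \<open>auto simp: fv_cfm intro!: prv.all_dist cfm_wff\<close>)
next
  case (ball v t \<phi>)
  obtain N where N: "\<forall>w\<in>all_vars (BAll v t \<phi>). fst w < N"
    using var_bound[of "all_vars (BAll v t \<phi>)"] finite_all_vars by blast
  show ?case
  proof (intro exI[of _ N] allI impI)
    fix L' Ax' h
    assume *: "translates L L' N h \<and> (\<forall>\<psi>\<in>Ax. prv L' Ax' (cfm h \<psi>))"
    have "wff L' (cfm h (BAll v t \<phi>))"
      using * N ball cfm_wff by blast
    then have "prv L' Ax' (BAll v (ctm h t) (cfm h \<phi>) \<^bold>\<longleftrightarrow>
        All v (Le (Var v) (ctm h t) \<^bold>\<longrightarrow> cfm h \<phi>))"
      by (intro prv.ball) simp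
    then show "prv L' Ax' (cfm h (BAll v t \<phi> \<^bold>\<longleftrightarrow> All v (Le (Var v) t \<^bold>\<longrightarrow> \<phi>)))"
      by (simp add: ctm_Le del: ctm.simps(3))
  qed
next
  case (mp \<phi> \<psi>)
  then obtain N M where
    N: "\<forall>L' Ax' h. translates L L' N h \<and> (\<forall>\<psi>\<in>Ax. prv L' Ax' (cfm h \<psi>)) \<longrightarrow> prv L' Ax' (cfm h (\<phi> \<^bold>\<longrightarrow> \<psi>))" and
    M: "\<forall>L' Ax' h. translates L L' M h \<and> (\<forall>\<psi>\<in>Ax. prv L' Ax' (cfm h \<psi>)) \<longrightarrow> prv L' Ax' (cfm h \<phi>)"
    by blast
  show ?case
  proof (intro exI[of _ "max M N"] allI impI)
    fix L' Ax' h
    assume *: "translates L L' (max M N) h \<and> (\<forall>\<psi>\<in>Ax. prv L' Ax' (cfm h \<psi>))"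
    then have "translates L L' N h" "translates L L' M h"
      by (auto intro: translates_mono)
    then show "prv L' Ax' (cfm h \<psi>)"
      using N M * prv.mp[of L' Ax' "cfm h \<phi>" "cfm h \<psi>"] by auto
  qed
next
  case (gen \<phi> v)
  then obtain N where "\<forall>L' Ax' h. translates L L' N h \<and> (\<forall>\<psi>\<in>Ax. prv L' Ax' (cfm h \<psi>)) \<longrightarrow>
      prv L' Ax' (cfm h \<phi>)" by blast
  then show ?case by (intro exI[of _ N]) (simp add: prv.gen)
qed auto


section \<open>Deduction theorem\<close>

lemma prv_mono: "prv L A \<phi> \<Longrightarrow> A \<subseteq> B \<Longrightarrow> prv L B \<phi>"
  by (induction rule: prv.induct) (auto intro: prv.intros)

lemma prv_fin: "prv L A \<phi> \<Longrightarrow> \<exists>F. finite F \<and> F \<subseteq> A \<and> prv L F \<phi>"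
proof (induction rule: prv.induct)
  case (axiom \<phi>)
  then show ?case by (intro exI[of _ "{\<phi>}"]) (auto intro: prv.axiom)
next
  case (mp \<phi> \<psi>)
  then obtain F G where "finite F" "F \<subseteq> A" "prv L F (\<phi> \<^bold>\<longrightarrow> \<psi>)" "finite G" "G \<subseteq> A" "prv L G \<phi>"
    by blast
  then show ?case
    by (intro exI[of _ "F \<union> G"]) (auto intro: prv.mp prv_mono)
qed (blast intro: prv.intros)+

lemma monus_wt: "wt L monus_tm" "ty monus_tm = Num \<rightarrow> Num \<rightarrow> Num" "fvt monus_tm = {}"
  by (simp_all add: monus_tm_def pred_tm_def Let_def)

lemma prv_wff:
  assumes "prv L A \<phi>" and "\<forall>\<psi>\<in>A. wff L \<psi>"
  shows "wff L \<phi>"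
  using assms
proof (induction rule: prv.induct)
  case (all_inst \<phi> t v)
  then show ?case by (simp add: wff_subst)
next
  case (ball v t \<phi>)
  then show ?case by (auto simp: Tm_def monus_wt)
qed auto

lemma imp_refl: "wff L \<phi> \<Longrightarrow> prv L A (\<phi> \<^bold>\<longrightarrow> \<phi>)"
  using prv.mp[OF prv.mp[OF prv.imp_S[of L \<phi> "\<phi> \<^bold>\<longrightarrow> \<phi>" \<phi>] prv.imp_K] prv.imp_K]
  by simp

text \<open>The rule \<open>gen\<close> is unrestricted, so the discharged formula has to be closed:
  \<open>all_dist\<close> then moves it out of the quantifier.\<close>

lemma deduction:
  assumes "prv L (insert \<delta> A) \<phi>" and "wff L \<delta>" and "fv \<delta> = {}" and "\<forall>\<psi>\<in>A. wff L \<psi>"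
  shows "prv L A (\<delta> \<^bold>\<longrightarrow> \<phi>)"
proof -
  have wff: "wff L \<psi>" if "prv L (insert \<delta> A) \<psi>" for \<psi>
    using prv_wff[OF that] assms by auto
  have K: "prv L A (\<delta> \<^bold>\<longrightarrow> \<psi>)" if "prv L A \<psi>" for \<psi>
    using prv.mp[OF prv.imp_K that] assms(2,4) prv_wff that by blast
  show ?thesis
    using assms(1)
  proof (induction rule: prv.induct)
    case (axiom \<phi>)
    then show ?case using imp_refl[OF assms(2)] K prv.axiom by auto
  next
    case (mp \<phi> \<psi>)
    then show ?case
      using prv.mp[OF prv.mp[OF prv.imp_S[OF assms(2)] mp.IH(1)] mp.IH(2)]
        wff[OF mp.hyps(1)] by simp
  next
    case (gen \<phi> v)
    then show ?case
      using prv.mp[OF prv.all_dist[OF assms(2), of \<phi> v] prv.gen] wff assms(3) by auto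
  qed (blast intro: K prv.intros)+
qed

lemma ex_falso: "prv L A Bot \<Longrightarrow> wff L \<phi> \<Longrightarrow> prv L A \<phi>"
  using prv.mp[OF prv.dneg[of L \<phi>] prv.mp[OF prv.imp_K[of L Bot "\<^bold>\<not> \<phi>"]]] by auto

lemma by_contradiction:
  assumes "prv L (insert (\<^bold>\<not> \<phi>) A) Bot" and "wff L \<phi>" and "fv \<phi> = {}" and "\<forall>\<psi>\<in>A. wff L \<psi>"
  shows "prv L A \<phi>"
  using prv.mp[OF prv.dneg[OF assms(2)] deduction[OF assms(1)]] assms by auto


section \<open>Henkin constants\<close>

primrec cst :: "trm \<Rightarrow> (nat \<times> ftyp) set" where
  "cst (Var v) = {}"
| "cst (Con c) = (case c of CXi i \<sigma> \<Rightarrow> {(i, \<sigma>)} | _ \<Rightarrow> {})"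
| "cst (s \<cdot> t) = cst s \<union> cst t"

primrec csf :: "fm \<Rightarrow> (nat \<times> ftyp) set" where
  "csf Bot = {}"
| "csf (s \<doteq> t) = cst s \<union> cst t"
| "csf (St t) = cst t"
| "csf (\<phi> \<^bold>\<longrightarrow> \<psi>) = csf \<phi> \<union> csf \<psi>"
| "csf (All v \<phi>) = csf \<phi>"
| "csf (BAll v t \<phi>) = cst t \<union> csf \<phi>"

lemma finite_cst: "finite (cst t)"
  by (induction t) (auto split: const.splits)

lemma finite_csf: "finite (csf \<phi>)"
  by (induction \<phi>) (auto simp: finite_cst)

definition replace_const :: "nat \<times> ftyp \<Rightarrow> trm \<Rightarrow> nat \<Rightarrow> ftyp \<Rightarrow> trm" where
  "replace_const c u i \<sigma> = (if (i, \<sigma>) = c then u else Con (CXi i \<sigma>))"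

lemma ctm_replace_idle: "c \<notin> cst t \<Longrightarrow> ctm (replace_const c u) t = t"
  by (induction t) (auto simp: replace_const_def split: const.splits)

lemma cfm_replace_idle: "c \<notin> csf \<phi> \<Longrightarrow> cfm (replace_const c u) \<phi> = \<phi>"
  by (induction \<phi>) (auto simp: ctm_replace_idle)

lemma free_for_back: "wff L \<phi> \<Longrightarrow> w \<notin> all_vars \<phi> \<Longrightarrow> free_for w (Var v) (subst v (Var w) \<phi>)"
proof (induction \<phi>)
  case (All x \<phi>)
  then show ?case by (auto simp: not_fv)
next
  case (BAll x t \<phi>)
  then show ?case by (auto simp: not_fv substt_idle)
qed auto

lemma substt_back: "w \<notin> fvt t \<Longrightarrow> substt w (Var v) (substt v (Var w) t) = t"
  by (induction t) auto

lemma subst_back: "w \<notin> all_vars \<phi> \<Longrightarrow> subst w (Var v) (subst v (Var w) \<phi>) = \<phi>"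
  by (induction \<phi>) (auto simp: substt_back subst_idle not_fv)

text \<open>Replacing the constant by a new variable leaves the axioms unchanged and yields a
  derivation to which \<open>gen\<close> applies.\<close>

lemma fresh_constant:
  assumes prv: "prv L A (subst v (Con (CXi i (snd v))) \<chi>)"
    and wff: "wff L \<chi>" "\<forall>\<psi>\<in>A. wff L \<psi>"
    and c: "(i, snd v) \<in> L" "(i, snd v) \<notin> csf \<chi>" "\<forall>\<psi>\<in>A. (i, snd v) \<notin> csf \<psi>"
  shows "prv L A (All v \<chi>)"
proof -
  let ?c = "Con (CXi i (snd v))"
  obtain N where N: "\<forall>L' Ax' h. translates L L' N h \<and> (\<forall>\<psi>\<in>A. prv L' Ax' (cfm h \<psi>)) \<longrightarrow>
      prv L' Ax' (cfm h (subst v ?c \<chi>))"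
    using prv_cfm[OF prv] by blast
  obtain M where M: "\<forall>w\<in>insert v (all_vars \<chi>). fst w < M"
    using var_bound[of "insert v (all_vars \<chi>)"] finite_all_vars by auto
  \<comment> \<open>Beyond \<open>N\<close>, so that the derivation can be translated; beyond
    \<open>M\<close>, so that \<open>w\<close> does not occur in \<chi> and can be renamed back to
    \<open>v\<close>.\<close>
  define w where "w = (max N M, snd v)"
  have w: "w \<notin> all_vars \<chi>" "w \<noteq> v" using M[rule_format, of w] M[rule_format, of v] by (auto simp: w_def prod_eq_iff)
  let ?h = "replace_const (i, snd v) (Var w)"
  have good: "translates L L (max N M) ?h" by (auto simp: translates_def replace_const_def w_def)
  have "prv L A (cfm ?h (subst v ?c \<chi>))"
    using N good c(3) translates_mono[OF good, of N] cfm_replace_idle prv.axiom by (metis max.cobounded1)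
  moreover have "cfm ?h (subst v ?c \<chi>) = subst v (Var w) \<chi>"
    using cfm_subst[OF good wff(1), of v ?c] M cfm_replace_idle[OF c(2)]
    by (simp add: replace_const_def less_max_iff_disj)
  ultimately have "prv L A (All w (subst v (Var w) \<chi>))"
    by (simp add: prv.gen)
  moreover have "wff L (subst v (Var w) \<chi>)"
    using calculation prv_wff wff(2) by fastforce
  ultimately have "prv L A \<chi>"
    using prv.mp[OF prv.all_inst[of L "subst v (Var w) \<chi>" "Var v" w A]]
      free_for_back[OF wff(1) w(1)] subst_back[OF w(1)]
    by (auto simp: w_def Tm_def)
  then show ?thesis by (rule prv.gen)
qed


section \<open>Complete Henkin extensions\<close>

declare split_paired_All [simp del] split_paired_Ex [simp del]

instance ftyp :: countable by countable_datatype
instance const :: countable by countable_datatype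
instance trm :: countable by countable_datatype
instance fm :: countable by countable_datatype

definition sentence :: "lang \<Rightarrow> fm \<Rightarrow> bool" where
  "sentence L \<phi> \<longleftrightarrow> wff L \<phi> \<and> fv \<phi> = {}"

definition CT :: "lang \<Rightarrow> ftyp \<Rightarrow> trm set" where
  "CT L \<sigma> = {t \<in> Tm L \<sigma>. fvt t = {}}"

text \<open>Only the odd indices are counted, as the axioms may use infinitely many constants with
  even index. Finiteness keeps a supply of fresh Henkin constants.\<close>

definition odd_consts :: "fm set \<Rightarrow> nat set" where
  "odd_consts G = {i. odd i \<and> (\<exists>\<tau>. \<exists>\<theta>\<in>G. (i, \<tau>) \<in> csf \<theta>)}"

definition consistent :: "lang \<Rightarrow> fm set \<Rightarrow> bool" where
  "consistent L G \<longleftrightarrow> (\<forall>\<psi>\<in>G. wff L \<psi>) \<and> \<not> prv L G Bot \<and> finite (odd_consts G)"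

text \<open>Negation completeness and the Henkin property are joined so that one enumeration of the
  sentences achieves both. The condition is monotone in \<open>G\<close> and thus survives the union
  of a chain.\<close>

definition decides :: "lang \<Rightarrow> fm set \<Rightarrow> fm \<Rightarrow> bool" where
  "decides L G \<psi> \<longleftrightarrow> \<psi> \<in> G \<or> \<^bold>\<not> \<psi> \<in> G \<and>
     (\<forall>v \<chi>. \<psi> = All v \<chi> \<longrightarrow> (\<exists>t\<in>CT L (snd v). \<^bold>\<not> (subst v t \<chi>) \<in> G))"

lemma free_for_closed: "fvt t = {} \<Longrightarrow> free_for v t \<phi>"
  by (induction \<phi>) auto

lemma fv_subst_closed: "fvt t = {} \<Longrightarrow> fv (subst v t \<phi>) = fv \<phi> - {v}"
proof (induction \<phi>)
  case (Eq s u)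
  have "fvt (substt v t r) = fvt r - {v}" for r
    using Eq by (induction r) auto
  then show ?case by auto
next
  case (St u)
  have "fvt (substt v t r) = fvt r - {v}" for r
    using St by (induction r) auto
  then show ?case by auto
next
  case (BAll w u \<phi>)
  have "fvt (substt v t r) = fvt r - {v}" for r
    using BAll.prems by (induction r) auto
  then show ?case using BAll by auto
qed auto

lemma sentence_subst:
  "sentence L (All v \<chi>) \<Longrightarrow> t \<in> CT L (snd v) \<Longrightarrow> sentence L (subst v t \<chi>)"
  by (auto simp: sentence_def CT_def wff_subst free_for_closed fv_subst_closed)

lemma finite_odd_consts_insert: "finite (odd_consts G) \<Longrightarrow> finite (odd_consts (insert \<psi> G))"
proof -
  assume "finite (odd_consts G)"
  moreover have "odd_consts (insert \<psi> G) \<subseteq> odd_consts G \<union> fst ` csf \<psi>"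
    by (auto simp: odd_consts_def rev_image_eqI)
  ultimately show ?thesis by (meson finite_Un finite_csf finite_imageI finite_subset)
qed

lemma prv_insert_cut:
  assumes "prv L (insert \<psi> G) \<phi>" and "prv L G \<psi>" and "sentence L \<psi>" and "\<forall>\<psi>\<in>G. wff L \<psi>"
  shows "prv L G \<phi>"
  using prv.mp[OF deduction[OF assms(1)] assms(2)] assms(3,4) by (auto simp: sentence_def)

lemma consistent_insert:
  assumes "consistent L G" "sentence L \<psi>" "prv L (insert \<psi> G) Bot"
  shows "prv L G (\<^bold>\<not> \<psi>)"
  using assms deduction by (auto simp: consistent_def sentence_def)

lemma infinite_odd: "infinite {i::nat. odd i}"
proof -
  have "infinite (range (\<lambda>n::nat. 2 * n + 1))"
    by (intro notI, drule finite_imageD) (auto intro: inj_onI)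
  moreover have "range (\<lambda>n::nat. 2 * n + 1) \<subseteq> {i. odd i}" by auto
  ultimately show ?thesis by (meson finite_subset)
qed

lemma henkin_step:
  assumes G: "consistent L G" and \<psi>: "sentence L \<psi>" and L: "\<forall>i \<sigma>. odd i \<longrightarrow> (i, \<sigma>) \<in> L"
  shows "\<exists>G'. G \<subseteq> G' \<and> consistent L G' \<and> decides L G' \<psi>"
proof (cases "prv L (insert \<psi> G) Bot")
  case False
  then have "consistent L (insert \<psi> G)"
    using G \<psi> by (auto simp: consistent_def sentence_def finite_odd_consts_insert)
  then show ?thesis by (intro exI[of _ "insert \<psi> G"]) (auto simp: decides_def)
next
  case True
  then have neg: "prv L G (\<^bold>\<not> \<psi>)" using consistent_insert G \<psi> by blast
  have wff: "\<forall>\<psi>\<in>G. wff L \<psi>" and cons: "\<not> prv L G Bot" using G by (auto simp: consistent_def)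
  have sneg: "sentence L (\<^bold>\<not> \<psi>)" using \<psi> by (simp add: sentence_def)
  have cons': "\<not> prv L (insert (\<^bold>\<not> \<psi>) G) Bot"
    using prv_insert_cut[OF _ neg sneg wff] cons by blast
  show ?thesis
  proof (cases "\<exists>v \<chi>. \<psi> = All v \<chi>")
    case False
    then show ?thesis
      using G cons' sneg
      by (intro exI[of _ "insert (\<^bold>\<not> \<psi>) G"])
        (auto simp: decides_def consistent_def sentence_def finite_odd_consts_insert)
  next
    case True
    then obtain v \<chi> where \<psi>_eq: "\<psi> = All v \<chi>" by blast
    have "finite (odd_consts G \<union> fst ` csf \<chi>)"
      using G finite_csf by (auto simp: consistent_def)
    then obtain i where i: "odd i" "i \<notin> odd_consts G \<union> fst ` csf \<chi>"
      using infinite_odd by (metis (no_types, lifting) finite_subset mem_Collect_eq subsetI)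
    let ?c = "Con (CXi i (snd v))"
    have c: "?c \<in> CT L (snd v)" using i L by (auto simp: CT_def Tm_def)
    let ?\<theta> = "\<^bold>\<not> (subst v ?c \<chi>)"
    have s\<theta>: "sentence L ?\<theta>"
      using sentence_subst[of L v \<chi>, OF _ c] \<psi> \<psi>_eq by (simp add: sentence_def)
    \<comment> \<open>Otherwise \<open>G\<close> proves \<chi> for the constant \<open>?c\<close>,
      which is fresh, and hence proves the universal sentence that it refutes.\<close>
    have "\<not> prv L (insert ?\<theta> G) Bot"
    proof
      assume "prv L (insert ?\<theta> G) Bot"
      then have "prv L G (subst v ?c \<chi>)"
        using by_contradiction s\<theta> wff by (auto simp: sentence_def)
      then have "prv L G (All v \<chi>)"
      proof (rule fresh_constant)
        show "wff L \<chi>" using \<psi> \<psi>_eq by (simp add: sentence_def)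
        show "(i, snd v) \<in> L" using i L by blast
        show "(i, snd v) \<notin> csf \<chi>" using i(2) by (metis UnI2 fst_conv image_eqI)
        show "\<forall>\<psi>\<in>G. (i, snd v) \<notin> csf \<psi>" using i by (auto simp: odd_consts_def)
      qed (rule wff)
      then show False using neg prv.mp cons \<psi>_eq by blast
    qed
    then have cons'': "\<not> prv L (insert (\<^bold>\<not> \<psi>) (insert ?\<theta> G)) Bot"
      using prv_insert_cut[of L "\<^bold>\<not> \<psi>" "insert ?\<theta> G" Bot] prv_mono[OF neg] sneg s\<theta> wff
      by (auto simp: sentence_def)
    have "consistent L (insert (\<^bold>\<not> \<psi>) (insert ?\<theta> G))"
      using G cons'' sneg s\<theta>
      by (simp add: consistent_def sentence_def finite_odd_consts_insert)
    moreover have "decides L (insert (\<^bold>\<not> \<psi>) (insert ?\<theta> G)) \<psi>"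
      using c \<psi>_eq by (auto simp: decides_def)
    ultimately show ?thesis
      by (intro exI[of _ "insert (\<^bold>\<not> \<psi>) (insert ?\<theta> G)"]) auto
  qed
qed

lemma decides_mono: "decides L G \<psi> \<Longrightarrow> G \<subseteq> H \<Longrightarrow> decides L H \<psi>"
  unfolding decides_def by blast

lemma finite_subset_chain:
  assumes "finite F" "F \<subseteq> (\<Union>n. G n)" "\<And>n. G n \<subseteq> G (Suc n)"
  shows "\<exists>n. F \<subseteq> G (n::nat)"
  using assms(1,2)
proof (induction F rule: finite_induct)
  case (insert x F)
  then obtain n m where "F \<subseteq> G n" "x \<in> G m" by auto
  moreover have "G n \<subseteq> G (max n m)" "G m \<subseteq> G (max n m)"
    using lift_Suc_mono_le[of G, OF assms(3)] by auto
  ultimately show ?case by blast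
qed auto

text \<open>Lindenbaum's construction along the countable enumeration \<open>from_nat\<close> of the
  formulas. A derivation of \<open>Bot\<close> from the union uses finitely many formulas and so
  exists at a finite stage.\<close>

lemma henkin_extension:
  assumes A: "\<forall>\<psi>\<in>A. wff L \<psi>" "odd_consts A = {}" and \<phi>: "sentence L \<phi>" and np: "\<not> prv L A \<phi>"
    and L: "\<forall>i \<sigma>. odd i \<longrightarrow> (i, \<sigma>) \<in> L"
  shows "\<exists>\<Gamma>. A \<subseteq> \<Gamma> \<and> \<^bold>\<not> \<phi> \<in> \<Gamma> \<and> (\<forall>\<psi>\<in>\<Gamma>. wff L \<psi>) \<and> \<not> prv L \<Gamma> Bot \<and>
    (\<forall>\<psi>. sentence L \<psi> \<longrightarrow> decides L \<Gamma> \<psi>)"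
proof -
  have "\<not> prv L (insert (\<^bold>\<not> \<phi>) A) Bot"
    using by_contradiction np \<phi> A by (auto simp: sentence_def)
  then have c0: "consistent L (insert (\<^bold>\<not> \<phi>) A)"
    using A \<phi> by (auto simp: consistent_def sentence_def finite_odd_consts_insert)
  have "\<exists>G. \<forall>n. (consistent L (G n) \<and> (n = 0 \<longrightarrow> G n = insert (\<^bold>\<not> \<phi>) A)) \<and>
      (G n \<subseteq> G (Suc n) \<and> (sentence L (from_nat n) \<longrightarrow> decides L (G (Suc n)) (from_nat n)))"
  proof (rule dependent_nat_choice)
    show "\<exists>x. consistent L x \<and> (0 = (0::nat) \<longrightarrow> x = insert (\<^bold>\<not> \<phi>) A)" using c0 by blast
    fix x and n :: nat
    assume x: "consistent L x \<and> (n = 0 \<longrightarrow> x = insert (\<^bold>\<not> \<phi>) A)"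
    show "\<exists>y. (consistent L y \<and> (Suc n = 0 \<longrightarrow> y = insert (\<^bold>\<not> \<phi>) A)) \<and> x \<subseteq> y \<and>
        (sentence L (from_nat n) \<longrightarrow> decides L y (from_nat n))"
    proof (cases "sentence L (from_nat n)")
      case True
      then obtain y where "x \<subseteq> y" "consistent L y" "decides L y (from_nat n)"
        using henkin_step[OF _ _ L, of x "from_nat n"] x by auto
      then show ?thesis by (intro exI[of _ y]) simp
    next
      case False
      then show ?thesis using x by (intro exI[of _ x]) simp
    qed
  qed
  then obtain G where G0: "\<forall>n. (consistent L (G n) \<and> (n = 0 \<longrightarrow> G n = insert (\<^bold>\<not> \<phi>) A)) \<and>
      (G n \<subseteq> G (Suc n) \<and> (sentence L (from_nat n) \<longrightarrow> decides L (G (Suc n)) (from_nat n)))" ..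
  have G: "consistent L (G n)" "G 0 = insert (\<^bold>\<not> \<phi>) A" "G n \<subseteq> G (Suc n)"
    "sentence L (from_nat n) \<Longrightarrow> decides L (G (Suc n)) (from_nat n)" for n
    using spec[OF G0, of n] spec[OF G0, of 0] by simp_all
  let ?\<Gamma> = "\<Union>n. G n"
  have "\<not> prv L ?\<Gamma> Bot"
  proof
    assume "prv L ?\<Gamma> Bot"
    from prv_fin[OF this] obtain F where F: "finite F" "F \<subseteq> ?\<Gamma>" "prv L F Bot" by (elim exE conjE)
    from finite_subset_chain[OF F(1,2) G(3)] obtain n where "F \<subseteq> G n" ..
    then show False using prv_mono[OF F(3), of "G n"] G(1)[of n] by (simp add: consistent_def)
  qed
  moreover have "decides L ?\<Gamma> \<psi>" if "sentence L \<psi>" for \<psi>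
    by (rule decides_mono[of L "G (Suc (to_nat \<psi>))"]) (use G(4)[of "to_nat \<psi>"] that in auto)
  moreover have "insert (\<^bold>\<not> \<phi>) A \<subseteq> ?\<Gamma>" unfolding G(2)[symmetric] by blast
  moreover have "\<forall>\<psi>\<in>?\<Gamma>. wff L \<psi>" using G(1) by (auto simp: consistent_def)
  ultimately show ?thesis by (intro exI[of _ ?\<Gamma>]) auto
qed


section \<open>Satisfaction\<close>

primrec eval :: "('e \<Rightarrow> 'e \<Rightarrow> 'e) \<Rightarrow> (const \<Rightarrow> 'e) \<Rightarrow> (var \<Rightarrow> 'e) \<Rightarrow> trm \<Rightarrow> 'e" where
  "eval ap I \<rho> (Var v) = \<rho> v"
| "eval ap I \<rho> (Con c) = I c"
| "eval ap I \<rho> (s \<cdot> t) = ap (eval ap I \<rho> s) (eval ap I \<rho> t)"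

text \<open>Equality is a parameter \<open>E\<close>: it is provable equality in the term model and
  becomes identity only in the quotient. The clause for \<open>BAll\<close> follows the axiom
  \<open>ball\<close>, with the defined term \<open>monus_tm\<close> evaluated in the
  structure.\<close>

primrec sat :: "(ftyp \<Rightarrow> 'e set) \<Rightarrow> ('e \<Rightarrow> 'e \<Rightarrow> 'e) \<Rightarrow> (const \<Rightarrow> 'e) \<Rightarrow> ('e \<Rightarrow> 'e \<Rightarrow> bool) \<Rightarrow>
    ('e \<Rightarrow> bool) \<Rightarrow> (var \<Rightarrow> 'e) \<Rightarrow> fm \<Rightarrow> bool" where
  "sat D ap I E ST \<rho> Bot \<longleftrightarrow> False"
| "sat D ap I E ST \<rho> (s \<doteq> t) \<longleftrightarrow> E (eval ap I \<rho> s) (eval ap I \<rho> t)"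
| "sat D ap I E ST \<rho> (St t) \<longleftrightarrow> ST (eval ap I \<rho> t)"
| "sat D ap I E ST \<rho> (\<phi> \<^bold>\<longrightarrow> \<psi>) \<longleftrightarrow> (sat D ap I E ST \<rho> \<phi> \<longrightarrow> sat D ap I E ST \<rho> \<psi>)"
| "sat D ap I E ST \<rho> (All v \<phi>) \<longleftrightarrow> (\<forall>a\<in>D (snd v). sat D ap I E ST (\<rho>(v := a)) \<phi>)"
| "sat D ap I E ST \<rho> (BAll v t \<phi>) \<longleftrightarrow>
     (\<forall>a\<in>D (snd v). E (ap (ap (eval ap I \<rho> monus_tm) a) (eval ap I \<rho> t)) (I CZero) \<longrightarrow>
        sat D ap I E ST (\<rho>(v := a)) \<phi>)"

lemma eval_cong: "\<forall>v\<in>fvt t. \<rho> v = \<rho>' v \<Longrightarrow> eval ap I \<rho> t = eval ap I \<rho>' t"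
  by (induction t) auto

lemma sat_cong:
  "\<forall>v\<in>fv \<phi>. \<rho> v = \<rho>' v \<Longrightarrow> sat D ap I E ST \<rho> \<phi> \<longleftrightarrow> sat D ap I E ST \<rho>' \<phi>"
proof (induction \<phi> arbitrary: \<rho> \<rho>')
  case (Eq s t)
  then show ?case using eval_cong[of s \<rho> \<rho>'] eval_cong[of t \<rho> \<rho>'] by auto
next
  case (St t)
  then show ?case using eval_cong[of t \<rho> \<rho>'] by auto
next
  case (All v \<phi>)
  have "sat D ap I E ST (\<rho>(v := a)) \<phi> \<longleftrightarrow> sat D ap I E ST (\<rho>'(v := a)) \<phi>" for a
    using All.prems by (intro All.IH) auto
  then show ?case by simp
next
  case (BAll v t \<phi>)
  have "sat D ap I E ST (\<rho>(v := a)) \<phi> \<longleftrightarrow> sat D ap I E ST (\<rho>'(v := a)) \<phi>" for a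
    using BAll.prems by (intro BAll.IH) auto
  moreover have "eval ap I \<rho> t = eval ap I \<rho>' t" "eval ap I \<rho> monus_tm = eval ap I \<rho>' monus_tm"
    using BAll.prems by (auto intro!: eval_cong simp: monus_wt)
  ultimately show ?case by simp
next
  case (Imp \<phi> \<psi>)
  show ?case using Imp.IH[of \<rho> \<rho>'] Imp.prems by simp
qed simp

lemma sat_closure:
  assumes "sat D ap I E ST \<rho> (foldr All vs \<phi>)" "\<forall>v. \<rho>' v \<in> D (snd v)" "\<forall>v\<in>fv \<phi> - set vs. \<rho> v = \<rho>' v"
  shows "sat D ap I E ST \<rho>' \<phi>"
  using assms
proof (induction vs arbitrary: \<rho>)
  case Nil
  then show ?case using sat_cong[of \<phi> \<rho> \<rho>'] by simp
next
  case (Cons v vs)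
  show ?case
    by (rule Cons.IH[of "\<rho>(v := \<rho>' v)"]) (use Cons.prems in \<open>simp_all del: fun_upd_apply\<close>, simp)
qed


section \<open>The term model\<close>

text \<open>The indices of the given constants are doubled, so that the odd ones are free for Henkin
  constants.\<close>

fun dblc :: "const \<Rightarrow> const" where
  "dblc (CXi i \<sigma>) = CXi (2 * i) \<sigma>"
| "dblc c = c"

abbreviation dbl :: "(var \<Rightarrow> trm) \<Rightarrow> trm \<Rightarrow> trm" where
  "dbl \<equiv> eval App (Con \<circ> dblc)"

primrec psf :: "(var \<Rightarrow> trm) \<Rightarrow> fm \<Rightarrow> fm" where
  "psf \<rho> Bot = Bot"
| "psf \<rho> (s \<doteq> t) = (dbl \<rho> s \<doteq> dbl \<rho> t)"
| "psf \<rho> (St t) = St (dbl \<rho> t)"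
| "psf \<rho> (\<phi> \<^bold>\<longrightarrow> \<psi>) = (psf \<rho> \<phi> \<^bold>\<longrightarrow> psf \<rho> \<psi>)"
| "psf \<rho> (All v \<phi>) = All v (psf (\<rho>(v := Var v)) \<phi>)"
| "psf \<rho> (BAll v t \<phi>) = BAll v (dbl \<rho> t) (psf (\<rho>(v := Var v)) \<phi>)"

definition lang2 :: "lang \<Rightarrow> lang" where
  "lang2 L = {(i, \<sigma>). odd i \<or> (i div 2, \<sigma>) \<in> L}"

text \<open>This makes the substitution \<open>psf\<close> free of capture: the value at
  \<open>v\<close> contains no variable but \<open>v\<close>, and \<open>psf\<close> resets
  \<open>v\<close> when it passes a quantifier over it.\<close>

definition near :: "lang \<Rightarrow> (var \<Rightarrow> trm) \<Rightarrow> bool" where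
  "near L \<rho> \<longleftrightarrow> (\<forall>v. \<rho> v \<in> Tm L (snd v) \<and> fvt (\<rho> v) \<subseteq> {v})"

lemma near_upd: "near L \<rho> \<Longrightarrow> near L (\<rho>(v := Var v))"
  by (auto simp: near_def Tm_def)

lemma near_Var: "near L Var"
  by (auto simp: near_def Tm_def)

lemma dbl_wt: "near (lang2 L) \<rho> \<Longrightarrow> wt L t \<Longrightarrow> wt (lang2 L) (dbl \<rho> t) \<and> ty (dbl \<rho> t) = ty t"
proof (induction t)
  case (Con c)
  then show ?case by (cases c) (auto simp: lang2_def)
qed (auto simp: near_def Tm_def)

lemma dbl_Tm: "near (lang2 L) \<rho> \<Longrightarrow> t \<in> Tm L \<sigma> \<Longrightarrow> dbl \<rho> t \<in> Tm (lang2 L) \<sigma>"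
  using dbl_wt by (auto simp: Tm_def)

lemma fvt_dbl: "fvt (dbl \<rho> t) = (\<Union>v\<in>fvt t. fvt (\<rho> v))"
  by (induction t) auto

lemma fv_psf: "fv (psf \<rho> \<phi>) \<subseteq> (\<Union>v\<in>fv \<phi>. fvt (\<rho> v))"
proof (induction \<phi> arbitrary: \<rho>)
  case (All v \<phi>)
  show ?case using All[of "\<rho>(v := Var v)"] by (fastforce split: if_splits)
next
  case (BAll v t \<phi>)
  show ?case using BAll[of "\<rho>(v := Var v)"] by (fastforce simp: fvt_dbl split: if_splits)
qed (auto simp: fvt_dbl, blast+)

lemma wff_psf: "near (lang2 L) \<rho> \<Longrightarrow> wff L \<phi> \<Longrightarrow> wff (lang2 L) (psf \<rho> \<phi>)"
proof (induction \<phi> arbitrary: \<rho>)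
  case (BAll v t \<phi>)
  have "v \<notin> fvt (dbl \<rho> t)" using BAll.prems by (auto simp: near_def fvt_dbl)
  then show ?case using BAll.prems BAll.IH[OF near_upd[OF BAll.prems(1)]]
    by (simp add: dbl_Tm del: fun_upd_apply)
qed (auto simp: dbl_Tm dbl_wt near_upd)

lemma substt_dbl: "substt v t (dbl \<rho> s) = dbl (\<lambda>w. substt v t (\<rho> w)) s"
  by (induction s) auto

lemma subst_psf:
  "near L \<rho> \<Longrightarrow> fvt t = {} \<Longrightarrow> t \<in> Tm L (snd v) \<Longrightarrow>
    subst v t (psf \<rho> \<phi>) = psf (\<lambda>w. substt v t (\<rho> w)) \<phi>"
proof -
  have upd: "(\<lambda>u. substt v t ((\<rho>(w := Var w)) u)) = (\<lambda>u. substt v t (\<rho> u))(w := Var w)"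
    if "w \<noteq> v" for \<rho> w using that by auto
  have same: "\<rho>(v := Var v) = (\<lambda>u. substt v t (\<rho> u))(v := Var v)" if "near L \<rho>" for \<rho>
    using that by (auto simp: near_def fun_eq_iff intro!: substt_idle[symmetric])
  show "near L \<rho> \<Longrightarrow> fvt t = {} \<Longrightarrow> t \<in> Tm L (snd v) \<Longrightarrow> ?thesis"
  proof (induction \<phi> arbitrary: \<rho>)
    case (All w \<phi>)
    then show ?case using same[OF All.prems(1)] upd[of w \<rho>] All.IH[OF near_upd[OF All.prems(1)]]
      by (cases "w = v") (simp_all del: fun_upd_apply)
  next
    case (BAll w s \<phi>)
    then show ?case using same[OF BAll.prems(1)] upd[of w \<rho>] BAll.IH[OF near_upd[OF BAll.prems(1)]]
      by (cases "w = v") (simp_all add: substt_dbl del: fun_upd_apply)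
  qed (auto simp: substt_dbl)
qed

lemma dbl_cong: "\<forall>v\<in>fvt t. \<rho> v = \<rho>' v \<Longrightarrow> dbl \<rho> t = dbl \<rho>' t"
  by (rule eval_cong)

lemma psf_cong: "\<forall>v\<in>fv \<phi>. \<rho> v = \<rho>' v \<Longrightarrow> psf \<rho> \<phi> = psf \<rho>' \<phi>"
proof (induction \<phi> arbitrary: \<rho> \<rho>')
  case (All v \<phi>)
  have "psf (\<rho>(v := Var v)) \<phi> = psf (\<rho>'(v := Var v)) \<phi>"
    by (rule All.IH) (use All.prems in auto)
  then show ?case by simp
next
  case (BAll v t \<phi>)
  have "psf (\<rho>(v := Var v)) \<phi> = psf (\<rho>'(v := Var v)) \<phi>"
    by (rule BAll.IH) (use BAll.prems in auto)
  then show ?case using dbl_cong[of t \<rho> \<rho>'] BAll.prems by simp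
next
  case (Eq s t)
  then show ?case using dbl_cong[of s \<rho> \<rho>'] dbl_cong[of t \<rho> \<rho>'] by simp
next
  case (St t)
  then show ?case using dbl_cong[of t \<rho> \<rho>'] by simp
next
  case (Imp \<phi> \<psi>)
  show ?case using Imp.IH[of \<rho> \<rho>'] Imp.prems by simp
qed auto

definition undouble :: "nat \<Rightarrow> nat \<Rightarrow> ftyp \<Rightarrow> trm" where
  "undouble N i \<sigma> = (if even i then Con (CXi (i div 2) \<sigma>) else Var (N + i, \<sigma>))"

lemma undouble_dbl: "ctm (undouble N) (dbl Var t) = t"
proof (induction t)
  case (Con c)
  then show ?case by (cases c) (auto simp: undouble_def)
qed auto

lemma undouble_psf: "cfm (undouble N) (psf Var \<phi>) = \<phi>"
  by (induction \<phi>) (auto simp: undouble_dbl)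

text \<open>Even constants are halved and odd ones become variables beyond those of the derivation,
  so the additional Henkin constants prove nothing new about doubled formulas.\<close>

lemma prv_undouble:
  assumes "prv (lang2 L) (psf Var ` A) (psf Var \<phi>)"
  shows "prv L A \<phi>"
proof -
  obtain N where N: "\<forall>L' Ax' h. translates (lang2 L) L' N h \<and> (\<forall>\<psi>\<in>psf Var ` A. prv L' Ax' (cfm h \<psi>)) \<longrightarrow>
      prv L' Ax' (cfm h (psf Var \<phi>))"
    using prv_cfm[OF assms] by blast
  have "translates (lang2 L) L N (undouble N)"
    by (auto simp: translates_def lang2_def undouble_def)
  moreover have "\<forall>\<psi>\<in>psf Var ` A. prv L A (cfm (undouble N) \<psi>)"
    by (auto simp: undouble_psf prv.axiom)
  ultimately show ?thesis using N undouble_psf by metis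
qed

lemma cst_dbl: "(i, \<sigma>) \<in> cst (dbl Var t) \<Longrightarrow> even i"
proof (induction t)
  case (Con c)
  then show ?case by (cases c) auto
qed auto

lemma csf_psf: "(i, \<sigma>) \<in> csf (psf Var \<phi>) \<Longrightarrow> even i"
  by (induction \<phi>) (auto simp: cst_dbl)

lemma zero_tm_CT: "zero_tm \<sigma> \<in> CT L \<sigma>"
  by (induction \<sigma>) (auto simp: CT_def Tm_def)

lemma dbl_monus: "dbl \<rho> monus_tm = monus_tm"
  by (simp add: monus_tm_def pred_tm_def Let_def)

locale henkin =
  fixes L :: lang and \<Gamma> :: "fm set"
  assumes wff_\<Gamma>: "\<psi> \<in> \<Gamma> \<Longrightarrow> wff (lang2 L) \<psi>"
    and consistent_\<Gamma>: "\<not> prv (lang2 L) \<Gamma> Bot"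
    and decides_\<Gamma>: "sentence (lang2 L) \<psi> \<Longrightarrow> decides (lang2 L) \<Gamma> \<psi>"
begin

abbreviation "L2 \<equiv> lang2 L"
abbreviation "Th \<equiv> prv L2 \<Gamma>"

lemma Th_neg: "sentence L2 \<psi> \<Longrightarrow> Th (\<^bold>\<not> \<psi>) \<longleftrightarrow> \<not> Th \<psi>"
  using decides_\<Gamma>[of \<psi>] consistent_\<Gamma> prv.mp[of L2 \<Gamma> \<psi> Bot] prv.axiom[of _ \<Gamma>]
  by (auto simp: decides_def)

lemma Th_imp:
  assumes "sentence L2 \<phi>" "sentence L2 \<psi>"
  shows "Th (\<phi> \<^bold>\<longrightarrow> \<psi>) \<longleftrightarrow> (Th \<phi> \<longrightarrow> Th \<psi>)"
proof
  assume *: "Th \<phi> \<longrightarrow> Th \<psi>"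
  show "Th (\<phi> \<^bold>\<longrightarrow> \<psi>)"
  proof (cases "Th \<phi>")
    case True
    then show ?thesis using * assms prv.mp[OF prv.imp_K[of L2 \<psi> \<phi>]] by (auto simp: sentence_def)
  next
    case False
    then have "Th (\<^bold>\<not> \<phi>)" using Th_neg assms by blast
    then have "prv L2 (insert \<phi> \<Gamma>) Bot"
      using prv.mp[OF prv_mono[of L2 \<Gamma> "\<^bold>\<not> \<phi>" "insert \<phi> \<Gamma>"] prv.axiom[of \<phi>]] by auto
    then have "prv L2 (insert \<phi> \<Gamma>) \<psi>" using ex_falso assms by (auto simp: sentence_def)
    then show ?thesis using deduction assms wff_\<Gamma> by (auto simp: sentence_def)
  qed
qed (use prv.mp in blast)

lemma Th_inst: "Th (All v \<chi>) \<Longrightarrow> t \<in> CT L2 (snd v) \<Longrightarrow> wff L2 \<chi> \<Longrightarrow> Th (subst v t \<chi>)"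
  using prv.mp[OF prv.all_inst[of L2 \<chi> t v \<Gamma>]] by (auto simp: CT_def free_for_closed)

text \<open>From right to left this is the Henkin part of \<open>decides\<close>: if the universal
  sentence is no theorem, then some closed instance is refuted.\<close>

lemma Th_all:
  assumes "sentence L2 (All v \<chi>)"
  shows "Th (All v \<chi>) \<longleftrightarrow> (\<forall>t\<in>CT L2 (snd v). Th (subst v t \<chi>))"
proof
  assume *: "\<forall>t\<in>CT L2 (snd v). Th (subst v t \<chi>)"
  show "Th (All v \<chi>)"
  proof (rule ccontr)
    assume n: "\<not> Th (All v \<chi>)"
    then have "All v \<chi> \<notin> \<Gamma>" using prv.axiom by blast
    then obtain t where "t \<in> CT L2 (snd v)" "\<^bold>\<not> (subst v t \<chi>) \<in> \<Gamma>"
      using decides_\<Gamma>[OF assms] by (auto simp: decides_def)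
    then show False using * consistent_\<Gamma> prv.mp prv.axiom by blast
  qed
qed (use assms Th_inst in \<open>auto simp: sentence_def\<close>)

lemma Th_ball:
  assumes "sentence L2 (BAll v t \<chi>)"
  shows "Th (BAll v t \<chi>) \<longleftrightarrow> (\<forall>a\<in>CT L2 Num. Th (monus_tm \<cdot> a \<cdot> t \<doteq> zero) \<longrightarrow> Th (subst v a \<chi>))"
proof -
  have t: "fvt t = {}" "t \<in> Tm L2 Num" "snd v = Num" "wff L2 \<chi>" "fv \<chi> \<subseteq> {v}"
    using assms by (auto simp: sentence_def)
  let ?\<psi> = "All v (Le (Var v) t \<^bold>\<longrightarrow> \<chi>)"
  have s: "sentence L2 ?\<psi>"
    using t by (auto simp: sentence_def Tm_def monus_wt)
  have "Th ((BAll v t \<chi> \<^bold>\<longrightarrow> ?\<psi>) \<^bold>\<and> (?\<psi> \<^bold>\<longrightarrow> BAll v t \<chi>))"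
    using prv.ball[of L2 v t \<chi> \<Gamma>] assms by (auto simp: sentence_def)
  moreover have imp: "sentence L2 (BAll v t \<chi> \<^bold>\<longrightarrow> ?\<psi>)" "sentence L2 (?\<psi> \<^bold>\<longrightarrow> BAll v t \<chi>)"
    using s assms by (auto simp: sentence_def)
  moreover have "sentence L2 ((BAll v t \<chi> \<^bold>\<longrightarrow> ?\<psi>) \<^bold>\<longrightarrow> \<^bold>\<not> (?\<psi> \<^bold>\<longrightarrow> BAll v t \<chi>))"
    "sentence L2 (\<^bold>\<not> (?\<psi> \<^bold>\<longrightarrow> BAll v t \<chi>))"
    using imp by (auto simp: sentence_def)
  ultimately have "Th (BAll v t \<chi> \<^bold>\<longrightarrow> ?\<psi>) \<and> Th (?\<psi> \<^bold>\<longrightarrow> BAll v t \<chi>)"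
    using Th_neg Th_imp by metis
  then have "Th (BAll v t \<chi>) \<longleftrightarrow> Th ?\<psi>" using prv.mp by blast
  also have "\<dots> \<longleftrightarrow> (\<forall>a\<in>CT L2 Num. Th (Le a t \<^bold>\<longrightarrow> subst v a \<chi>))"
    using Th_all[OF s] t by (simp add: substt_idle monus_wt)
  also have "\<dots> \<longleftrightarrow> (\<forall>a\<in>CT L2 Num. Th (monus_tm \<cdot> a \<cdot> t \<doteq> zero) \<longrightarrow> Th (subst v a \<chi>))"
  proof (rule ball_cong[OF refl])
    fix a assume a: "a \<in> CT L2 Num"
    have "sentence L2 (subst v a \<chi>)"
      using sentence_subst[of L2 v \<chi> a] t a by (auto simp: sentence_def)
    moreover have "sentence L2 (Le a t)"
      using t a by (auto simp: sentence_def CT_def Tm_def monus_wt)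
    ultimately show "Th (Le a t \<^bold>\<longrightarrow> subst v a \<chi>) \<longleftrightarrow> (Th (Le a t) \<longrightarrow> Th (subst v a \<chi>))"
      using Th_imp by blast
  qed
  finally show ?thesis .
qed

abbreviation sat1 :: "(var \<Rightarrow> trm) \<Rightarrow> fm \<Rightarrow> bool" where
  "sat1 \<equiv> sat (CT L2) App (Con \<circ> dblc) (\<lambda>s t. Th (s \<doteq> t)) (\<lambda>t. Th (St t))"

definition cval :: "(var \<Rightarrow> trm) \<Rightarrow> bool" where
  "cval \<rho> \<longleftrightarrow> (\<forall>v. \<rho> v \<in> CT L2 (snd v))"

lemma cval_upd: "cval \<rho> \<Longrightarrow> a \<in> CT L2 (snd v) \<Longrightarrow> cval (\<rho>(v := a))"
  by (simp add: cval_def)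

lemma cval_near: "cval \<rho> \<Longrightarrow> near L2 \<rho>"
  by (auto simp: cval_def near_def CT_def)

lemma cval_sentence: "cval \<rho> \<Longrightarrow> wff L \<phi> \<Longrightarrow> sentence L2 (psf \<rho> \<phi>)"
  using fv_psf[of \<rho> \<phi>] wff_psf[OF cval_near] by (auto simp: sentence_def cval_def CT_def)

lemma psf_upd:
  assumes "cval \<rho>" "a \<in> CT L2 (snd v)"
  shows "subst v a (psf (\<rho>(v := Var v)) \<phi>) = psf (\<rho>(v := a)) \<phi>"
proof -
  have "(\<lambda>w. substt v a ((\<rho>(v := Var v)) w)) = \<rho>(v := a)"
    using assms by (auto simp: fun_eq_iff cval_def CT_def intro!: substt_idle)
  then show ?thesis
    using subst_psf[OF near_upd[OF cval_near[OF assms(1)]], of a v v \<phi>] assms(2) by (simp add: CT_def)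
qed

lemma truth: "cval \<rho> \<Longrightarrow> wff L \<phi> \<Longrightarrow> sat1 \<rho> \<phi> \<longleftrightarrow> Th (psf \<rho> \<phi>)"
proof (induction \<phi> arbitrary: \<rho>)
  case Bot
  then show ?case using consistent_\<Gamma> by simp
next
  case (Imp \<phi> \<psi>)
  then show ?case using cval_sentence Th_imp by simp
next
  case (All v \<phi>)
  have "sentence L2 (All v (psf (\<rho>(v := Var v)) \<phi>))" using cval_sentence[OF All.prems] by simp
  then show ?case using All.IH[OF cval_upd] All.prems psf_upd by (simp add: Th_all del: fun_upd_apply)
next
  case (BAll v t \<phi>)
  have "sentence L2 (BAll v (dbl \<rho> t) (psf (\<rho>(v := Var v)) \<phi>))"
    using cval_sentence[OF BAll.prems] by simp
  then show ?case using BAll.IH[OF cval_upd] BAll.prems psf_upd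
    by (simp add: Th_ball dbl_monus[unfolded comp_def] comp_def del: fun_upd_apply)
qed auto

text \<open>An axiom may be open, and then \<Gamma> contains it under \<open>Var\<close> but not
  under \<rho>. Its universal closure is the same under both assignments, so \<open>truth\<close>
  applies to the closure.\<close>

lemma sat1_axiom:
  assumes "psf Var \<psi> \<in> \<Gamma>" and "wff L \<psi>" and "cval \<rho>"
  shows "sat1 \<rho> \<psi>"
proof -
  obtain vs where vs: "set vs = fv \<psi>" using finite_list[OF finite_fv] by blast
  have "Th (psf Var \<psi>)" using assms(1) prv.axiom by blast
  then have "Th (psf Var (foldr All vs \<psi>))"
    by (induction vs) (auto intro: prv.gen)
  moreover have "fv (foldr All ws \<psi>) = fv \<psi> - set ws" for ws
    by (induction ws) auto
  then have "psf Var (foldr All vs \<psi>) = psf \<rho> (foldr All vs \<psi>)"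
    using vs by (intro psf_cong) auto
  moreover have "wff L (foldr All ws \<psi>)" for ws
    using assms(2) by (induction ws) auto
  ultimately have "sat1 \<rho> (foldr All vs \<psi>)" using truth[OF assms(3)] by metis
  then show ?thesis
    by (rule sat_closure) (use assms(3) vs in \<open>auto simp: cval_def\<close>)
qed

end

theorem term_model:
  assumes "\<forall>\<psi>\<in>A. wff L \<psi>" and "sentence L \<phi>" and "\<not> prv L A \<phi>"
  shows "\<exists>\<Gamma>. henkin L \<Gamma> \<and> (\<forall>\<psi>\<in>A. psf Var \<psi> \<in> \<Gamma>) \<and> \<not> prv (lang2 L) \<Gamma> (psf Var \<phi>)"
proof -
  have np: "\<not> prv (lang2 L) (psf Var ` A) (psf Var \<phi>)" using assms(3) prv_undouble by blast
  have s: "sentence (lang2 L) (psf Var \<phi>)"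
    using assms(2) fv_psf[of Var \<phi>] wff_psf[OF near_Var] by (auto simp: sentence_def)
  obtain \<Gamma> where \<Gamma>: "psf Var ` A \<subseteq> \<Gamma>" "\<^bold>\<not> (psf Var \<phi>) \<in> \<Gamma>" "\<forall>\<psi>\<in>\<Gamma>. wff (lang2 L) \<psi>"
    "\<not> prv (lang2 L) \<Gamma> Bot" "\<forall>\<psi>. sentence (lang2 L) \<psi> \<longrightarrow> decides (lang2 L) \<Gamma> \<psi>"
    using henkin_extension[OF _ _ s np] assms(1) wff_psf[OF near_Var]
    by (force simp: odd_consts_def lang2_def dest: csf_psf)
  then have "henkin L \<Gamma>" by (simp add: henkin_def)
  moreover have "\<not> prv (lang2 L) \<Gamma> (psf Var \<phi>)"
    using \<Gamma>(2,4) prv.mp prv.axiom by blast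
  ultimately show ?thesis using \<Gamma>(1) by blast
qed


section \<open>Extensional models\<close>

lemma maxv_fvt: "v \<in> fvt t \<Longrightarrow> fst v \<le> maxv t"
  by (induction t) (auto simp: le_max_iff_disj)

lemma fresh_notin: "fresh \<sigma> s t \<notin> fvt s" "fresh \<sigma> s t \<notin> fvt t" "snd (fresh \<sigma> s t) = \<sigma>"
  using maxv_fvt[of "fresh \<sigma> s t" s] maxv_fvt[of "fresh \<sigma> s t" t] by (auto simp: fresh_def)

lemma wff_eqn: "s \<in> Tm L \<sigma> \<Longrightarrow> t \<in> Tm L \<sigma> \<Longrightarrow> wff L (eqn \<sigma> s t)"
proof (induction \<sigma> arbitrary: s t)
  case (Fun \<sigma> \<tau>)
  then show ?case by (simp add: Let_def Tm_def fresh_notin(3))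
next
  case (Seq \<sigma>)
  then show ?case using fresh_notin[of Num s t] by (simp add: Let_def Tm_def monus_wt)
qed (auto simp: Tm_def)

text \<open>Equality axioms are not built in: that \<open>EQ\<close> is a congruence is derived from
  the axioms that the structure satisfies.\<close>

locale prestructure =
  fixes L :: lang and D :: "ftyp \<Rightarrow> 'e set" and ap :: "'e \<Rightarrow> 'e \<Rightarrow> 'e" and I :: "const \<Rightarrow> 'e"
    and E :: "'e \<Rightarrow> 'e \<Rightarrow> bool" and ST :: "'e \<Rightarrow> bool"
  assumes nonempty: "D \<sigma> \<noteq> {}"
    and ap_typed: "x \<in> D (\<sigma> \<rightarrow> \<tau>) \<Longrightarrow> y \<in> D \<sigma> \<Longrightarrow> ap x y \<in> D \<tau>"
    and I_typed: "wt L (Con c) \<Longrightarrow> I c \<in> D (cty c)"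
    and sat_core: "\<psi> \<in> RCA0Omega_core L \<Longrightarrow> wff L \<psi> \<Longrightarrow> \<forall>v. \<rho> v \<in> D (snd v) \<Longrightarrow>
      sat D ap I E ST \<rho> \<psi>"
begin

definition typed :: "(var \<Rightarrow> 'e) \<Rightarrow> bool" where
  "typed \<rho> \<longleftrightarrow> (\<forall>v. \<rho> v \<in> D (snd v))"

abbreviation "ev \<equiv> eval ap I"
abbreviation "sem \<equiv> sat D ap I E ST"

lemma typed_upd: "typed \<rho> \<Longrightarrow> a \<in> D (snd v) \<Longrightarrow> typed (\<rho>(v := a))"
  by (simp add: typed_def)

lemma ex_typed: "\<exists>\<rho>. typed \<rho>"
proof -
  have "\<forall>v. \<exists>x. x \<in> D (snd v)" using nonempty by (simp add: ex_in_conv)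
  then show ?thesis unfolding typed_def by (rule choice)
qed

lemma ev_typed: "typed \<rho> \<Longrightarrow> wt L t \<Longrightarrow> ev \<rho> t \<in> D (ty t)"
proof (induction t)
  case (Con c)
  then show ?case using I_typed by simp
next
  case (App s t)
  then obtain \<tau> where "ty s = ty t \<rightarrow> \<tau>" by auto
  then show ?case using App ap_typed[of "ev \<rho> s" "ty t" \<tau>] by simp
qed (simp add: typed_def)

lemma ev_Tm: "typed \<rho> \<Longrightarrow> t \<in> Tm L \<sigma> \<Longrightarrow> ev \<rho> t \<in> D \<sigma>"
  using ev_typed by (auto simp: Tm_def)

definition mon :: "'e \<Rightarrow> 'e \<Rightarrow> 'e" where
  "mon x y = ap (ap (ev (\<lambda>_. undefined) monus_tm) x) y"

lemma ev_monus: "ap (ap (ev \<rho> monus_tm) x) y = mon x y"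
proof -
  have "ev \<rho> monus_tm = ev (\<lambda>_. undefined) monus_tm"
    by (rule eval_cong) (simp add: monus_wt)
  then show ?thesis by (simp add: mon_def)
qed

primrec EQ :: "ftyp \<Rightarrow> 'e \<Rightarrow> 'e \<Rightarrow> bool" where
  "EQ Num x y \<longleftrightarrow> E x y"
| "EQ (\<sigma> \<rightarrow> \<tau>) x y \<longleftrightarrow> (\<forall>z\<in>D \<sigma>. EQ \<tau> (ap x z) (ap y z))"
| "EQ (Seq \<sigma>) x y \<longleftrightarrow> E (ap (I (CLen \<sigma>)) x) (ap (I (CLen \<sigma>)) y) \<and>
     (\<forall>i\<in>D Num. E (mon i (ap (I (CLen \<sigma>)) x)) (I CZero) \<longrightarrow>
        E (mon (ap (I CSucc) i) (ap (I (CLen \<sigma>)) x)) (I CZero) \<longrightarrow>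
        EQ \<sigma> (ap (ap (I (CGet \<sigma>)) x) i) (ap (ap (I (CGet \<sigma>)) y) i))"

lemma sat_eqn_EQ: "sem \<rho> (eqn \<sigma> s t) \<longleftrightarrow> EQ \<sigma> (ev \<rho> s) (ev \<rho> t)"
proof (induction \<sigma> arbitrary: s t \<rho>)
  case (Fun \<sigma> \<tau>)
  let ?z = "fresh \<sigma> s t"
  have "ev (\<rho>(?z := a)) s = ev \<rho> s" "ev (\<rho>(?z := a)) t = ev \<rho> t" for a
    using fresh_notin[of \<sigma> s t] by (auto intro!: eval_cong)
  then show ?case using Fun by (simp add: Let_def fresh_notin(3) fun_upd_same del: fun_upd_apply)
next
  case (Seq \<sigma>)
  let ?z = "fresh Num s t"
  have "ev (\<rho>(?z := a)) s = ev \<rho> s" "ev (\<rho>(?z := a)) t = ev \<rho> t" for a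
    using fresh_notin[of Num s t] by (auto intro!: eval_cong)
  then show ?case using Seq
    by (simp add: Let_def fresh_notin(3) ev_monus fun_upd_same del: fun_upd_apply) blast
qed simp

lemma sat_base: "\<psi> \<in> RCA0omega L \<Longrightarrow> wff L \<psi> \<Longrightarrow> typed \<rho> \<Longrightarrow> sem \<rho> \<psi>"
  using sat_core RCA0Omega_core.base by (simp add: typed_def)

text \<open>Schemata are instantiated with variables, and this assigns given elements to those
  variables; so an axiom yields a statement about elements, whether or not closed terms denote
  them.\<close>

lemma val3:
  assumes "x \<in> D \<sigma>" "y \<in> D \<tau>" "z \<in> D \<rho>"
  obtains r where "typed r" "r (0, \<sigma>) = x" "r (1, \<tau>) = y" "r (2, \<rho>) = z"
proof -
  obtain r0 where "typed r0" using ex_typed by blast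
  then have "typed (r0((0, \<sigma>) := x, (1, \<tau>) := y, (2, \<rho>) := z))"
    using assms by (intro typed_upd) auto
  then show ?thesis by (rule that) auto
qed

lemma Var_Tm: "snd v = \<sigma> \<Longrightarrow> Var v \<in> Tm L \<sigma>"
  by (simp add: Tm_def)

section \<open>Extensional equality as a congruence\<close>

lemma E_refl: "x \<in> D Num \<Longrightarrow> E x x"
proof -
  assume x: "x \<in> D Num"
  obtain r where "typed r" "r (0, Num) = x" by (rule val3[OF x x x]) auto
  then show ?thesis
    using sat_base[OF RCA0omega.eq_refl[of "Var (0, Num)" L], of r] by (simp add: Var_Tm)
qed

lemma E_sym: "E x y \<Longrightarrow> x \<in> D Num \<Longrightarrow> y \<in> D Num \<Longrightarrow> E y x"
proof -
  assume x: "x \<in> D Num" "y \<in> D Num" "E x y"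
  obtain r where "typed r" "r (0, Num) = x" "r (1, Num) = y" by (rule val3[OF x(1,2,1)]) auto
  then show ?thesis
    using sat_base[OF RCA0omega.eq_sym[of "Var (0, Num)" L "Var (1, Num)"], of r] x
    by (simp add: Var_Tm)
qed

lemma E_trans: "E x y \<Longrightarrow> E y z \<Longrightarrow> x \<in> D Num \<Longrightarrow> y \<in> D Num \<Longrightarrow> z \<in> D Num \<Longrightarrow> E x z"
proof -
  assume x: "x \<in> D Num" "y \<in> D Num" "z \<in> D Num" "E x y" "E y z"
  obtain r where "typed r" "r (0, Num) = x" "r (1, Num) = y" "r (2, Num) = z"
    by (rule val3[OF x(1-3)]) auto
  then show ?thesis
    using sat_base[OF RCA0omega.eq_trans[of "Var (0, Num)" L "Var (1, Num)" "Var (2, Num)"], of r] x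
    by (simp add: Var_Tm)
qed

lemma EQ_ext: "EQ \<sigma> x y \<Longrightarrow> x \<in> D \<sigma> \<Longrightarrow> y \<in> D \<sigma> \<Longrightarrow> f \<in> D (\<sigma> \<rightarrow> \<tau>) \<Longrightarrow> EQ \<tau> (ap f x) (ap f y)"
proof -
  assume x: "x \<in> D \<sigma>" "y \<in> D \<sigma>" "f \<in> D (\<sigma> \<rightarrow> \<tau>)" "EQ \<sigma> x y"
  obtain r where r: "typed r" "r (0, \<sigma>) = x" "r (1, \<sigma>) = y" "r (2, \<sigma> \<rightarrow> \<tau>) = f"
    by (rule val3[OF x(1-3)]) auto
  have "Var (2, \<sigma> \<rightarrow> \<tau>) \<cdot> Var (i, \<sigma>) \<in> Tm L \<tau>" for i by (simp add: Tm_def)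
  then have "wff L (eqn \<sigma> (Var (0, \<sigma>)) (Var (1, \<sigma>)) \<^bold>\<longrightarrow>
      eqn \<tau> (Var (2, \<sigma> \<rightarrow> \<tau>) \<cdot> Var (0, \<sigma>)) (Var (2, \<sigma> \<rightarrow> \<tau>) \<cdot> Var (1, \<sigma>)))"
    by (simp add: wff_eqn Var_Tm)
  from sat_base[OF RCA0omega.ext this r(1)] show ?thesis
    using x r by (simp add: Var_Tm sat_eqn_EQ)
qed

lemma Seq_typed: "x \<in> D (Seq \<sigma>) \<Longrightarrow> ap (I (CLen \<sigma>)) x \<in> D Num"
  "x \<in> D (Seq \<sigma>) \<Longrightarrow> i \<in> D Num \<Longrightarrow> ap (ap (I (CGet \<sigma>)) x) i \<in> D \<sigma>"
  "i \<in> D Num \<Longrightarrow> ap (I CSucc) i \<in> D Num" "I CZero \<in> D Num"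
  using I_typed[of "CLen \<sigma>"] I_typed[of "CGet \<sigma>"] I_typed[of CSucc] I_typed[of CZero]
  by (auto intro: ap_typed)

lemma mon_typed1: "x \<in> D Num \<Longrightarrow> ap (ev (\<lambda>_. undefined) monus_tm) x \<in> D one"
proof -
  assume x: "x \<in> D Num"
  obtain r where r: "typed r" using ex_typed by blast
  have "ev r monus_tm \<in> D (Num \<rightarrow> one)" using ev_typed[OF r, of monus_tm] by (simp add: monus_wt)
  moreover have "ev r monus_tm = ev (\<lambda>_. undefined) monus_tm"
    by (rule eval_cong) (simp add: monus_wt)
  ultimately show ?thesis using ap_typed x by metis
qed

lemma mon_typed: "x \<in> D Num \<Longrightarrow> y \<in> D Num \<Longrightarrow> mon x y \<in> D Num"
  using ap_typed[OF mon_typed1] by (simp add: mon_def)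

lemma mon_cong: "E y z \<Longrightarrow> x \<in> D Num \<Longrightarrow> y \<in> D Num \<Longrightarrow> z \<in> D Num \<Longrightarrow>
    E (mon x y) (I CZero) \<Longrightarrow> E (mon x z) (I CZero)"
  using EQ_ext[of Num z y, OF _ _ _ mon_typed1[of x]] E_sym[of y z] mon_typed Seq_typed(4)
  by (metis EQ.simps(1) E_trans mon_def)

lemma EQ_refl: "x \<in> D \<sigma> \<Longrightarrow> EQ \<sigma> x x"
  by (induction \<sigma> arbitrary: x) (auto simp: E_refl Seq_typed intro: ap_typed)

lemma EQ_sym: "EQ \<sigma> x y \<Longrightarrow> x \<in> D \<sigma> \<Longrightarrow> y \<in> D \<sigma> \<Longrightarrow> EQ \<sigma> y x"
proof (induction \<sigma> arbitrary: x y)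
  case (Fun \<sigma> \<tau>)
  then show ?case using ap_typed[of x \<sigma> \<tau>] ap_typed[of y \<sigma> \<tau>] by simp
next
  case (Seq \<sigma>)
  let ?l = "ap (I (CLen \<sigma>))"
  have l: "E (?l y) (?l x)" "?l x \<in> D Num" "?l y \<in> D Num"
    using Seq.prems E_sym Seq_typed by auto
  have m: "E (mon i (?l x)) (I CZero)" if "E (mon i (?l y)) (I CZero)" "i \<in> D Num" for i
    using mon_cong[OF l(1) that(2) l(3,2) that(1)] .
  show ?case using Seq l m Seq_typed by auto
qed (simp add: E_sym)

lemma EQ_trans: "EQ \<sigma> x y \<Longrightarrow> EQ \<sigma> y z \<Longrightarrow> x \<in> D \<sigma> \<Longrightarrow> y \<in> D \<sigma> \<Longrightarrow> z \<in> D \<sigma> \<Longrightarrow> EQ \<sigma> x z"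
proof (induction \<sigma> arbitrary: x y z)
  case Num
  then show ?case using E_trans[of x y z] by simp
next
  case (Fun \<sigma> \<tau>)
  have "EQ \<tau> (ap x u) (ap z u)" if u: "u \<in> D \<sigma>" for u
    by (rule Fun.IH(2)[of _ "ap y u"])
      (use Fun.prems u ap_typed[of _ \<sigma> \<tau> u] in simp_all)
  then show ?case by simp
next
  case (Seq \<sigma>)
  let ?l = "ap (I (CLen \<sigma>))" and ?g = "\<lambda>x. ap (ap (I (CGet \<sigma>)) x)"
  have l: "E (?l x) (?l y)" "?l x \<in> D Num" "?l y \<in> D Num" "E (?l y) (?l z)" "?l z \<in> D Num"
    using Seq.prems Seq_typed by auto
  have m: "E (mon i (?l y)) (I CZero)" if "E (mon i (?l x)) (I CZero)" "i \<in> D Num" for i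
    using mon_cong[OF l(1) that(2) l(2,3) that(1)] .
  have "EQ \<sigma> (?g x i) (?g z i)"
    if "i \<in> D Num" "E (mon i (?l x)) (I CZero)" "E (mon (ap (I CSucc) i) (?l x)) (I CZero)" for i
  proof (rule Seq.IH)
    show "EQ \<sigma> (?g x i) (?g y i)" using Seq.prems(1) that by simp
    show "EQ \<sigma> (?g y i) (?g z i)" using Seq.prems(2) that m Seq_typed by simp
  qed (use Seq.prems Seq_typed that in auto)
  moreover have "E (?l x) (?l z)" using E_trans l by blast
  ultimately show ?case by simp
qed

lemma ST_cong: "EQ \<sigma> x y \<Longrightarrow> x \<in> D \<sigma> \<Longrightarrow> y \<in> D \<sigma> \<Longrightarrow> ST x \<Longrightarrow> ST y"
proof -
  assume x: "x \<in> D \<sigma>" "y \<in> D \<sigma>" "EQ \<sigma> x y" "ST x"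
  obtain r where r: "typed r" "r (0, \<sigma>) = x" "r (1, \<sigma>) = y"
    by (rule val3[OF x(1,2,2)]) auto
  show ?thesis
    using sat_core[OF RCA0Omega_core.st_eq[of "Var (0, \<sigma>)" L \<sigma> "Var (1, \<sigma>)"], of r] r x
    by (simp add: Var_Tm sat_eqn_EQ wff_eqn typed_def)
qed

lemma ap_cong:
  assumes "EQ (\<sigma> \<rightarrow> \<tau>) f g" "EQ \<sigma> x y" "f \<in> D (\<sigma> \<rightarrow> \<tau>)" "g \<in> D (\<sigma> \<rightarrow> \<tau>)" "x \<in> D \<sigma>" "y \<in> D \<sigma>"
  shows "EQ \<tau> (ap f x) (ap g y)"
proof (rule EQ_trans)
  show "EQ \<tau> (ap f x) (ap g x)" using assms by simp
  show "EQ \<tau> (ap g x) (ap g y)" using assms EQ_ext by blast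
qed (use assms ap_typed in blast)+

lemma ev_EQ:
  assumes "typed \<rho>" "typed \<rho>'" "\<forall>v. EQ (snd v) (\<rho> v) (\<rho>' v)"
  shows "wt L t \<Longrightarrow> EQ (ty t) (ev \<rho> t) (ev \<rho>' t)"
proof (induction t)
  case (Con c)
  then show ?case using EQ_refl[OF I_typed, of c] by simp
next
  case (App s t)
  then obtain \<tau> where \<tau>: "ty s = ty t \<rightarrow> \<tau>" by auto
  have "ev \<rho> s \<in> D (ty t \<rightarrow> \<tau>)" "ev \<rho>' s \<in> D (ty t \<rightarrow> \<tau>)"
    using ev_typed[of \<rho> s] ev_typed[of \<rho>' s] App.prems assms \<tau> by auto
  then have "EQ \<tau> (ap (ev \<rho> s) (ev \<rho> t)) (ap (ev \<rho>' s) (ev \<rho>' t))"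
    by (intro ap_cong[of "ty t"]) (use App \<tau> assms ev_typed in auto)
  then show ?case using \<tau> by simp
qed (use assms in simp)

lemma ev_EQ_Tm:
  assumes "typed \<rho>" "typed \<rho>'" "\<forall>v. EQ (snd v) (\<rho> v) (\<rho>' v)" "t \<in> Tm L Num"
  shows "E (ev \<rho> t) (ev \<rho>' t)"
  using ev_EQ[OF assms(1-3), of t] assms(4) by (simp add: Tm_def)

lemma sat_EQ:
  "typed \<rho> \<Longrightarrow> typed \<rho>' \<Longrightarrow> \<forall>v. EQ (snd v) (\<rho> v) (\<rho>' v) \<Longrightarrow> wff L \<phi> \<Longrightarrow> sem \<rho> \<phi> \<Longrightarrow> sem \<rho>' \<phi>"
proof (induction \<phi> arbitrary: \<rho> \<rho>')
  case (Eq s t)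
  have "s \<in> Tm L Num" "t \<in> Tm L Num" using Eq.prems by auto
  then have "E (ev \<rho> s) (ev \<rho>' s)" "E (ev \<rho> t) (ev \<rho>' t)" "E (ev \<rho> s) (ev \<rho> t)"
    "ev \<rho> s \<in> D Num" "ev \<rho>' s \<in> D Num" "ev \<rho> t \<in> D Num" "ev \<rho>' t \<in> D Num"
    using ev_EQ_Tm ev_Tm Eq.prems by auto
  then have "E (ev \<rho>' s) (ev \<rho>' t)" using E_trans E_sym by meson
  then show ?case by simp
next
  case (St t)
  then show ?case using ST_cong[OF ev_EQ[of \<rho> \<rho>' t]] ev_typed by simp
next
  case (Imp \<phi> \<psi>)
  have "sem \<rho> \<phi>" if "sem \<rho>' \<phi>"
    using Imp.IH(1)[of \<rho>' \<rho>] that Imp.prems EQ_sym by (simp add: typed_def)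
  then show ?case using Imp.IH(2)[of \<rho> \<rho>'] Imp.prems by simp
next
  case (All v \<phi>)
  have "sem (\<rho>'(v := a)) \<phi>" if a: "a \<in> D (snd v)" for a
  proof (rule All.IH[of "\<rho>(v := a)"])
    show "\<forall>w. EQ (snd w) ((\<rho>(v := a)) w) ((\<rho>'(v := a)) w)" using All.prems a EQ_refl by simp
  qed (use All.prems a typed_upd[of _ a v] in \<open>simp_all del: fun_upd_apply\<close>)
  then show ?case by simp
next
  case (BAll v t \<phi>)
  have t: "t \<in> Tm L Num" "snd v = Num" using BAll.prems by auto
  have et: "E (ev \<rho> t) (ev \<rho>' t)" "ev \<rho> t \<in> D Num" "ev \<rho>' t \<in> D Num"
    using ev_EQ_Tm[OF BAll.prems(1-3) t(1)] ev_Tm t BAll.prems by auto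
  have "sem (\<rho>'(v := a)) \<phi>" if a: "a \<in> D (snd v)" "E (mon a (ev \<rho>' t)) (I CZero)" for a
  proof (rule BAll.IH[of "\<rho>(v := a)"])
    show "\<forall>w. EQ (snd w) ((\<rho>(v := a)) w) ((\<rho>'(v := a)) w)" using BAll.prems a EQ_refl E_refl by simp
    have "E (mon a (ev \<rho> t)) (I CZero)"
      using mon_cong[of "ev \<rho>' t" "ev \<rho> t" a] E_sym et a t by simp
    then show "sem (\<rho>(v := a)) \<phi>" using BAll.prems(5) a by (simp add: ev_monus)
  qed (use BAll.prems a typed_upd[of _ a v] in \<open>simp_all del: fun_upd_apply\<close>)
  then show ?case by (simp add: ev_monus)
qed simp

end

text \<open>With extensional equality as identity, functionals with equal values are equal, and
  equations may be used inside all functionals.\<close>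

locale model = prestructure L D ap I "(=)" ST
  for L :: lang and D :: "ftyp \<Rightarrow> 'e set" and ap and I and ST +
  assumes EQ_eq: "x \<in> D \<sigma> \<Longrightarrow> y \<in> D \<sigma> \<Longrightarrow> EQ \<sigma> x y \<longleftrightarrow> x = y"

text \<open>Disjoint carriers determine the type of an object, so that the representative
  \<open>rp x\<close> can be chosen without mentioning a type.\<close>

locale disjoint_prestructure = prestructure L D ap I E ST
  for L :: lang and D :: "ftyp \<Rightarrow> 'e set" and ap and I and E and ST +
  assumes disjoint: "x \<in> D \<sigma> \<Longrightarrow> x \<in> D \<tau> \<Longrightarrow> \<sigma> = \<tau>"
begin

text \<open>The quotient by \<open>EQ\<close> consists of chosen representatives and so has the same carrier type.\<close>

definition rp :: "'e \<Rightarrow> 'e" where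
  "rp x = (SOME y. \<exists>\<sigma>. x \<in> D \<sigma> \<and> y \<in> D \<sigma> \<and> EQ \<sigma> x y)"

lemma rp: "x \<in> D \<sigma> \<Longrightarrow> rp x \<in> D \<sigma> \<and> EQ \<sigma> x (rp x)"
proof -
  assume x: "x \<in> D \<sigma>"
  have "\<exists>\<tau>. x \<in> D \<tau> \<and> rp x \<in> D \<tau> \<and> EQ \<tau> x (rp x)"
    unfolding rp_def by (rule someI[of _ x]) (use x EQ_refl in blast)
  then show ?thesis using disjoint x by blast
qed

lemma rp_iff: "x \<in> D \<sigma> \<Longrightarrow> y \<in> D \<sigma> \<Longrightarrow> rp x = rp y \<longleftrightarrow> EQ \<sigma> x y"
proof
  assume "x \<in> D \<sigma>" "y \<in> D \<sigma>" "rp x = rp y"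
  then show "EQ \<sigma> x y" using rp EQ_sym EQ_trans by metis
next
  assume x: "x \<in> D \<sigma>" "y \<in> D \<sigma>" "EQ \<sigma> x y"
  have "(\<lambda>z. \<exists>\<sigma>. x \<in> D \<sigma> \<and> z \<in> D \<sigma> \<and> EQ \<sigma> x z) = (\<lambda>z. \<exists>\<sigma>. y \<in> D \<sigma> \<and> z \<in> D \<sigma> \<and> EQ \<sigma> y z)"
  proof
    fix z
    have "EQ \<sigma> x z \<longleftrightarrow> EQ \<sigma> y z" if "z \<in> D \<sigma>"
      using x that EQ_sym EQ_trans by metis
    then show "(\<exists>\<sigma>. x \<in> D \<sigma> \<and> z \<in> D \<sigma> \<and> EQ \<sigma> x z) = (\<exists>\<sigma>. y \<in> D \<sigma> \<and> z \<in> D \<sigma> \<and> EQ \<sigma> y z)"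
      using x disjoint by metis
  qed
  then show "rp x = rp y" by (simp add: rp_def)
qed

lemma rp_rp: "x \<in> D \<sigma> \<Longrightarrow> rp (rp x) = rp x"
  using rp rp_iff EQ_sym by metis

abbreviation "D' \<sigma> \<equiv> rp ` D \<sigma>"
abbreviation "ap' x y \<equiv> rp (ap x y)"
abbreviation "I' c \<equiv> rp (I c)"

lemma D'_D: "x \<in> D' \<sigma> \<Longrightarrow> x \<in> D \<sigma> \<and> rp x = x"
  using rp rp_rp by auto

lemma typed_D': "\<forall>v. \<rho> v \<in> D' (snd v) \<Longrightarrow> typed \<rho>"
  using D'_D unfolding typed_def by blast

lemma eval_quot: "\<forall>v. \<rho> v \<in> D' (snd v) \<Longrightarrow> wt L t \<Longrightarrow> eval ap' I' \<rho> t = rp (ev \<rho> t)"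
proof (induction t)
  case (Var v)
  then show ?case using D'_D[of "\<rho> v" "snd v"] by simp
next
  case (App s t)
  have \<rho>: "typed \<rho>" using typed_D'[OF App.prems(1)] .
  obtain \<tau> where \<tau>: "ty s = ty t \<rightarrow> \<tau>" using App.prems by auto
  have st: "ev \<rho> s \<in> D (ty t \<rightarrow> \<tau>)" "ev \<rho> t \<in> D (ty t)"
    using ev_typed[of \<rho> s] ev_typed[of \<rho> t] App.prems \<rho> \<tau> by auto
  have "rp (ap (rp (ev \<rho> s)) (rp (ev \<rho> t))) = rp (ap (ev \<rho> s) (ev \<rho> t))"
  proof (subst rp_iff)
    show "EQ \<tau> (ap (rp (ev \<rho> s)) (rp (ev \<rho> t))) (ap (ev \<rho> s) (ev \<rho> t))"
      using st rp[OF st(1)] rp[OF st(2)] EQ_sym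
      by (intro ap_cong[of "ty t"]) (simp_all del: EQ.simps)
  qed (use st rp ap_typed in blast)+
  then show ?case using App by simp
qed simp

text \<open>The clause of \<open>sat\<close> for \<open>BAll\<close> applies \<open>monus_tm\<close>
  to elements rather than terms. Assigning the elements to two variables reduces this to
  \<open>eval_quot\<close>.\<close>

lemma quot_monus:
  assumes "\<forall>v. \<rho> v \<in> D' (snd v)" "a \<in> D Num" "b \<in> D Num"
  shows "ap' (ap' (eval ap' I' \<rho> monus_tm) (rp a)) (rp b) = rp (mon a b)"
proof -
  let ?\<rho> = "\<rho>((0, Num) := rp a, (1, Num) := rp b)"
  let ?t = "monus_tm \<cdot> Var (0, Num) \<cdot> Var (1, Num)"
  have \<rho>: "\<forall>v. ?\<rho> v \<in> D' (snd v)" using assms by auto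
  have *: "eval ap' I' \<rho>' monus_tm = eval ap' I' \<rho> monus_tm" for \<rho>'
    by (rule eval_cong) (simp add: monus_wt)
  have "ap' (ap' (eval ap' I' \<rho> monus_tm) (rp a)) (rp b) = eval ap' I' ?\<rho> ?t"
    using *[of ?\<rho>] by (simp del: One_nat_def)
  also have "\<dots> = rp (ev ?\<rho> ?t)" by (rule eval_quot[OF \<rho>]) (simp add: monus_wt)
  also have "ev ?\<rho> ?t = mon (rp a) (rp b)" by (simp add: ev_monus)
  also have "rp (mon (rp a) (rp b)) = rp (mon a b)"
  proof (subst rp_iff)
    have m: "ev (\<lambda>_. undefined) monus_tm \<in> D (Num \<rightarrow> one)"
    proof -
      obtain r where "typed r" using ex_typed by blast
      then have "ev r monus_tm \<in> D (Num \<rightarrow> one)" using ev_typed[of r monus_tm] by (simp add: monus_wt)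
      moreover have "ev r monus_tm = ev (\<lambda>_. undefined) monus_tm"
        by (rule eval_cong) (simp add: monus_wt)
      ultimately show ?thesis by simp
    qed
    have rs: "rp a \<in> D Num" "rp b \<in> D Num" "EQ Num (rp a) a" "EQ Num (rp b) b"
      using assms rp EQ_sym by blast+
    show "EQ Num (mon (rp a) (rp b)) (mon a b)" unfolding mon_def
      using EQ_ext[OF rs(3,1) assms(2) m] rs(4) ap_typed[OF m rs(1)] ap_typed[OF m assms(2)] rs(2)
        assms(3)
      by (rule ap_cong[of Num])
  qed (use assms rp mon_typed in blast)+
  finally show ?thesis .
qed

lemma sat_quot: "\<forall>v. \<rho> v \<in> D' (snd v) \<Longrightarrow> wff L \<phi> \<Longrightarrow> sat D' ap' I' (=) ST \<rho> \<phi> \<longleftrightarrow> sem \<rho> \<phi>"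
proof (induction \<phi> arbitrary: \<rho>)
  case (Eq s t)
  have "typed \<rho>" using typed_D'[OF Eq.prems(1)] .
  then show ?case using Eq rp_iff[of "ev \<rho> s" Num "ev \<rho> t"] ev_Tm[of \<rho> _ Num] eval_quot[of \<rho>]
    by (simp add: Tm_def)
next
  case (St t)
  have \<rho>: "typed \<rho>" using typed_D'[OF St.prems(1)] .
  have "ev \<rho> t \<in> D (ty t)" using \<rho> ev_typed St.prems by simp
  then have "ST (rp (ev \<rho> t)) \<longleftrightarrow> ST (ev \<rho> t)" using rp ST_cong EQ_sym by metis
  then show ?case using St eval_quot[of \<rho>] by simp
next
  case (All v \<phi>)
  have \<rho>: "typed \<rho>" using typed_D'[OF All.prems(1)] .
  have IH: "sat D' ap' I' (=) ST (\<rho>(v := rp a)) \<phi> \<longleftrightarrow> sem (\<rho>(v := rp a)) \<phi>" if "a \<in> D (snd v)" for a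
    using All that by auto
  have sat: "sem (\<rho>(v := a)) \<phi>" if a: "a \<in> D (snd v)" "sem (\<rho>(v := rp a)) \<phi>" for a
  proof (rule sat_EQ[of "\<rho>(v := rp a)"])
    show "\<forall>w. EQ (snd w) ((\<rho>(v := rp a)) w) ((\<rho>(v := a)) w)"
      using \<rho> a EQ_refl EQ_sym rp by (simp add: typed_def)
  qed (use \<rho> a rp All.prems in \<open>auto intro: typed_upd\<close>)
  then show ?case using IH rp by (auto simp del: fun_upd_apply)
next
  case (BAll v t \<phi>)
  have \<rho>: "typed \<rho>" using typed_D'[OF BAll.prems(1)] .
  have v: "snd v = Num" and t: "t \<in> Tm L Num" and wt: "wt L t" using BAll.prems by (auto simp: Tm_def)
  have tD: "ev \<rho> t \<in> D Num" using ev_Tm \<rho> t by blast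
  have IH: "sat D' ap' I' (=) ST (\<rho>(v := rp a)) \<phi> \<longleftrightarrow> sem (\<rho>(v := rp a)) \<phi>" if "a \<in> D Num" for a
    using BAll that v by auto
  have sat: "sem (\<rho>(v := a)) \<phi> \<longleftrightarrow> sem (\<rho>(v := rp a)) \<phi>" if a: "a \<in> D Num" for a
  proof
    show "sem (\<rho>(v := a)) \<phi>" if "sem (\<rho>(v := rp a)) \<phi>"
    proof (rule sat_EQ[OF _ _ _ _ that])
      show "\<forall>w. EQ (snd w) ((\<rho>(v := rp a)) w) ((\<rho>(v := a)) w)"
        using \<rho> a v EQ_refl EQ_sym rp by (simp add: typed_def del: EQ.simps)
    qed (use \<rho> a v rp BAll.prems in \<open>auto intro: typed_upd\<close>)
    show "sem (\<rho>(v := rp a)) \<phi>" if "sem (\<rho>(v := a)) \<phi>"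
    proof (rule sat_EQ[OF _ _ _ _ that])
      show "\<forall>w. EQ (snd w) ((\<rho>(v := a)) w) ((\<rho>(v := rp a)) w)"
        using \<rho> a v EQ_refl rp by (simp add: typed_def del: EQ.simps)
    qed (use \<rho> a v rp BAll.prems in \<open>auto intro: typed_upd\<close>)
  qed
  have "ap' (ap' (eval ap' I' \<rho> monus_tm) (rp a)) (eval ap' I' \<rho> t) = I' CZero \<longleftrightarrow>
      E (mon a (ev \<rho> t)) (I CZero)" if a: "a \<in> D Num" for a
    unfolding eval_quot[OF BAll.prems(1) wt] quot_monus[OF BAll.prems(1) a tD]
    using rp_iff[of "mon a (ev \<rho> t)" Num "I CZero"] mon_typed a tD Seq_typed(4) by simp
  then show ?case using IH sat v by (simp add: ev_monus del: fun_upd_apply)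
qed auto

lemma model_quot: "model L D' ap' I' ST"
proof -
  interpret q: prestructure L D' ap' I' "(=)" ST
  proof
    show "D' \<sigma> \<noteq> {}" for \<sigma> using nonempty by simp
    show "ap' x y \<in> D' \<tau>" if "x \<in> D' (\<sigma> \<rightarrow> \<tau>)" "y \<in> D' \<sigma>" for x y \<sigma> \<tau>
      using ap_typed[of x \<sigma> \<tau> y] D'_D[OF that(1)] D'_D[OF that(2)] by (intro imageI) simp
    show "I' c \<in> D' (cty c)" if "wt L (Con c)" for c
      using that I_typed by blast
    show "sat D' ap' I' (=) ST \<rho> \<psi>"
      if "\<psi> \<in> RCA0Omega_core L" "wff L \<psi>" "\<forall>v. \<rho> v \<in> D' (snd v)" for \<rho> \<psi>
      using that sat_quot[of \<rho> \<psi>] sat_core[of \<psi> \<rho>] D'_D by blast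
  qed
  show ?thesis
  proof
    fix x \<sigma> y
    assume xy: "x \<in> D' \<sigma>" "y \<in> D' \<sigma>"
    obtain r0 where r0: "q.typed r0" using q.ex_typed by blast
    let ?r = "r0((0, \<sigma>) := x, (1, \<sigma>) := y)"
    have r: "q.typed ?r" using r0 xy by (intro q.typed_upd) auto
    have "q.EQ \<sigma> x y \<longleftrightarrow> q.sem ?r (eqn \<sigma> (Var (0, \<sigma>)) (Var (1, \<sigma>)))"
      by (simp add: q.sat_eqn_EQ)
    also have "\<dots> \<longleftrightarrow> sem ?r (eqn \<sigma> (Var (0, \<sigma>)) (Var (1, \<sigma>)))"
      using r by (intro sat_quot) (simp_all add: q.typed_def wff_eqn Var_Tm)
    also have "\<dots> \<longleftrightarrow> EQ \<sigma> x y" by (simp add: sat_eqn_EQ)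
    also have "\<dots> \<longleftrightarrow> x = y" using rp_iff xy D'_D by metis
    finally show "q.EQ \<sigma> x y \<longleftrightarrow> x = y" .
  qed
qed

end

text \<open>An unprovable sentence fails in the term model of a Henkin theory and therefore in its
  quotient. The quotient consists of representatives, so models whose elements are terms are
  enough.\<close>

theorem completeness:
  fixes \<phi> :: fm
  assumes core: "RCA0Omega_core L \<subseteq> A" and \<phi>: "sentence L \<phi>"
    and models: "\<And>D ap I ST \<rho>. model L D ap (I :: const \<Rightarrow> trm) ST \<Longrightarrow>
      (\<And>\<psi> \<rho>. \<psi> \<in> A \<Longrightarrow> wff L \<psi> \<Longrightarrow> \<forall>v. \<rho> v \<in> D (snd v) \<Longrightarrow> sat D ap I (=) ST \<rho> \<psi>) \<Longrightarrow>
      \<forall>v. \<rho> v \<in> D (snd v) \<Longrightarrow> sat D ap I (=) ST \<rho> \<phi>"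
  shows "prv L A \<phi>"
proof (rule ccontr)
  assume "\<not> prv L A \<phi>"
  \<comment> \<open>Dropping ill-formed axioms weakens the theory, so unprovability persists; the
    deduction theorem behind the Henkin construction asks for well-formed axioms.\<close>
  then have "\<not> prv L {\<psi>\<in>A. wff L \<psi>} \<phi>" using prv_mono[of L "{\<psi>\<in>A. wff L \<psi>}" \<phi> A] by blast
  then obtain \<Gamma> where h: "henkin L \<Gamma>" and \<Gamma>: "\<forall>\<psi>\<in>{\<psi>\<in>A. wff L \<psi>}. psf Var \<psi> \<in> \<Gamma>"
    and np: "\<not> prv (lang2 L) \<Gamma> (psf Var \<phi>)"
    using term_model[of "{\<psi>\<in>A. wff L \<psi>}" L \<phi>] \<phi> by auto
  interpret henkin L \<Gamma> by (rule h)
  have ax: "sat1 \<rho> \<psi>" if "\<psi> \<in> A" "wff L \<psi>" "\<forall>v. \<rho> v \<in> CT L2 (snd v)" for \<psi> \<rho>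
    using sat1_axiom[of \<psi> \<rho>] \<Gamma> that by (simp add: cval_def)
  interpret disjoint_prestructure L "CT L2" App "Con \<circ> dblc" "\<lambda>s t. Th (s \<doteq> t)" "\<lambda>t. Th (St t)"
  proof
    show "CT L2 \<sigma> \<noteq> {}" for \<sigma> using zero_tm_CT by blast
    show "x \<cdot> y \<in> CT L2 \<tau>" if "x \<in> CT L2 (\<sigma> \<rightarrow> \<tau>)" "y \<in> CT L2 \<sigma>" for x y \<sigma> \<tau>
      using that by (simp add: CT_def Tm_def)
    show "(Con \<circ> dblc) c \<in> CT L2 (cty c)" if "wt L (Con c)" for c
      using that by (cases c) (auto simp: CT_def Tm_def lang2_def)
    show "sat1 \<rho> \<psi>" if "\<psi> \<in> RCA0Omega_core L" "wff L \<psi>" "\<forall>v. \<rho> v \<in> CT L2 (snd v)" for \<psi> \<rho>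
      using ax that core by blast
    show "\<sigma> = \<tau>" if "x \<in> CT L2 \<sigma>" "x \<in> CT L2 \<tau>" for x \<sigma> \<tau>
      using that by (auto simp: CT_def Tm_def)
  qed
  obtain \<rho> :: "var \<Rightarrow> trm" where \<rho>: "\<forall>v. \<rho> v \<in> D' (snd v)"
    by (rule that[of "\<lambda>v. rp (zero_tm (snd v))"]) (intro allI imageI zero_tm_CT)
  have "sat D' ap' I' (=) (\<lambda>t. Th (St t)) \<rho> \<phi>"
  proof (rule models[OF model_quot])
    fix \<psi> and \<rho> :: "var \<Rightarrow> trm"
    assume "\<psi> \<in> A" "wff L \<psi>" "\<forall>v. \<rho> v \<in> D' (snd v)"
    then show "sat D' ap' I' (=) (\<lambda>t. Th (St t)) \<rho> \<psi>"
      using ax[of \<psi> \<rho>] sat_quot[of \<rho> \<psi>] typed_D'[of \<rho>] by (simp add: typed_def)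
  qed (rule \<rho>)
  then have "sat1 \<rho> \<phi>" using sat_quot[OF \<rho>] \<phi> by (simp add: sentence_def)
  moreover have c: "cval \<rho>" using typed_D'[OF \<rho>] by (simp add: cval_def typed_def)
  ultimately have "Th (psf \<rho> \<phi>)" using truth \<phi> by (simp add: sentence_def)
  moreover have "psf \<rho> \<phi> = psf Var \<phi>" using \<phi> by (intro psf_cong) (simp add: sentence_def)
  ultimately show False using np by simp
qed


section \<open>Definable functionals\<close>

declare lam.simps [simp del]

lemma fvt_lam [simp]: "fvt (lam v t) = fvt t - {v}"
  by (induction t) (auto simp: lam.simps)

lemma ty_lam: "wt L t \<Longrightarrow> ty (lam v t) = snd v \<rightarrow> ty t"
  by (induction t) (auto simp: lam.simps)

lemma wt_lam [simp]: "wt L t \<Longrightarrow> wt L (lam v t)"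
proof (induction t)
  case (App s t)
  then show ?case using ty_lam[of L s v] ty_lam[of L t v] by (auto simp: lam.simps)
qed (auto simp: lam.simps)

lemma ty_lam' [simp]: "wt UNIV t \<Longrightarrow> ty (lam v t) = snd v \<rightarrow> ty t"
  by (rule ty_lam)

lemma plus_tm [simp]: "wt L plus_tm" "ty plus_tm = Num \<rightarrow> Num \<rightarrow> Num" "fvt plus_tm = {}"
  by (auto simp: plus_tm_def Let_def)

lemma pred_tm [simp]: "wt L pred_tm" "ty pred_tm = Num \<rightarrow> Num" "fvt pred_tm = {}"
  by (auto simp: pred_tm_def Let_def)

lemmas monus_tm [simp] = monus_wt

lemma tri_tm [simp]: "wt L tri_tm" "ty tri_tm = Num \<rightarrow> Num" "fvt tri_tm = {}"
  by (auto simp: tri_tm_def Let_def)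

lemma pair_tm [simp]: "wt L pair_tm" "ty pair_tm = Num \<rightarrow> Num \<rightarrow> Num" "fvt pair_tm = {}"
  by (auto simp: pair_tm_def Let_def)

lemma bar_tm [simp]: "wt L bar_tm" "ty bar_tm = one \<rightarrow> Num \<rightarrow> Num" "fvt bar_tm = {}"
  by (auto simp: bar_tm_def Let_def)

text \<open>The value 0 counts as true here and below: the first branch is taken at 0, and
  \<open>eq_tm\<close> vanishes at equal arguments.\<close>

definition cond_tm :: trm where
  "cond_tm = (let c = (0, Num); a = (1, Num); b = (2, Num); d = (3, Num); e = (4, Num) in
     lam c (lam a (lam b (Con CRec \<cdot> Var c \<cdot> Var a \<cdot> lam d (lam e (Var b))))))"

definition eq_tm :: trm where
  "eq_tm = (let m = (0, Num); n = (1, Num) in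
     lam m (lam n (plus_tm \<cdot> (monus_tm \<cdot> Var m \<cdot> Var n) \<cdot> (monus_tm \<cdot> Var n \<cdot> Var m))))"

lemma cond_tm [simp]: "wt L cond_tm" "ty cond_tm = Num \<rightarrow> Num \<rightarrow> Num \<rightarrow> Num" "fvt cond_tm = {}"
  by (auto simp: cond_tm_def Let_def)

lemma eq_tm [simp]: "wt L eq_tm" "ty eq_tm = Num \<rightarrow> Num \<rightarrow> Num" "fvt eq_tm = {}"
  by (auto simp: eq_tm_def Let_def)

text \<open>The value 0 means that the node is not in \<open>T\<close>, so that a vanishing sum of
  such values says that all the nodes in question are missing.\<close>

definition in_tm :: trm where
  "in_tm = (let T = (0, one); u = (1, Num) in
     lam T (lam u (cond_tm \<cdot> (eq_tm \<cdot> (Var T \<cdot> Var u) \<cdot> succ zero) \<cdot> succ zero \<cdot> zero)))"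

text \<open>A retraction of all sequences onto the binary ones. With it, statements about binary
  sequences become statements about all sequences, without the premise \<open>bin\<close>, which is
  not quantifier-free.\<close>

definition star_tm :: trm where
  "star_tm = (let \<alpha> = (0, one); i = (1, Num) in
     lam \<alpha> (lam i (cond_tm \<cdot> (Var \<alpha> \<cdot> Var i) \<cdot> zero \<cdot> succ zero)))"

text \<open>As \<open>qf\<close> excludes even bounded quantifiers, the vanishing of a sum over the
  indices below \<open>n\<close> takes the place of a bounded universal quantifier.\<close>

definition sum_tm :: trm where
  "sum_tm = (let f = (0, one); n = (1, Num); a = (2, Num); b = (3, Num) in
     lam f (lam n (Con CRec \<cdot> Var n \<cdot> zero \<cdot> lam a (lam b (plus_tm \<cdot> Var a \<cdot> (Var f \<cdot> Var b))))))"

definition par_tm :: trm where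
  "par_tm = (let n = (0, Num); a = (1, Num); b = (2, Num) in
     lam n (Con CRec \<cdot> Var n \<cdot> zero \<cdot> lam a (lam b (cond_tm \<cdot> Var a \<cdot> succ zero \<cdot> zero))))"

lemma in_tm [simp]: "wt L in_tm" "ty in_tm = one \<rightarrow> Num \<rightarrow> Num" "fvt in_tm = {}"
  by (auto simp: in_tm_def Let_def)

lemma star_tm [simp]: "wt L star_tm" "ty star_tm = one \<rightarrow> one" "fvt star_tm = {}"
  by (auto simp: star_tm_def Let_def)

lemma sum_tm [simp]: "wt L sum_tm" "ty sum_tm = one \<rightarrow> Num \<rightarrow> Num" "fvt sum_tm = {}"
  by (auto simp: sum_tm_def Let_def)

lemma par_tm [simp]: "wt L par_tm" "ty par_tm = Num \<rightarrow> Num" "fvt par_tm = {}"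
  by (auto simp: par_tm_def Let_def)

text \<open>Division by 2, rounded down: the step from n to n + 1 raises the value exactly when n is
  odd.\<close>

definition half_tm :: trm where
  "half_tm = (let n = (0, Num); a = (1, Num); b = (2, Num) in
     lam n (Con CRec \<cdot> Var n \<cdot> zero \<cdot> lam a (lam b (plus_tm \<cdot> Var a \<cdot> (par_tm \<cdot> Var b)))))"

lemma half_tm [simp]: "wt L half_tm" "ty half_tm = Num \<rightarrow> Num" "fvt half_tm = {}"
  by (auto simp: half_tm_def Let_def)

definition halves_tm :: trm where
  "halves_tm = (let t = (0, Num); i = (1, Num); a = (2, Num); b = (3, Num) in
     lam t (lam i (Con CRec \<cdot> Var i \<cdot> Var t \<cdot> lam a (lam b (half_tm \<cdot> Var a)))))"

lemma halves_tm [simp]: "wt L halves_tm" "ty halves_tm = Num \<rightarrow> Num \<rightarrow> Num" "fvt halves_tm = {}"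
  by (auto simp: halves_tm_def Let_def)

text \<open>A number is a code for the 0-1 sequence of its binary digits, the lowest first;
  \<open>enc_tm \<alpha> M\<close> is the code of \<open>\<alpha>\<close> cut off at \<open>M\<close>, computed by Horner's rule, and is at most
  \<open>bnd_tm M\<close> \<open>= 2\<^sup>M - 1\<close>.  In contrast to the codes that \<open>bar\<close> uses, these
  are decoded without inverting the pairing function.\<close>

definition dec_tm :: trm where
  "dec_tm = (let t = (0, Num); i = (1, Num) in
     lam t (lam i (par_tm \<cdot> (halves_tm \<cdot> Var t \<cdot> Var i))))"

definition horner_tm :: trm where
  "horner_tm = (let \<alpha> = (0, one); M = (1, Num); j = (2, Num); a = (3, Num); b = (4, Num) in
     lam \<alpha> (lam M (lam j (Con CRec \<cdot> Var j \<cdot> zero \<cdot>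
       lam a (lam b (plus_tm \<cdot> (plus_tm \<cdot> Var a \<cdot> Var a) \<cdot>
         (Var \<alpha> \<cdot> (monus_tm \<cdot> Var M \<cdot> succ (Var b)))))))))"

definition bnd_tm :: trm where
  "bnd_tm = (let k = (0, Num); a = (1, Num); b = (2, Num) in
     lam k (Con CRec \<cdot> Var k \<cdot> zero \<cdot> lam a (lam b (succ (plus_tm \<cdot> Var a \<cdot> Var a)))))"

lemma dec_tm [simp]: "wt L dec_tm" "ty dec_tm = Num \<rightarrow> one" "fvt dec_tm = {}"
  by (auto simp: dec_tm_def Let_def)

lemma horner_tm [simp]: "wt L horner_tm" "ty horner_tm = one \<rightarrow> Num \<rightarrow> Num \<rightarrow> Num"
  "fvt horner_tm = {}"
  by (auto simp: horner_tm_def Let_def)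

lemma bnd_tm [simp]: "wt L bnd_tm" "ty bnd_tm = Num \<rightarrow> Num" "fvt bnd_tm = {}"
  by (auto simp: bnd_tm_def Let_def)

definition enc_tm :: trm where
  "enc_tm = (let \<alpha> = (0, one); M = (1, Num) in
     lam \<alpha> (lam M (horner_tm \<cdot> Var \<alpha> \<cdot> Var M \<cdot> Var M)))"

lemma enc_tm [simp]: "wt L enc_tm" "ty enc_tm = one \<rightarrow> Num \<rightarrow> Num" "fvt enc_tm = {}"
  by (auto simp: enc_tm_def Let_def)

text \<open>\<open>paths_tm T k\<close> counts the codes below \<open>2\<^sup>k\<close> of sequences whose initial segment of length
  \<open>k\<close> is in \<open>T\<close>.\<close>

definition paths_tm :: trm where
  "paths_tm = (let T = (0, one); k = (1, Num); t = (2, Num) in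
     lam T (lam k (sum_tm \<cdot> lam t (in_tm \<cdot> Var T \<cdot> bar (dec_tm \<cdot> Var t) (Var k)) \<cdot> succ (bnd_tm \<cdot> Var k))))"

lemma paths_tm [simp]: "wt L paths_tm" "ty paths_tm = one \<rightarrow> Num \<rightarrow> Num" "fvt paths_tm = {}"
  by (auto simp: paths_tm_def Let_def)

context model
begin

notation ap (infixl "\<bullet>" 90)

abbreviation "N \<equiv> D Num"
abbreviation "F \<equiv> D one"
abbreviation "G \<equiv> D two"
abbreviation "Z \<equiv> I CZero"
abbreviation Sc :: "'e \<Rightarrow> 'e" where "Sc n \<equiv> I CSucc \<bullet> n"
abbreviation "One \<equiv> Sc Z"
abbreviation Rec :: "'e \<Rightarrow> 'e \<Rightarrow> 'e \<Rightarrow> 'e" where "Rec n x f \<equiv> I CRec \<bullet> n \<bullet> x \<bullet> f"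

definition "r0 = (SOME \<rho>. typed \<rho>)"

lemma typed_r0 [simp]: "typed r0"
  unfolding r0_def using ex_typed by (rule someI_ex)

definition cl :: "trm \<Rightarrow> 'e" where "cl t = ev r0 t"

lemma ev_closed: "fvt t = {} \<Longrightarrow> ev \<rho> t = cl t"
  unfolding cl_def by (rule eval_cong) simp

lemma typed_upd' [simp]: "typed \<rho> \<Longrightarrow> a \<in> D \<sigma> \<Longrightarrow> typed (\<rho>((i, \<sigma>) := a))"
  by (rule typed_upd) auto

lemma ev_D [simp]: "typed \<rho> \<Longrightarrow> wt L t \<Longrightarrow> ty t = \<sigma> \<Longrightarrow> ev \<rho> t \<in> D \<sigma>"
  using ev_typed by blast

lemma cl_D: "wt L t \<Longrightarrow> ty t = \<sigma> \<Longrightarrow> cl t \<in> D \<sigma>"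
  by (simp add: cl_def)

lemma const_typed: "Z \<in> N" "I CSucc \<in> D one" "I (CK \<sigma> \<tau>) \<in> D (\<sigma> \<rightarrow> \<tau> \<rightarrow> \<sigma>)"
  "I (CS \<rho> \<sigma> \<tau>) \<in> D ((\<rho> \<rightarrow> \<sigma> \<rightarrow> \<tau>) \<rightarrow> (\<rho> \<rightarrow> \<sigma>) \<rightarrow> \<rho> \<rightarrow> \<tau>)"
  "I CRec \<in> D (Num \<rightarrow> Num \<rightarrow> (Num \<rightarrow> Num \<rightarrow> Num) \<rightarrow> Num)"
  "I (CLen \<sigma>) \<in> D (Seq \<sigma> \<rightarrow> Num)" "I (CGet \<sigma>) \<in> D (Seq \<sigma> \<rightarrow> Num \<rightarrow> \<sigma>)"
  using I_typed[of CZero] I_typed[of CSucc] I_typed[of "CK \<sigma> \<tau>"] I_typed[of "CS \<rho> \<sigma> \<tau>"]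
    I_typed[of CRec] I_typed[of "CLen \<sigma>"] I_typed[of "CGet \<sigma>"] by simp_all

lemma ap_N [simp]: "\<alpha> \<in> F \<Longrightarrow> n \<in> N \<Longrightarrow> \<alpha> \<bullet> n \<in> N" "g \<in> G \<Longrightarrow> \<alpha> \<in> F \<Longrightarrow> g \<bullet> \<alpha> \<in> N"
  by (rule ap_typed; assumption)+

lemma Z_Sc_N [simp]: "Z \<in> N" "I CSucc \<in> F"
  by (rule const_typed)+

lemma Rec_N [simp]: "n \<in> N \<Longrightarrow> x \<in> N \<Longrightarrow> f \<in> D (Num \<rightarrow> Num \<rightarrow> Num) \<Longrightarrow> Rec n x f \<in> N"
  by (rule ap_typed ap_typed[OF ap_typed] ap_typed[OF ap_typed[OF ap_typed]] const_typed | assumption)+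

lemma function_ext:
  "f \<in> D (\<sigma> \<rightarrow> \<tau>) \<Longrightarrow> g \<in> D (\<sigma> \<rightarrow> \<tau>) \<Longrightarrow> (\<And>x. x \<in> D \<sigma> \<Longrightarrow> f \<bullet> x = g \<bullet> x) \<Longrightarrow> f = g"
  using EQ_eq[of f "\<sigma> \<rightarrow> \<tau>" g] EQ_eq ap_typed by simp

lemma sat_eqn: "typed \<rho> \<Longrightarrow> s \<in> Tm L \<sigma> \<Longrightarrow> t \<in> Tm L \<sigma> \<Longrightarrow> sem \<rho> (eqn \<sigma> s t) \<longleftrightarrow> ev \<rho> s = ev \<rho> t"
  using EQ_eq ev_Tm by (simp add: sat_eqn_EQ)

lemma K_eq: "x \<in> D \<sigma> \<Longrightarrow> y \<in> D \<tau> \<Longrightarrow> I (CK \<sigma> \<tau>) \<bullet> x \<bullet> y = x"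
proof -
  assume x: "x \<in> D \<sigma>" "y \<in> D \<tau>"
  obtain r where r: "typed r" "r (0, \<sigma>) = x" "r (1, \<tau>) = y" by (rule val3[OF x x(2)]) auto
  have "Con (CK \<sigma> \<tau>) \<cdot> Var (0, \<sigma>) \<cdot> Var (1, \<tau>) \<in> Tm L \<sigma>" by (simp add: Tm_def)
  then show ?thesis
    using sat_base[OF RCA0omega.comb_K[of "Var (0, \<sigma>)" L \<sigma> "Var (1, \<tau>)" \<tau>], of r] r
    by (simp add: Var_Tm wff_eqn sat_eqn)
qed

lemma S_eq:
  assumes x: "x \<in> D (\<rho> \<rightarrow> \<sigma> \<rightarrow> \<tau>)" "y \<in> D (\<rho> \<rightarrow> \<sigma>)" "z \<in> D \<rho>"
  shows "I (CS \<rho> \<sigma> \<tau>) \<bullet> x \<bullet> y \<bullet> z = x \<bullet> z \<bullet> (y \<bullet> z)"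
proof -
  let ?x = "Var (0, \<rho> \<rightarrow> \<sigma> \<rightarrow> \<tau>)" and ?y = "Var (1, \<rho> \<rightarrow> \<sigma>)" and ?z = "Var (2, \<rho>)"
  obtain r where r: "typed r" "r (0, \<rho> \<rightarrow> \<sigma> \<rightarrow> \<tau>) = x" "r (1, \<rho> \<rightarrow> \<sigma>) = y" "r (2, \<rho>) = z"
    by (rule val3[OF x]) auto
  have "Con (CS \<rho> \<sigma> \<tau>) \<cdot> ?x \<cdot> ?y \<cdot> ?z \<in> Tm L \<tau>" "?x \<cdot> ?z \<cdot> (?y \<cdot> ?z) \<in> Tm L \<tau>"
    by (simp_all add: Tm_def)
  then show ?thesis
    using sat_base[OF RCA0omega.comb_S[of ?x L \<rho> \<sigma> \<tau> ?y ?z], of r] r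
    by (simp add: Var_Tm wff_eqn sat_eqn)
qed

lemma K_typed: "x \<in> D \<sigma> \<Longrightarrow> I (CK \<sigma> \<tau>) \<bullet> x \<in> D (\<tau> \<rightarrow> \<sigma>)"
  by (rule ap_typed[OF const_typed(3)])

lemma S_typed: "x \<in> D (\<rho> \<rightarrow> \<sigma> \<rightarrow> \<tau>) \<Longrightarrow> y \<in> D (\<rho> \<rightarrow> \<sigma>) \<Longrightarrow> I (CS \<rho> \<sigma> \<tau>) \<bullet> x \<bullet> y \<in> D (\<rho> \<rightarrow> \<tau>)"
  by (rule ap_typed[OF ap_typed[OF const_typed(4)]])

text \<open>The theory has the equations for K and S only up to extensional equality. In a model
  that is identity, so abstraction obeys beta as an equation, and the terms that follow are
  evaluated by rewriting.\<close>

lemma beta [simp]: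
  assumes \<rho>: "typed \<rho>" and a: "a \<in> D (snd v)"
  shows "wt L t \<Longrightarrow> ev \<rho> (lam v t) \<bullet> a = ev (\<rho>(v := a)) t"
proof (induction t)
  case (Var w)
  show ?case
  proof (cases "v = w")
    case True
    have "I (CS (snd v) (snd v \<rightarrow> snd v) (snd v)) \<bullet> I (CK (snd v) (snd v \<rightarrow> snd v)) \<bullet>
        I (CK (snd v) (snd v)) \<bullet> a = a"
      using S_eq[OF const_typed(3) const_typed(3) a] K_eq[OF a K_typed[OF a]] by simp
    then show ?thesis using True by (simp add: lam.simps)
  next
    case False
    then show ?thesis using K_eq[of "\<rho> w" "snd w" a "snd v"] \<rho> a by (simp add: lam.simps typed_def)
  qed
next
  case (Con c)
  then show ?case using K_eq[OF I_typed a, of c] by (simp add: lam.simps)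
next
  case (App s t)
  obtain \<tau> where \<tau>: "ty s = ty t \<rightarrow> \<tau>" using App.prems by auto
  show ?case
  proof (cases "v \<in> fvt (s \<cdot> t)")
    case True
    have "ev \<rho> (lam v s) \<in> D (snd v \<rightarrow> ty t \<rightarrow> \<tau>)" "ev \<rho> (lam v t) \<in> D (snd v \<rightarrow> ty t)"
      using App.prems \<rho> \<tau> by (auto intro!: ev_D simp: ty_lam)
    from S_eq[OF this a] show ?thesis using App True \<tau> by (auto simp: lam.simps)
  next
    case False
    have "ev \<rho> (s \<cdot> t) \<in> D \<tau>" using App.prems \<rho> \<tau> by (intro ev_D) auto
    from K_eq[OF this a] have "ev \<rho> (lam v (s \<cdot> t)) \<bullet> a = ev \<rho> (s \<cdot> t)"
      using False \<tau> by (simp add: lam.simps)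
    also have "\<dots> = ev (\<rho>(v := a)) (s \<cdot> t)" using False by (intro eval_cong) auto
    finally show ?thesis .
  qed
qed

lemma beta_cl [simp]: "a \<in> D (snd v) \<Longrightarrow> wt L t \<Longrightarrow> cl (lam v t) \<bullet> a = ev (r0(v := a)) t"
  unfolding cl_def by (rule beta[OF typed_r0])

lemma Rec_Z [simp]: "x \<in> N \<Longrightarrow> f \<in> D (Num \<rightarrow> Num \<rightarrow> Num) \<Longrightarrow> Rec Z x f = x"
proof -
  assume x: "x \<in> N" "f \<in> D (Num \<rightarrow> Num \<rightarrow> Num)"
  obtain r where r: "typed r" "r (0, Num) = x" "r (1, Num \<rightarrow> Num \<rightarrow> Num) = f"
    by (rule val3[OF x x(2)]) auto
  then show ?thesis
    using sat_base[OF RCA0omega.rec_zero[of "Var (0, Num)" L "Var (1, Num \<rightarrow> Num \<rightarrow> Num)"], of r]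
    by (simp add: Tm_def)
qed

lemma Rec_Sc [simp]:
  "n \<in> N \<Longrightarrow> x \<in> N \<Longrightarrow> f \<in> D (Num \<rightarrow> Num \<rightarrow> Num) \<Longrightarrow> Rec (Sc n) x f = f \<bullet> Rec n x f \<bullet> n"
proof -
  assume x: "n \<in> N" "x \<in> N" "f \<in> D (Num \<rightarrow> Num \<rightarrow> Num)"
  obtain r where r: "typed r" "r (0, Num) = n" "r (1, Num) = x" "r (2, Num \<rightarrow> Num \<rightarrow> Num) = f"
    by (rule val3[OF x]) auto
  then show ?thesis
    using sat_base[OF RCA0omega.rec_succ[of "Var (0, Num)" L "Var (1, Num)"
      "Var (2, Num \<rightarrow> Num \<rightarrow> Num)"], of r]
    by (simp add: Tm_def)
qed

lemma Sc_nz [simp]: "n \<in> N \<Longrightarrow> Sc n \<noteq> Z" "n \<in> N \<Longrightarrow> Z \<noteq> Sc n"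
proof -
  assume x: "n \<in> N"
  obtain r where r: "typed r" "r (0, Num) = n" by (rule val3[OF x x x]) auto
  then show "Sc n \<noteq> Z"
    using sat_base[OF RCA0omega.succ_nz[of "Var (0, Num)" L], of r] by (simp add: Tm_def)
  then show "Z \<noteq> Sc n" by simp
qed

lemma Sc_inj [simp]: "m \<in> N \<Longrightarrow> n \<in> N \<Longrightarrow> Sc m = Sc n \<longleftrightarrow> m = n"
proof -
  assume x: "m \<in> N" "n \<in> N"
  obtain r where r: "typed r" "r (0, Num) = m" "r (1, Num) = n" by (rule val3[OF x x(2)]) auto
  then show ?thesis
    using sat_base[OF RCA0omega.succ_inj[of "Var (0, Num)" L "Var (1, Num)"], of r] by (auto simp: Tm_def)
qed


section \<open>Induction in the model\<close>

text \<open>Induction in the model is available only for functions that some functional represents,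
  possibly with parameters. Each induction therefore begins by decomposing its functions with
  \<open>R_rules\<close>.\<close>

definition R :: "ftyp \<Rightarrow> ('e \<Rightarrow> 'e) \<Rightarrow> bool" where
  "R \<tau> f \<longleftrightarrow> (\<exists>t\<in>D (Num \<rightarrow> \<tau>). \<forall>n\<in>N. t \<bullet> n = f n)"

lemma R_const: "c \<in> D \<tau> \<Longrightarrow> R \<tau> (\<lambda>n. c)"
  unfolding R_def using K_eq K_typed by blast

lemma R_id: "R Num (\<lambda>n. n)"
proof -
  have "cl (lam (0, Num) (Var (0, Num))) \<in> F" by (rule cl_D) auto
  then show ?thesis unfolding R_def by (rule bexI[rotated]) simp
qed

lemma R_app: "R (\<sigma> \<rightarrow> \<tau>) f \<Longrightarrow> R \<sigma> g \<Longrightarrow> R \<tau> (\<lambda>n. f n \<bullet> g n)"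
proof -
  assume "R (\<sigma> \<rightarrow> \<tau>) f" "R \<sigma> g"
  then obtain s t where st: "s \<in> D (Num \<rightarrow> \<sigma> \<rightarrow> \<tau>)" "t \<in> D (Num \<rightarrow> \<sigma>)"
    "\<forall>n\<in>N. s \<bullet> n = f n" "\<forall>n\<in>N. t \<bullet> n = g n" unfolding R_def by blast
  then show ?thesis unfolding R_def
    by (intro bexI[of _ "I (CS Num \<sigma> \<tau>) \<bullet> s \<bullet> t"]) (auto simp: S_eq S_typed)
qed

lemma R_D: "R \<tau> f \<Longrightarrow> n \<in> N \<Longrightarrow> f n \<in> D \<tau>"
  unfolding R_def using ap_typed by metis

text \<open>Disjunctions of two equations suffice for the arithmetic after which every quantifier-free
  predicate has a characteristic functional.\<close>

lemma induct_disj: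
  assumes R: "R Num f" "R Num g" "R Num h" "R Num k"
    and base: "f Z = g Z \<or> h Z = k Z"
    and step: "\<And>n. n \<in> N \<Longrightarrow> f n = g n \<or> h n = k n \<Longrightarrow> f (Sc n) = g (Sc n) \<or> h (Sc n) = k (Sc n)"
    and n: "n \<in> N"
  shows "f n = g n \<or> h n = k n"
proof -
  have ex: "\<exists>t\<in>F. \<forall>n\<in>N. t \<bullet> n = f n" if "R Num f" for f
    using that by (simp add: R_def)
  obtain f' where f': "f' \<in> F" "\<forall>n\<in>N. f' \<bullet> n = f n" using ex[OF R(1)] ..
  obtain g' where g': "g' \<in> F" "\<forall>n\<in>N. g' \<bullet> n = g n" using ex[OF R(2)] ..
  obtain h' where h': "h' \<in> F" "\<forall>n\<in>N. h' \<bullet> n = h n" using ex[OF R(3)] ..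
  obtain k' where k': "k' \<in> F" "\<forall>n\<in>N. k' \<bullet> n = k n" using ex[OF R(4)] ..
  note t = f' g' h' k'
  let ?n = "Var (0, Num)"
  let ?A = "\<^bold>\<not> (Var (1, one) \<cdot> ?n \<doteq> Var (2, one) \<cdot> ?n) \<^bold>\<longrightarrow> (Var (3, one) \<cdot> ?n \<doteq> Var (4, one) \<cdot> ?n)"
  let ?r = "r0((1, one) := f', (2, one) := g', (3, one) := h', (4, one) := k')"
  have r: "typed ?r" using t by simp
  have "wff L ?A" "qf ?A" by (simp_all add: Tm_def)
  then have "sem ?r (subst (0, Num) zero ?A \<^bold>\<and>
      All (0, Num) (?A \<^bold>\<longrightarrow> subst (0, Num) (succ (Var (0, Num))) ?A) \<^bold>\<longrightarrow> All (0, Num) ?A)"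
    by (intro sat_base[OF RCA0omega.qf_ind _ r]) (simp_all add: Tm_def)
  then have sem: "f' \<bullet> Z = g' \<bullet> Z \<or> h' \<bullet> Z = k' \<bullet> Z \<Longrightarrow>
      (\<forall>n\<in>N. f' \<bullet> n = g' \<bullet> n \<or> h' \<bullet> n = k' \<bullet> n \<longrightarrow>
        f' \<bullet> Sc n = g' \<bullet> Sc n \<or> h' \<bullet> Sc n = k' \<bullet> Sc n) \<Longrightarrow>
      \<forall>n\<in>N. f' \<bullet> n = g' \<bullet> n \<or> h' \<bullet> n = k' \<bullet> n"
    by (simp add: imp_conv_disj[of "\<not> _"])
  have "\<forall>n\<in>N. f' \<bullet> n = g' \<bullet> n \<or> h' \<bullet> n = k' \<bullet> n"
  proof (rule sem)
    show "f' \<bullet> Z = g' \<bullet> Z \<or> h' \<bullet> Z = k' \<bullet> Z" using t base by simp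
    show "\<forall>n\<in>N. f' \<bullet> n = g' \<bullet> n \<or> h' \<bullet> n = k' \<bullet> n \<longrightarrow>
        f' \<bullet> Sc n = g' \<bullet> Sc n \<or> h' \<bullet> Sc n = k' \<bullet> Sc n"
    proof (intro ballI impI)
      fix n assume n: "n \<in> N" "f' \<bullet> n = g' \<bullet> n \<or> h' \<bullet> n = k' \<bullet> n"
      then have "f n = g n \<or> h n = k n" using t by simp
      from step[OF n(1) this] show "f' \<bullet> Sc n = g' \<bullet> Sc n \<or> h' \<bullet> Sc n = k' \<bullet> Sc n"
        using t ap_N(1)[OF Z_Sc_N(2) n(1)] by metis
    qed
  qed
  then show ?thesis using t n by metis
qed

lemma induct_eq:
  assumes R: "R Num f" "R Num g" and base: "f Z = g Z"
    and step: "\<And>n. n \<in> N \<Longrightarrow> f n = g n \<Longrightarrow> f (Sc n) = g (Sc n)"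
    and n: "n \<in> N"
  shows "f n = g n"
  using induct_disj[OF R R _ _ n] base step by blast


section \<open>Arithmetic in the model\<close>

lemmas ev_tms [simp] =
  ev_closed[OF plus_tm(3)] ev_closed[OF pred_tm(3)] ev_closed[OF monus_tm(3)]
  ev_closed[OF pair_tm(3)] ev_closed[OF bar_tm(3)] ev_closed[OF cond_tm(3)] ev_closed[OF eq_tm(3)]
  ev_closed[OF in_tm(3)] ev_closed[OF star_tm(3)] ev_closed[OF sum_tm(3)] ev_closed[OF par_tm(3)]
  ev_closed[OF half_tm(3)] ev_closed[OF halves_tm(3)] ev_closed[OF dec_tm(3)]
  ev_closed[OF horner_tm(3)] ev_closed[OF bnd_tm(3)] ev_closed[OF enc_tm(3)] ev_closed[OF paths_tm(3)]

lemmas cl_types =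
  cl_D[OF plus_tm(1,2)] cl_D[OF pred_tm(1,2)] cl_D[OF monus_tm(1,2)] cl_D[OF pair_tm(1,2)]
  cl_D[OF bar_tm(1,2)] cl_D[OF cond_tm(1,2)] cl_D[OF eq_tm(1,2)] cl_D[OF in_tm(1,2)]
  cl_D[OF star_tm(1,2)] cl_D[OF sum_tm(1,2)] cl_D[OF par_tm(1,2)] cl_D[OF half_tm(1,2)]
  cl_D[OF halves_tm(1,2)] cl_D[OF dec_tm(1,2)] cl_D[OF horner_tm(1,2)] cl_D[OF bnd_tm(1,2)]
  cl_D[OF enc_tm(1,2)] cl_D[OF paths_tm(1,2)]

lemmas R_rules = R_app R_id R_const const_typed cl_types

abbreviation "pl m n \<equiv> cl plus_tm \<bullet> m \<bullet> n"
abbreviation "pre n \<equiv> cl pred_tm \<bullet> n"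
abbreviation "mo m n \<equiv> cl monus_tm \<bullet> m \<bullet> n"
abbreviation "sn s a \<equiv> Sc (cl pair_tm \<bullet> s \<bullet> a)"
abbreviation "br \<alpha> n \<equiv> cl bar_tm \<bullet> \<alpha> \<bullet> n"
abbreviation "cd c a b \<equiv> cl cond_tm \<bullet> c \<bullet> a \<bullet> b"
abbreviation "eqv m n \<equiv> cl eq_tm \<bullet> m \<bullet> n"
abbreviation "inn T u \<equiv> cl in_tm \<bullet> T \<bullet> u"
abbreviation "star \<alpha> \<equiv> cl star_tm \<bullet> \<alpha>"
abbreviation "sig f n \<equiv> cl sum_tm \<bullet> f \<bullet> n"
abbreviation "par n \<equiv> cl par_tm \<bullet> n"
abbreviation "half n \<equiv> cl half_tm \<bullet> n"
abbreviation "halves t i \<equiv> cl halves_tm \<bullet> t \<bullet> i"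
abbreviation "dec t \<equiv> cl dec_tm \<bullet> t"
abbreviation "hor \<alpha> M j \<equiv> cl horner_tm \<bullet> \<alpha> \<bullet> M \<bullet> j"
abbreviation "bnd k \<equiv> cl bnd_tm \<bullet> k"
abbreviation "enc \<alpha> M \<equiv> cl enc_tm \<bullet> \<alpha> \<bullet> M"
abbreviation "paths T k \<equiv> cl paths_tm \<bullet> T \<bullet> k"

lemma typed1: "f \<in> D (\<sigma> \<rightarrow> \<tau>) \<Longrightarrow> x \<in> D \<sigma> \<Longrightarrow> f \<bullet> x \<in> D \<tau>"
  by (rule ap_typed)

lemma typed2: "f \<in> D (\<sigma> \<rightarrow> \<tau> \<rightarrow> \<rho>) \<Longrightarrow> x \<in> D \<sigma> \<Longrightarrow> y \<in> D \<tau> \<Longrightarrow> f \<bullet> x \<bullet> y \<in> D \<rho>"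
  by (rule ap_typed[OF ap_typed])

lemma typed3: "f \<in> D (\<sigma> \<rightarrow> \<tau> \<rightarrow> \<rho> \<rightarrow> \<upsilon>) \<Longrightarrow> x \<in> D \<sigma> \<Longrightarrow> y \<in> D \<tau> \<Longrightarrow> z \<in> D \<rho> \<Longrightarrow> f \<bullet> x \<bullet> y \<bullet> z \<in> D \<upsilon>"
  by (rule ap_typed[OF ap_typed[OF ap_typed]])

lemmas types1 [simp] =
  typed1[OF cl_D[OF pred_tm(1,2)]] typed1[OF cl_D[OF star_tm(1,2)]] typed1[OF cl_D[OF par_tm(1,2)]]
  typed1[OF cl_D[OF half_tm(1,2)]] typed1[OF cl_D[OF dec_tm(1,2)]] typed1[OF cl_D[OF bnd_tm(1,2)]]

lemmas types2 [simp] =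
  typed2[OF cl_D[OF plus_tm(1,2)]] typed2[OF cl_D[OF monus_tm(1,2)]] typed2[OF cl_D[OF pair_tm(1,2)]]
  typed2[OF cl_D[OF bar_tm(1,2)]] typed2[OF cl_D[OF eq_tm(1,2)]] typed2[OF cl_D[OF in_tm(1,2)]]
  typed2[OF cl_D[OF sum_tm(1,2)]] typed2[OF cl_D[OF halves_tm(1,2)]] typed2[OF cl_D[OF enc_tm(1,2)]]
  typed2[OF cl_D[OF paths_tm(1,2)]]

lemmas types3 [simp] =
  typed3[OF cl_D[OF cond_tm(1,2)]] typed3[OF cl_D[OF horner_tm(1,2)]]

lemma ev_upd_idle: "v \<notin> fvt t \<Longrightarrow> ev (\<rho>(v := a)) t = ev \<rho> t"
  by (rule eval_cong) auto

lemma pl_rec [simp]: "m \<in> N \<Longrightarrow> pl m Z = m" "m \<in> N \<Longrightarrow> n \<in> N \<Longrightarrow> pl m (Sc n) = Sc (pl m n)"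
  by (simp_all add: plus_tm_def Let_def ev_upd_idle)

lemma pre_rec [simp]: "pre Z = Z" "n \<in> N \<Longrightarrow> pre (Sc n) = n"
  by (simp_all add: pred_tm_def Let_def)

lemma mo_rec: "m \<in> N \<Longrightarrow> mo m Z = m" "m \<in> N \<Longrightarrow> n \<in> N \<Longrightarrow> mo m (Sc n) = pre (mo m n)"
  by (simp_all add: monus_tm_def Let_def ev_upd_idle)

lemma cd_rec [simp]: "a \<in> N \<Longrightarrow> b \<in> N \<Longrightarrow> cd Z a b = a"
  "n \<in> N \<Longrightarrow> a \<in> N \<Longrightarrow> b \<in> N \<Longrightarrow> cd (Sc n) a b = b"
  by (simp_all add: cond_tm_def Let_def)

lemma br_rec [simp]: "\<alpha> \<in> F \<Longrightarrow> br \<alpha> Z = Z"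
  "\<alpha> \<in> F \<Longrightarrow> n \<in> N \<Longrightarrow> br \<alpha> (Sc n) = sn (br \<alpha> n) (\<alpha> \<bullet> n)"
  by (simp_all add: bar_tm_def Let_def ev_upd_idle)

lemma Sum_rec [simp]: "f \<in> F \<Longrightarrow> sig f Z = Z"
  "f \<in> F \<Longrightarrow> n \<in> N \<Longrightarrow> sig f (Sc n) = pl (sig f n) (f \<bullet> n)"
  by (simp_all add: sum_tm_def Let_def ev_upd_idle)

lemma par_rec [simp]: "par Z = Z" "n \<in> N \<Longrightarrow> par (Sc n) = cd (par n) One Z"
  by (simp_all add: par_tm_def Let_def ev_upd_idle)

lemma half_rec [simp]: "half Z = Z" "n \<in> N \<Longrightarrow> half (Sc n) = pl (half n) (par n)"
  by (simp_all add: half_tm_def Let_def ev_upd_idle)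

lemma halves_rec [simp]: "t \<in> N \<Longrightarrow> halves t Z = t"
  "t \<in> N \<Longrightarrow> n \<in> N \<Longrightarrow> halves t (Sc n) = half (halves t n)"
  by (simp_all add: halves_tm_def Let_def ev_upd_idle)

lemma hor_rec [simp]: "\<alpha> \<in> F \<Longrightarrow> M \<in> N \<Longrightarrow> hor \<alpha> M Z = Z"
  "\<alpha> \<in> F \<Longrightarrow> M \<in> N \<Longrightarrow> n \<in> N \<Longrightarrow>
    hor \<alpha> M (Sc n) = pl (pl (hor \<alpha> M n) (hor \<alpha> M n)) (\<alpha> \<bullet> mo M (Sc n))"
  by (simp_all add: horner_tm_def Let_def ev_upd_idle)

lemma bnd_rec [simp]: "bnd Z = Z" "n \<in> N \<Longrightarrow> bnd (Sc n) = Sc (pl (bnd n) (bnd n))"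
  by (simp_all add: bnd_tm_def Let_def ev_upd_idle)

lemma eqv_eq: "m \<in> N \<Longrightarrow> n \<in> N \<Longrightarrow> eqv m n = pl (mo m n) (mo n m)"
  by (simp add: eq_tm_def Let_def)

lemma inn_eq: "T \<in> F \<Longrightarrow> u \<in> N \<Longrightarrow> inn T u = cd (eqv (T \<bullet> u) One) One Z"
  by (simp add: in_tm_def Let_def)

lemma star_eq: "\<alpha> \<in> F \<Longrightarrow> n \<in> N \<Longrightarrow> star \<alpha> \<bullet> n = cd (\<alpha> \<bullet> n) Z One"
  by (simp add: star_tm_def Let_def)

lemma dec_eq: "t \<in> N \<Longrightarrow> n \<in> N \<Longrightarrow> dec t \<bullet> n = par (halves t n)"
  by (simp add: dec_tm_def Let_def)

lemma enc_eq: "\<alpha> \<in> F \<Longrightarrow> M \<in> N \<Longrightarrow> enc \<alpha> M = hor \<alpha> M M"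
  by (simp add: enc_tm_def Let_def)

lemma paths_eq: "T \<in> F \<Longrightarrow> k \<in> N \<Longrightarrow>
  \<exists>f\<in>F. (\<forall>t\<in>N. f \<bullet> t = inn T (br (dec t) k)) \<and> paths T k = sig f (Sc (bnd k))"
proof -
  assume T: "T \<in> F" "k \<in> N"
  let ?r = "r0((0, one) := T, (Suc 0, Num) := k)"
  let ?f = "ev ?r (lam (2, Num) (in_tm \<cdot> Var (0, one) \<cdot> bar (dec_tm \<cdot> Var (2, Num)) (Var (Suc 0, Num))))"
  show ?thesis using T by (intro bexI[of _ ?f] conjI) (simp_all add: paths_tm_def Let_def)
qed

section \<open>Addition, cut-off subtraction and the order\<close>

lemma Z_pl [simp]: "n \<in> N \<Longrightarrow> pl Z n = n"
  by (rule induct_eq[where g = "\<lambda>n. n"]) (rule R_rules | simp)+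

lemma Sc_pl [simp]: "m \<in> N \<Longrightarrow> n \<in> N \<Longrightarrow> pl (Sc m) n = Sc (pl m n)"
  by (rule induct_eq[where f = "\<lambda>n. pl (Sc m) n" and g = "\<lambda>n. Sc (pl m n)"]) (rule R_rules | simp)+

lemma pl_comm: "m \<in> N \<Longrightarrow> n \<in> N \<Longrightarrow> pl m n = pl n m"
  by (rule induct_eq[where f = "\<lambda>n. pl m n" and g = "\<lambda>n. pl n m"]) (rule R_rules | simp)+

lemma pl_assoc: "k \<in> N \<Longrightarrow> m \<in> N \<Longrightarrow> n \<in> N \<Longrightarrow> pl (pl k m) n = pl k (pl m n)"
  by (rule induct_eq[where f = "\<lambda>n. pl (pl k m) n" and g = "\<lambda>n. pl k (pl m n)"]) (rule R_rules | simp)+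

lemma mo_Sc_Sc [simp]: "m \<in> N \<Longrightarrow> n \<in> N \<Longrightarrow> mo (Sc m) (Sc n) = mo m n"
  by (rule induct_eq[where f = "\<lambda>n. mo (Sc m) (Sc n)" and g = "\<lambda>n. mo m n"])
    (rule R_rules | simp add: mo_rec)+

lemma Z_mo [simp]: "n \<in> N \<Longrightarrow> mo Z n = Z"
  by (rule induct_eq[where f = "\<lambda>n. mo Z n" and g = "\<lambda>n. Z"]) (rule R_rules | simp add: mo_rec)+

lemma mo_Z [simp]: "n \<in> N \<Longrightarrow> mo n Z = n"
  by (rule mo_rec)

lemma mo_self [simp]: "n \<in> N \<Longrightarrow> mo n n = Z"
  by (rule induct_eq[where f = "\<lambda>n. mo n n" and g = "\<lambda>n. Z"]) (rule R_rules | simp)+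

lemma pl_mo: "m \<in> N \<Longrightarrow> n \<in> N \<Longrightarrow> mo (pl m n) m = n"
  by (rule induct_eq[where f = "\<lambda>m. mo (pl m n) m" and g = "\<lambda>m. n"]) (rule R_rules | simp)+

lemma mo_pl: "k \<in> N \<Longrightarrow> m \<in> N \<Longrightarrow> n \<in> N \<Longrightarrow> mo k (pl m n) = mo (mo k m) n"
  by (rule induct_eq[where f = "\<lambda>n. mo k (pl m n)" and g = "\<lambda>n. mo (mo k m) n"])
    (rule R_rules | simp add: mo_rec)+

lemma Z_or_Sc: "n \<in> N \<Longrightarrow> n = Z \<or> n = Sc (pre n)"
  by (rule induct_disj[where f = "\<lambda>n. n" and g = "\<lambda>n. Z" and h = "\<lambda>n. n" and k = "\<lambda>n. Sc (pre n)"])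
    (rule R_rules | simp)+

lemma N_cases:
  assumes "n \<in> N"
  obtains "n = Z" | m where "m \<in> N" "n = Sc m"
proof (cases "n = Z")
  case False
  then show ?thesis using that(2)[of "pre n"] Z_or_Sc[OF assms] assms by simp
qed

text \<open>Both comparability and the recovery of differences are contained in this one
  disjunction, whose form fits \<open>induct_disj\<close>. Totality and antisymmetry of
  \<open>le\<close>, and its description by addition, are read off from it.\<close>

lemma compare_aux: "m \<in> N \<Longrightarrow> n \<in> N \<Longrightarrow> n = pl m (mo n m) \<or> m = pl n (mo m n)"
proof (rule induct_disj[where f = "\<lambda>n. n" and g = "\<lambda>n. pl m (mo n m)" and h = "\<lambda>n. m"
      and k = "\<lambda>n. pl n (mo m n)"])
  fix n
  assume m: "m \<in> N" and n: "n \<in> N" and IH: "n = pl m (mo n m) \<or> m = pl n (mo m n)"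
  show "Sc n = pl m (mo (Sc n) m) \<or> m = pl (Sc n) (mo m (Sc n))"
    using IH
  proof
    assume a: "n = pl m (mo n m)"
    then have "Sc n = pl m (Sc (mo n m))" using m n by simp
    then have "mo (Sc n) m = Sc (mo n m)" using pl_mo[of m "Sc (mo n m)"] m n by simp
    then show ?thesis using a m n by simp
  next
    assume a: "m = pl n (mo m n)"
    have "mo m n \<in> N" using m n by simp
    then show ?thesis
    proof (cases "mo m n" rule: N_cases)
      case 1
      then have "m = n" using a n by simp
      then show ?thesis using pl_mo[of n One] m n by simp
    next
      case (2 e)
      then have e: "m = pl (Sc n) e" using a n by simp
      then show ?thesis using pl_mo[of "Sc n" e] n 2 by simp
    qed
  qed
qed (rule R_rules | simp)+

abbreviation le :: "'e \<Rightarrow> 'e \<Rightarrow> bool" where "le m n \<equiv> mo m n = Z"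
abbreviation less :: "'e \<Rightarrow> 'e \<Rightarrow> bool" where "less m n \<equiv> le (Sc m) n"

lemma le_pl [simp]: "m \<in> N \<Longrightarrow> n \<in> N \<Longrightarrow> le m (pl m n)" "m \<in> N \<Longrightarrow> n \<in> N \<Longrightarrow> le n (pl m n)"
proof -
  show *: "le m (pl m n)" if "m \<in> N" "n \<in> N" for m n using that by (simp add: mo_pl)
  show "m \<in> N \<Longrightarrow> n \<in> N \<Longrightarrow> le n (pl m n)" using *[of n m] by (simp add: pl_comm[of m n])
qed

lemma le_ex: "m \<in> N \<Longrightarrow> n \<in> N \<Longrightarrow> le m n \<longleftrightarrow> (\<exists>d\<in>N. n = pl m d)"
proof
  assume m: "m \<in> N" "n \<in> N" "le m n"
  show "\<exists>d\<in>N. n = pl m d"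
  proof (cases "n = pl m (mo n m)")
    case True
    then show ?thesis using m by (intro bexI[of _ "mo n m"]) auto
  next
    case False
    then have "m = pl n Z" using compare_aux m by force
    then have "n = pl m Z" using m by simp
    then show ?thesis by (intro bexI[of _ Z]) auto
  qed
qed auto

lemma le_total: "m \<in> N \<Longrightarrow> n \<in> N \<Longrightarrow> le m n \<or> le n m"
  using compare_aux[of m n] le_pl(1)[of m "mo n m"] le_pl(1)[of n "mo m n"]
  by (metis types2(2))

lemma le_antisym: "m \<in> N \<Longrightarrow> n \<in> N \<Longrightarrow> le m n \<Longrightarrow> le n m \<Longrightarrow> m = n"
  using compare_aux[of m n] by auto

lemma le_trans: "le k m \<Longrightarrow> le m n \<Longrightarrow> k \<in> N \<Longrightarrow> m \<in> N \<Longrightarrow> n \<in> N \<Longrightarrow> le k n"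
proof -
  assume a: "le k m" "le m n" "k \<in> N" "m \<in> N" "n \<in> N"
  then obtain d e where "d \<in> N" "e \<in> N" "m = pl k d" "n = pl m e" using le_ex by auto
  then have "n = pl k (pl d e)" "pl d e \<in> N" using a by (simp_all add: pl_assoc)
  then show "le k n" using a le_pl(1) by simp
qed

lemma le_Sc: "m \<in> N \<Longrightarrow> n \<in> N \<Longrightarrow> le m (Sc n) \<longleftrightarrow> le m n \<or> m = Sc n"
proof
  assume m: "m \<in> N" "n \<in> N" "le m (Sc n)"
  then obtain d where d: "d \<in> N" "Sc n = pl m d" using le_ex by auto
  show "le m n \<or> m = Sc n"
    using d(1)
  proof (cases d rule: N_cases)
    case 1
    then show ?thesis using d m by simp
  next
    case (2 e)
    then have "n = pl m e" using d m by simp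
    then show ?thesis using 2 m by simp
  qed
next
  assume "m \<in> N" "n \<in> N" "le m n \<or> m = Sc n"
  then show "le m (Sc n)" by (elim disjE) (simp_all add: mo_rec(2)[of m])
qed

lemma le_Sc_self [simp]: "n \<in> N \<Longrightarrow> le n (Sc n)"
  by (simp add: le_Sc)

lemma less_Sc: "m \<in> N \<Longrightarrow> n \<in> N \<Longrightarrow> less m n \<longleftrightarrow> le m n \<and> m \<noteq> n"
proof
  assume m: "m \<in> N" "n \<in> N" "less m n"
  have "le m n" using le_trans[OF le_Sc_self m(3)] m by simp
  moreover have "m \<noteq> n"
  proof
    assume "m = n"
    then have "le (Sc n) n" using m by simp
    then have "Sc n = n" using le_antisym[of "Sc n" n] m by simp
    then have "mo (Sc n) n = Z" using m by simp
    moreover have "mo (Sc n) n = One" using pl_mo[of n One] m by simp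
    ultimately show False by simp
  qed
  ultimately show "le m n \<and> m \<noteq> n" ..
next
  assume m: "m \<in> N" "n \<in> N" "le m n \<and> m \<noteq> n"
  show "less m n" using m(2)
  proof (cases n rule: N_cases)
    case 1
    then show ?thesis using m by simp
  next
    case (2 k)
    then show ?thesis using m le_Sc by auto
  qed
qed

lemma not_le: "m \<in> N \<Longrightarrow> n \<in> N \<Longrightarrow> \<not> le m n \<longleftrightarrow> less n m"
  using le_total[of m n] le_antisym[of m n] less_Sc[of n m] by auto

lemma pl_eq_Z [simp]: "m \<in> N \<Longrightarrow> n \<in> N \<Longrightarrow> pl m n = Z \<longleftrightarrow> m = Z \<and> n = Z"
  by (cases n rule: N_cases) auto

lemma eqv_Z [simp]: "m \<in> N \<Longrightarrow> n \<in> N \<Longrightarrow> eqv m n = Z \<longleftrightarrow> m = n"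
  using le_antisym by (auto simp: eqv_eq)

lemma cd_Z: "c \<in> N \<Longrightarrow> a \<in> N \<Longrightarrow> b \<in> N \<Longrightarrow> cd c a b = (if c = Z then a else b)"
  by (cases c rule: N_cases) auto

lemma inn_Z [simp]: "T \<in> F \<Longrightarrow> u \<in> N \<Longrightarrow> inn T u = Z \<longleftrightarrow> T \<bullet> u \<noteq> One"
  by (simp add: inn_eq cd_Z)


section \<open>Definable predicates\<close>

text \<open>These predicates are closed under the propositional connectives and admit induction.
  There is no closure under quantifiers: bounded ones have to be written as sums, and unbounded ones
  are avoided.\<close>

definition Q :: "('e \<Rightarrow> bool) \<Rightarrow> bool" where
  "Q P \<longleftrightarrow> (\<exists>f\<in>F. \<forall>n\<in>N. P n \<longleftrightarrow> f \<bullet> n = Z)"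

lemma Q_R: "R Num f \<Longrightarrow> (\<And>n. n \<in> N \<Longrightarrow> P n \<longleftrightarrow> f n = Z) \<Longrightarrow> Q P"
  unfolding Q_def R_def by (elim bexE) (rule bexI, auto)

lemma Q_ex: "Q P \<Longrightarrow> \<exists>f. R Num f \<and> (\<forall>n\<in>N. P n \<longleftrightarrow> f n = Z)"
  unfolding Q_def R_def by (elim bexE) (rule exI, auto)

lemma Q_eq: "R Num f \<Longrightarrow> R Num g \<Longrightarrow> Q (\<lambda>n. f n = g n)"
  by (rule Q_R[of "\<lambda>n. eqv (f n) (g n)"]) (rule R_rules | assumption | simp add: R_D)+

lemma Q_imp: "Q P \<Longrightarrow> Q P' \<Longrightarrow> Q (\<lambda>n. P n \<longrightarrow> P' n)"
proof -
  assume Q: "Q P" "Q P'"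
  from Q_ex[OF Q(1)] obtain f where "R Num f" "\<forall>n\<in>N. P n \<longleftrightarrow> f n = Z" by (elim exE conjE)
  moreover from Q_ex[OF Q(2)] obtain g where "R Num g" "\<forall>n\<in>N. P' n \<longleftrightarrow> g n = Z"
    by (elim exE conjE)
  ultimately show ?thesis
    by (intro Q_R[of "\<lambda>n. cd (f n) (g n) Z"]) (rule R_rules | assumption | simp add: R_D cd_Z)+
qed

lemma Q_not: "Q P \<Longrightarrow> Q (\<lambda>n. \<not> P n)"
proof -
  assume "Q P"
  from Q_ex[OF this] obtain f where "R Num f" "\<forall>n\<in>N. P n \<longleftrightarrow> f n = Z" by (elim exE conjE)
  then show ?thesis
    by (intro Q_R[of "\<lambda>n. cd (f n) One Z"]) (rule R_rules | assumption | simp add: R_D cd_Z)+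
qed

lemma Q_conj: "Q P \<Longrightarrow> Q P' \<Longrightarrow> Q (\<lambda>n. P n \<and> P' n)"
  using Q_not[OF Q_imp[OF _ Q_not[of P']], of P] by simp

lemma Q_disj: "Q P \<Longrightarrow> Q P' \<Longrightarrow> Q (\<lambda>n. P n \<or> P' n)"
  using Q_imp[OF Q_not[of P], of P'] by (simp add: disj_imp)

lemmas Q_rules = Q_imp Q_not Q_conj Q_disj Q_eq R_rules

lemma induct_Q:
  assumes Q: "Q P" and base: "P Z" and step: "\<And>n. n \<in> N \<Longrightarrow> P n \<Longrightarrow> P (Sc n)" and n: "n \<in> N"
  shows "P n"
proof -
  obtain f where f: "R Num f" "\<forall>n\<in>N. P n \<longleftrightarrow> f n = Z" using Q_ex[OF Q] by (elim exE conjE)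
  have "f n = Z"
    by (rule induct_eq[where f = f and g = "\<lambda>n. Z", OF f(1) R_const _ _ n])
      (use base step f in \<open>auto simp: const_typed\<close>)
  then show ?thesis using f n by blast
qed

section \<open>Initial segments, bounded sums and least zeros\<close>

lemma bar_cong:
  assumes \<alpha>: "\<alpha> \<in> F" "\<beta> \<in> F" "k \<in> N" and eq: "\<And>i. i \<in> N \<Longrightarrow> less i k \<Longrightarrow> \<alpha> \<bullet> i = \<beta> \<bullet> i"
    and n: "n \<in> N" "le n k"
  shows "br \<alpha> n = br \<beta> n"
proof -
  have "le n k \<longrightarrow> br \<alpha> n = br \<beta> n"
  proof (rule induct_Q[where P = "\<lambda>n. le n k \<longrightarrow> br \<alpha> n = br \<beta> n", OF _ _ _ n(1)])
    show "Q (\<lambda>n. le n k \<longrightarrow> br \<alpha> n = br \<beta> n)" using \<alpha> by - (rule Q_rules | assumption)+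
    fix n assume n: "n \<in> N" "le n k \<longrightarrow> br \<alpha> n = br \<beta> n"
    have "le n k" if "le (Sc n) k" using le_trans[OF le_Sc_self that] n \<alpha> by simp
    then show "le (Sc n) k \<longrightarrow> br \<alpha> (Sc n) = br \<beta> (Sc n)" using n eq[of n] \<alpha> by simp
  qed (use \<alpha> in simp)
  then show ?thesis using n by blast
qed

lemma Sum_le: "f \<in> F \<Longrightarrow> i \<in> N \<Longrightarrow> n \<in> N \<Longrightarrow> less i n \<Longrightarrow> le (f \<bullet> i) (sig f n)"
proof -
  assume f: "f \<in> F" "i \<in> N" "n \<in> N" "less i n"
  have "less i n \<longrightarrow> le (f \<bullet> i) (sig f n)"
  proof (rule induct_Q[where P = "\<lambda>n. less i n \<longrightarrow> le (f \<bullet> i) (sig f n)", OF _ _ _ f(3)])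
    show "Q (\<lambda>n. less i n \<longrightarrow> le (f \<bullet> i) (sig f n))" using f by - (rule Q_rules | assumption)+
    fix n assume n: "n \<in> N" "less i n \<longrightarrow> le (f \<bullet> i) (sig f n)"
    show "less i (Sc n) \<longrightarrow> le (f \<bullet> i) (sig f (Sc n))"
    proof
      assume "less i (Sc n)"
      then have "le i n" using f n by simp
      then consider "less i n" | "i = n" using less_Sc f n by blast
      then show "le (f \<bullet> i) (sig f (Sc n))"
      proof cases
        case 1
        then show ?thesis using n f le_trans[of "f \<bullet> i" "sig f n" "sig f (Sc n)"] by simp
      qed (use f n in simp)
    qed
  qed (use f in simp)
  then show ?thesis using f by blast
qed

lemma Sum_Z: "f \<in> F \<Longrightarrow> n \<in> N \<Longrightarrow> sig f n = Z \<longleftrightarrow> (\<forall>i\<in>N. less i n \<longrightarrow> f \<bullet> i = Z)"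
proof
  assume f: "f \<in> F" "n \<in> N" "\<forall>i\<in>N. less i n \<longrightarrow> f \<bullet> i = Z"
  have "le m n \<longrightarrow> sig f m = Z" if m: "m \<in> N" for m
  proof (rule induct_Q[where P = "\<lambda>m. le m n \<longrightarrow> sig f m = Z", OF _ _ _ m])
    show "Q (\<lambda>m. le m n \<longrightarrow> sig f m = Z)" using f(1,2) by - (rule Q_rules | assumption)+
    fix m assume m: "m \<in> N" "le m n \<longrightarrow> sig f m = Z"
    have "le m n" if "le (Sc m) n" using le_trans[OF le_Sc_self that] m f by simp
    then show "le (Sc m) n \<longrightarrow> sig f (Sc m) = Z" using m f by simp
  qed (use f in simp)
  then show "sig f n = Z" using f by simp
next
  assume f: "f \<in> F" "n \<in> N" "sig f n = Z"
  show "\<forall>i\<in>N. less i n \<longrightarrow> f \<bullet> i = Z" using Sum_le[OF f(1) _ f(2)] f by simp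
qed

text \<open>The induction predicate that there is no zero below \<open>m\<close> has a bounded
  quantifier. Summing the negation \<open>g\<close> of \<open>f\<close> makes it an
  equation.\<close>

lemma least:
  assumes f: "f \<in> F" "n \<in> N" "f \<bullet> n = Z"
  obtains m where "m \<in> N" "f \<bullet> m = Z" "\<And>i. i \<in> N \<Longrightarrow> less i m \<Longrightarrow> f \<bullet> i \<noteq> Z"
proof (rule ccontr)
  assume *: "\<not> thesis"
  note found = that
  have "R Num (\<lambda>n. cd (f \<bullet> n) One Z)" using f by - (rule R_rules | assumption)+
  then obtain g where g: "g \<in> F" "\<forall>n\<in>N. g \<bullet> n = cd (f \<bullet> n) One Z" unfolding R_def by blast
  have gZ: "g \<bullet> i = Z \<longleftrightarrow> f \<bullet> i \<noteq> Z" if "i \<in> N" for i using g that f by (simp add: cd_Z)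
  have "sig g m = Z" if m: "m \<in> N" for m
  proof (rule induct_Q[where P = "\<lambda>m. sig g m = Z", OF _ _ _ m])
    show "Q (\<lambda>m. sig g m = Z)" using g(1) by - (rule Q_rules | assumption)+
    fix m assume m: "m \<in> N" "sig g m = Z"
    then have "\<forall>i\<in>N. less i m \<longrightarrow> f \<bullet> i \<noteq> Z" using Sum_Z g(1) gZ by simp
    then have "f \<bullet> m \<noteq> Z" using * found[OF m(1)] by blast
    then show "sig g (Sc m) = Z" using m g(1) gZ by simp
  qed (use g in simp)
  then have "sig g (Sc n) = Z" using f by simp
  then show False using gZ g(1) f by simp
qed

end


section \<open>Functionals for the equivalences\<close>

text \<open>\<open>tree_tm T k\<close> is 0 iff \<open>T\<close> violates none of the conditions on trees at arguments up to \<open>k\<close>.\<close>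

definition viol_tm :: trm where
  "viol_tm = (let T = (0, one); s = (1, Num); a = (2, Num) in
     lam T (lam s (lam a (cond_tm \<cdot> (eq_tm \<cdot> (Var T \<cdot> snoc (Var s) (Var a)) \<cdot> succ zero) \<cdot>
       (plus_tm \<cdot> (eq_tm \<cdot> (Var T \<cdot> Var s) \<cdot> succ zero) \<cdot> (monus_tm \<cdot> Var a \<cdot> succ zero)) \<cdot> zero))))"

lemma viol_tm [simp]: "wt L viol_tm" "ty viol_tm = one \<rightarrow> Num \<rightarrow> Num \<rightarrow> Num" "fvt viol_tm = {}"
  by (auto simp: viol_tm_def Let_def)

definition tree_tm :: trm where
  "tree_tm = (let T = (0, one); k = (1, Num); s = (2, Num); a = (3, Num) in
     lam T (lam k (plus_tm \<cdot>
       (sum_tm \<cdot> lam s (monus_tm \<cdot> (Var T \<cdot> Var s) \<cdot> succ zero) \<cdot> succ (Var k)) \<cdot>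
       (sum_tm \<cdot> lam s (sum_tm \<cdot> lam a (viol_tm \<cdot> Var T \<cdot> Var s \<cdot> Var a) \<cdot> succ (Var k)) \<cdot> succ (Var k)))))"

lemma tree_tm [simp]: "wt L tree_tm" "ty tree_tm = one \<rightarrow> Num \<rightarrow> Num" "fvt tree_tm = {}"
  by (auto simp: tree_tm_def Let_def)

text \<open>The matrix for both choice arguments. It vanishes if \<open>k\<close> is a bound, if
  \<open>k\<close> exposes a violated tree condition, or if \<beta> refutes that \<open>g\<close> is
  a modulus. Such data exist for all \<open>T\<close> and \<open>g\<close>, so choice applies
  without premises.\<close>

definition wit_tm :: trm where
  "wit_tm = (let T = (0, one); g = (0, two); k = (1, Num); \<beta> = (1, one) in
     lam T (lam g (lam k (lam \<beta> (cond_tm \<cdot> (paths_tm \<cdot> Var T \<cdot> Var k) \<cdot> zero \<cdot>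
       (cond_tm \<cdot> (tree_tm \<cdot> Var T \<cdot> Var k) \<cdot>
         (eq_tm \<cdot> (Var T \<cdot> bar (Var \<beta>) (Var g \<cdot> Var \<beta>)) \<cdot> succ zero) \<cdot> zero))))))"

lemma wit_tm [simp]: "wt L wit_tm" "ty wit_tm = one \<rightarrow> two \<rightarrow> Num \<rightarrow> one \<rightarrow> Num" "fvt wit_tm = {}"
  by (auto simp: wit_tm_def Let_def)

text \<open>The first entry of the argument selects the component: after 0 the next entry is passed
  to \<open>T\<close>, and otherwise the rest of the sequence is passed to \<open>g\<close>. A
  single object of type 2 thus carries both, as the schemata with one variable require.\<close>

definition tpair_tm :: trm where
  "tpair_tm = (let T = (0, one); g = (0, two); \<beta> = (1, one); j = (0, Num) in
     lam T (lam g (lam \<beta> (cond_tm \<cdot> (Var \<beta> \<cdot> zero) \<cdot> (Var T \<cdot> (Var \<beta> \<cdot> succ zero)) \<cdot>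
       (Var g \<cdot> lam j (Var \<beta> \<cdot> succ (Var j)))))))"

definition tfst_tm :: trm where
  "tfst_tm = (let x = (0, two); n = (0, Num); j = (1, Num) in
     lam x (lam n (Var x \<cdot> lam j (cond_tm \<cdot> Var j \<cdot> zero \<cdot> Var n))))"

definition tsnd_tm :: trm where
  "tsnd_tm = (let x = (0, two); \<alpha> = (0, one); j = (1, Num) in
     lam x (lam \<alpha> (Var x \<cdot> lam j (cond_tm \<cdot> Var j \<cdot> succ zero \<cdot> (Var \<alpha> \<cdot> (pred_tm \<cdot> Var j))))))"

lemma tpair_tm [simp]: "wt L tpair_tm" "ty tpair_tm = one \<rightarrow> two \<rightarrow> two" "fvt tpair_tm = {}"
  by (auto simp: tpair_tm_def Let_def)

lemma tfst_tm [simp]: "wt L tfst_tm" "ty tfst_tm = two \<rightarrow> one" "fvt tfst_tm = {}"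
  by (auto simp: tfst_tm_def Let_def)

lemma tsnd_tm [simp]: "wt L tsnd_tm" "ty tsnd_tm = two \<rightarrow> two" "fvt tsnd_tm = {}"
  by (auto simp: tsnd_tm_def Let_def)

text \<open>One sequence supplies both the number and the sequence for \<open>wit_tm\<close>. They
  do not conflict: whichever alternative is realized depends on only one of them.\<close>

definition wit1_tm :: trm where
  "wit1_tm = (let x = (0, two); y = (0, one) in
     lam x (lam y (wit_tm \<cdot> (tfst_tm \<cdot> Var x) \<cdot> (tsnd_tm \<cdot> Var x) \<cdot> (Var y \<cdot> zero) \<cdot> (star_tm \<cdot> Var y))))"

text \<open>The version for number-valued choice, where the number is read both as a level and as
  the code of a binary sequence.\<close>

definition wit0_tm :: trm where
  "wit0_tm = (let x = (0, two); y = (0, Num) in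
     lam x (lam y (wit_tm \<cdot> (tfst_tm \<cdot> Var x) \<cdot> (tsnd_tm \<cdot> Var x) \<cdot> Var y \<cdot> (dec_tm \<cdot> Var y))))"

lemma wit1_tm [simp]: "wt L wit1_tm" "ty wit1_tm = two \<rightarrow> one \<rightarrow> Num" "fvt wit1_tm = {}"
  by (auto simp: wit1_tm_def Let_def)

lemma wit0_tm [simp]: "wt L wit0_tm" "ty wit0_tm = two \<rightarrow> Num \<rightarrow> Num" "fvt wit0_tm = {}"
  by (auto simp: wit0_tm_def Let_def)

text \<open>\<open>pick_tm p s j\<close> is the last entry of \<open>s\<close> with index below \<open>j\<close> on which \<open>p\<close> is not 0.\<close>

definition pick_tm :: trm where
  "pick_tm = (let p = (0, one); s = (0, Seq Num); j = (0, Num); a = (1, Num); b = (2, Num) in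
     lam p (lam s (lam j (Con CRec \<cdot> Var j \<cdot> zero \<cdot>
       lam a (lam b (cond_tm \<cdot> (Var p \<cdot> get Num (Var s) (Var b)) \<cdot> Var a \<cdot> get Num (Var s) (Var b)))))))"

lemma pick_tm [simp]: "wt L pick_tm" "ty pick_tm = one \<rightarrow> Seq Num \<rightarrow> Num \<rightarrow> Num" "fvt pick_tm = {}"
  by (auto simp: pick_tm_def Let_def)

definition modulus_tm :: trm where
  "modulus_tm = (let H = (0, one \<rightarrow> Seq Num); T = (0, one); \<alpha> = (1, one); n = (0, Num) in
     lam H (lam T (lam \<alpha> (pick_tm \<cdot> lam n (eq_tm \<cdot> (Var T \<cdot> bar (star_tm \<cdot> Var \<alpha>) (Var n)) \<cdot> succ zero) \<cdot>
       (Var H \<cdot> Var \<alpha>) \<cdot> len Num (Var H \<cdot> Var \<alpha>)))))"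

text \<open>A number above a bound is again a bound, so no entry of the list has to be tested: the
  sum of the entries' values at 0 dominates the correct one.\<close>

definition collect_tm :: trm where
  "collect_tm = (let H = (0, two \<rightarrow> Seq one); T = (0, one); g = (0, two); i = (0, Num) in
     lam H (lam T (lam g (sum_tm \<cdot> lam i (get one (Var H \<cdot> (tpair_tm \<cdot> Var T \<cdot> Var g)) (Var i) \<cdot> zero) \<cdot>
       len one (Var H \<cdot> (tpair_tm \<cdot> Var T \<cdot> Var g))))))"

lemma modulus_tm [simp]: "wt L modulus_tm" "ty modulus_tm = (one \<rightarrow> Seq Num) \<rightarrow> one \<rightarrow> two"
  "fvt modulus_tm = {}"
  by (auto simp: modulus_tm_def Let_def)

lemma collect_tm [simp]: "wt L collect_tm" "ty collect_tm = (two \<rightarrow> Seq one) \<rightarrow> one \<rightarrow> two \<rightarrow> Num"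
  "fvt collect_tm = {}"
  by (auto simp: collect_tm_def Let_def)

context model
begin

lemmas ev_tms_fan [simp] =
  ev_closed[OF viol_tm(3)] ev_closed[OF tree_tm(3)] ev_closed[OF wit_tm(3)] ev_closed[OF tpair_tm(3)]
  ev_closed[OF tfst_tm(3)] ev_closed[OF tsnd_tm(3)] ev_closed[OF wit1_tm(3)] ev_closed[OF wit0_tm(3)]
  ev_closed[OF pick_tm(3)] ev_closed[OF modulus_tm(3)] ev_closed[OF collect_tm(3)]

lemmas types_fan [simp] =
  typed3[OF cl_D[OF viol_tm(1,2)]] typed2[OF cl_D[OF tree_tm(1,2)]]
  ap_typed[OF typed3[OF cl_D[OF wit_tm(1,2)]]] typed2[OF cl_D[OF tpair_tm(1,2)]]
  typed1[OF cl_D[OF tfst_tm(1,2)]] typed1[OF cl_D[OF tsnd_tm(1,2)]]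
  typed2[OF cl_D[OF wit1_tm(1,2)]] typed2[OF cl_D[OF wit0_tm(1,2)]]
  typed3[OF cl_D[OF pick_tm(1,2)]] typed2[OF cl_D[OF modulus_tm(1,2)]]
  typed3[OF cl_D[OF collect_tm(1,2)]]
  typed2[OF const_typed(7)] typed1[OF const_typed(6)]

lemma Sum_Z_Sc: "f \<in> F \<Longrightarrow> n \<in> N \<Longrightarrow> sig f (Sc n) = Z \<longleftrightarrow> (\<forall>i\<in>N. le i n \<longrightarrow> f \<bullet> i = Z)"
  using Sum_Z[of f "Sc n"] by simp


section \<open>Binary sequences\<close>

definition bin_seq :: "'e \<Rightarrow> bool" where
  "bin_seq \<alpha> \<longleftrightarrow> (\<forall>i\<in>N. le (\<alpha> \<bullet> i) One)"

lemma le_One: "n \<in> N \<Longrightarrow> le n One \<longleftrightarrow> n = Z \<or> n = One"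
  by (simp add: le_Sc)

lemma bin_seqD: "bin_seq \<alpha> \<Longrightarrow> \<alpha> \<in> F \<Longrightarrow> i \<in> N \<Longrightarrow> \<alpha> \<bullet> i = Z \<or> \<alpha> \<bullet> i = One"
  by (simp add: bin_seq_def le_One[symmetric])

lemma double: "x \<in> N \<Longrightarrow> par (pl x x) = Z \<and> half (pl x x) = x"
  by (rule induct_Q[where P = "\<lambda>x. par (pl x x) = Z \<and> half (pl x x) = x"]) (rule Q_rules | simp)+

lemma double_digit:
  "x \<in> N \<Longrightarrow> b = Z \<or> b = One \<Longrightarrow> par (pl (pl x x) b) = b \<and> half (pl (pl x x) b) = x"
  using double[of x] by auto

lemma par_bin: "n \<in> N \<Longrightarrow> par n = Z \<or> par n = One"
  by (cases n rule: N_cases) (auto simp: cd_Z)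

lemma dec_bin: "t \<in> N \<Longrightarrow> bin_seq (dec t)"
  using par_bin by (simp add: bin_seq_def le_One dec_eq)

lemma star_bin: "\<alpha> \<in> F \<Longrightarrow> bin_seq (star \<alpha>)"
  by (simp add: bin_seq_def le_One star_eq cd_Z)

lemma star_at: "\<alpha> \<in> F \<Longrightarrow> i \<in> N \<Longrightarrow> le (\<alpha> \<bullet> i) One \<Longrightarrow> star \<alpha> \<bullet> i = \<alpha> \<bullet> i"
  by (auto simp: le_One star_eq cd_Z)

lemma star_id: "\<alpha> \<in> F \<Longrightarrow> bin_seq \<alpha> \<Longrightarrow> star \<alpha> = \<alpha>"
  by (rule function_ext[of _ Num Num]) (auto simp: star_at bin_seq_def)

text \<open>Horner's rule consumes \<alpha> from index M - 1 downwards and puts each new digit at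
  the low end. Halving therefore undoes its steps in reverse order, beginning with the entry at 0;
  after M halvings only 0 remains.\<close>

lemma halves_enc:
  assumes \<alpha>: "\<alpha> \<in> F" "bin_seq \<alpha>" and M: "M \<in> N" and i: "i \<in> N"
  shows "halves (enc \<alpha> M) i = hor \<alpha> M (mo M i)"
proof (rule induct_Q[where P = "\<lambda>i. halves (enc \<alpha> M) i = hor \<alpha> M (mo M i)", OF _ _ _ i])
  show "Q (\<lambda>i. halves (enc \<alpha> M) i = hor \<alpha> M (mo M i))" using \<alpha> M by - (rule Q_rules | assumption)+
  fix i assume i: "i \<in> N" "halves (enc \<alpha> M) i = hor \<alpha> M (mo M i)"
  have "mo M i \<in> N" using i M by simp
  then have "half (hor \<alpha> M (mo M i)) = hor \<alpha> M (mo M (Sc i))"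
  proof (cases "mo M i" rule: N_cases)
    case (2 j)
    then show ?thesis using \<alpha> M i double_digit bin_seqD by (simp add: mo_rec)
  qed (use \<alpha> M i in \<open>simp add: mo_rec\<close>)
  then show "halves (enc \<alpha> M) (Sc i) = hor \<alpha> M (mo M (Sc i))" using i \<alpha> M by simp
qed (use \<alpha> M in \<open>simp add: enc_eq\<close>)

lemma dec_enc:
  assumes \<alpha>: "\<alpha> \<in> F" "bin_seq \<alpha>" and M: "M \<in> N" and i: "i \<in> N"
  shows "dec (enc \<alpha> M) \<bullet> i = (if less i M then \<alpha> \<bullet> i else Z)"
proof (cases "less i M")
  case True
  then obtain d where d: "d \<in> N" "M = pl (Sc i) d" using le_ex i M by auto
  then have "M = pl i (Sc d)" using i by simp
  then have "mo M i = Sc d" by (simp only:) (rule pl_mo, use i d in simp_all)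
  \<comment> \<open>The digit that Horner's rule adds in its step from d to d + 1 is the entry at M
    - (d + 1), which is i.\<close>
  moreover have "mo M (Sc d) = i"
    unfolding \<open>M = pl i (Sc d)\<close> using pl_mo[of "Sc d" i] pl_comm[of i "Sc d"] i d by simp
  ultimately show ?thesis using True \<alpha> M i d double_digit bin_seqD
    by (simp add: dec_eq halves_enc)
next
  case False
  then have "le M i" using not_le[of M i] i M by blast
  then show ?thesis using False \<alpha> M i by (simp add: dec_eq halves_enc)
qed

lemma pl_mono: "le a c \<Longrightarrow> le b d \<Longrightarrow> a \<in> N \<Longrightarrow> b \<in> N \<Longrightarrow> c \<in> N \<Longrightarrow> d \<in> N \<Longrightarrow> le (pl a b) (pl c d)"
proof -
  assume a: "le a c" "le b d" "a \<in> N" "b \<in> N" "c \<in> N" "d \<in> N"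
  then obtain e f where e: "e \<in> N" "f \<in> N" "c = pl a e" "d = pl b f" using le_ex by auto
  have "pl c d = pl (pl a b) (pl e f)"
  proof -
    have "pl (pl a e) (pl b f) = pl a (pl (pl e b) f)" using a e by (simp add: pl_assoc)
    also have "pl e b = pl b e" using a e pl_comm by blast
    finally show ?thesis using a e by (simp add: pl_assoc)
  qed
  then show ?thesis using a e by simp
qed

lemma enc_bound: "\<alpha> \<in> F \<Longrightarrow> bin_seq \<alpha> \<Longrightarrow> M \<in> N \<Longrightarrow> le (enc \<alpha> M) (bnd M)"
proof -
  assume \<alpha>: "\<alpha> \<in> F" "bin_seq \<alpha>" "M \<in> N"
  have "le (hor \<alpha> M j) (bnd j)" if j: "j \<in> N" for j
  proof (rule induct_Q[where P = "\<lambda>j. le (hor \<alpha> M j) (bnd j)", OF _ _ _ j])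
    show "Q (\<lambda>j. le (hor \<alpha> M j) (bnd j))" using \<alpha> by - (rule Q_rules | assumption)+
    fix j assume j: "j \<in> N" "le (hor \<alpha> M j) (bnd j)"
    let ?h = "hor \<alpha> M j"
    have "le (pl (pl ?h ?h) (\<alpha> \<bullet> mo M (Sc j))) (pl (pl (bnd j) (bnd j)) One)"
      using j \<alpha> by (intro pl_mono) (auto simp: bin_seq_def)
    then show "le (hor \<alpha> M (Sc j)) (bnd (Sc j))" using j \<alpha> by simp
  qed (use \<alpha> in simp)
  then show ?thesis using \<alpha> by (simp add: enc_eq)
qed

lemma bar_dec_enc:
  assumes "\<alpha> \<in> F" "bin_seq \<alpha>" "M \<in> N" "n \<in> N" "le n M"
  shows "br (dec (enc \<alpha> M)) n = br \<alpha> n"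
  by (rule bar_cong[of _ _ M]) (use assms in \<open>auto simp: dec_enc\<close>)

text \<open>The segment of length \<open>k\<close> of a binary \<beta> is also that of
  \<open>dec (enc \<beta> k)\<close>, whose code is at most \<open>bnd k\<close>. The finite sum
  thus covers all binary sequences.\<close>

lemma paths_Z:
  assumes T: "T \<in> F" "k \<in> N"
  shows "paths T k = Z \<longleftrightarrow> (\<forall>\<beta>\<in>F. bin_seq \<beta> \<longrightarrow> T \<bullet> br \<beta> k \<noteq> One)"
proof -
  obtain f where f: "f \<in> F" "\<forall>t\<in>N. f \<bullet> t = inn T (br (dec t) k)" "paths T k = sig f (Sc (bnd k))"
    using paths_eq[OF T] by blast
  have "paths T k = Z \<longleftrightarrow> (\<forall>t\<in>N. le t (bnd k) \<longrightarrow> T \<bullet> br (dec t) k \<noteq> One)"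
    using f T by (simp add: Sum_Z_Sc del: Sum_rec)
  also have "\<dots> \<longleftrightarrow> (\<forall>\<beta>\<in>F. bin_seq \<beta> \<longrightarrow> T \<bullet> br \<beta> k \<noteq> One)"
  proof (intro iffI ballI impI)
    fix \<beta> assume *: "\<forall>t\<in>N. le t (bnd k) \<longrightarrow> T \<bullet> br (dec t) k \<noteq> One" and \<beta>: "\<beta> \<in> F" "bin_seq \<beta>"
    have "br (dec (enc \<beta> k)) k = br \<beta> k" using bar_dec_enc[OF \<beta> T(2) T(2)] T by simp
    then show "T \<bullet> br \<beta> k \<noteq> One" using *[rule_format, OF _ enc_bound[OF \<beta> T(2)]] \<beta> T by simp
  qed (use dec_bin in auto)
  finally show ?thesis .
qed


section \<open>Trees\<close>

definition clos :: "'e \<Rightarrow> 'e \<Rightarrow> 'e \<Rightarrow> bool" where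
  "clos T s a \<longleftrightarrow> (T \<bullet> sn s a = One \<longrightarrow> T \<bullet> s = One \<and> le a One)"

definition is_tree :: "'e \<Rightarrow> bool" where
  "is_tree T \<longleftrightarrow> bin_seq T \<and> (\<forall>s\<in>N. \<forall>a\<in>N. clos T s a)"

abbreviation "viol T s a \<equiv> cl viol_tm \<bullet> T \<bullet> s \<bullet> a"
abbreviation "trunc T k \<equiv> cl tree_tm \<bullet> T \<bullet> k"
abbreviation "wit T g k \<beta> \<equiv> cl wit_tm \<bullet> T \<bullet> g \<bullet> k \<bullet> \<beta>"
abbreviation "tpair T g \<equiv> cl tpair_tm \<bullet> T \<bullet> g"
abbreviation "tfst x \<equiv> cl tfst_tm \<bullet> x"
abbreviation "tsnd x \<equiv> cl tsnd_tm \<bullet> x"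
abbreviation "pick p s j \<equiv> cl pick_tm \<bullet> p \<bullet> s \<bullet> j"

lemma viol_Z: "T \<in> F \<Longrightarrow> s \<in> N \<Longrightarrow> a \<in> N \<Longrightarrow> viol T s a = Z \<longleftrightarrow> clos T s a"
  by (simp add: viol_tm_def Let_def cd_Z clos_def)

lemma trunc_Z:
  assumes T: "T \<in> F" "k \<in> N"
  shows "trunc T k = Z \<longleftrightarrow> (\<forall>i\<in>N. le i k \<longrightarrow> le (T \<bullet> i) One) \<and>
    (\<forall>s\<in>N. \<forall>a\<in>N. le s k \<longrightarrow> le a k \<longrightarrow> clos T s a)"
proof -
  let ?r = "r0((0, one) := T, (Suc 0, Num) := k)"
  let ?f = "ev ?r (lam (2, Num) (monus_tm \<cdot> (Var (0, one) \<cdot> Var (2, Num)) \<cdot> succ zero))"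
  let ?t = "sum_tm \<cdot> lam (3, Num) (viol_tm \<cdot> Var (0, one) \<cdot> Var (2, Num) \<cdot> Var (3, Num)) \<cdot> succ (Var (Suc 0, Num))"
  let ?g = "ev ?r (lam (2, Num) ?t)"
  have fg: "?f \<in> F" "?g \<in> F" using T by simp_all
  have "ev (?r((2, Num) := s)) ?t = Z \<longleftrightarrow> (\<forall>a\<in>N. le a k \<longrightarrow> clos T s a)" if "s \<in> N" for s
    using T that by (simp add: Sum_Z_Sc viol_Z del: Sum_rec)
  then have g: "?g \<bullet> s = Z \<longleftrightarrow> (\<forall>a\<in>N. le a k \<longrightarrow> clos T s a)" if "s \<in> N" for s
    using T that by simp
  have f: "?f \<bullet> s = mo (T \<bullet> s) One" if "s \<in> N" for s using T that by simp
  have A: "sig ?f (Sc k) = Z \<longleftrightarrow> (\<forall>i\<in>N. le i k \<longrightarrow> le (T \<bullet> i) One)"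
    using Sum_Z_Sc[OF fg(1) T(2)] f by simp
  have B: "sig ?g (Sc k) = Z \<longleftrightarrow> (\<forall>s\<in>N. \<forall>a\<in>N. le s k \<longrightarrow> le a k \<longrightarrow> clos T s a)"
    using Sum_Z_Sc[OF fg(2) T(2)] g by auto
  have "trunc T k = pl (sig ?f (Sc k)) (sig ?g (Sc k))"
    using T by (simp add: tree_tm_def Let_def)
  moreover have "sig ?f (Sc k) \<in> N" "sig ?g (Sc k) \<in> N" using fg T by (simp_all del: Sum_rec)
  ultimately have "trunc T k = Z \<longleftrightarrow> sig ?f (Sc k) = Z \<and> sig ?g (Sc k) = Z"
    by (simp only: pl_eq_Z)
  then show ?thesis using A B by blast
qed

lemma wit_Z: "T \<in> F \<Longrightarrow> g \<in> G \<Longrightarrow> k \<in> N \<Longrightarrow> \<beta> \<in> F \<Longrightarrow>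
  wit T g k \<beta> = Z \<longleftrightarrow> paths T k = Z \<or> trunc T k \<noteq> Z \<or> T \<bullet> br \<beta> (g \<bullet> \<beta>) = One"
  by (simp add: wit_tm_def Let_def cd_Z)

lemma tpair_eq: "T \<in> F \<Longrightarrow> g \<in> G \<Longrightarrow> \<beta> \<in> F \<Longrightarrow>
  \<exists>\<gamma>\<in>F. (\<forall>j\<in>N. \<gamma> \<bullet> j = \<beta> \<bullet> Sc j) \<and> tpair T g \<bullet> \<beta> = cd (\<beta> \<bullet> Z) (T \<bullet> (\<beta> \<bullet> One)) (g \<bullet> \<gamma>)"
proof -
  assume a: "T \<in> F" "g \<in> G" "\<beta> \<in> F"
  let ?r = "r0((0, one) := T, (0, two) := g, (1, one) := \<beta>)"
  show ?thesis using a
    by (intro bexI[of _ "ev ?r (lam (0, Num) (Var (1, one) \<cdot> succ (Var (0, Num))))"] conjI)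
      (simp_all add: tpair_tm_def Let_def)
qed

lemma tfst_eq: "x \<in> G \<Longrightarrow> n \<in> N \<Longrightarrow> \<exists>\<beta>\<in>F. (\<forall>j\<in>N. \<beta> \<bullet> j = cd j Z n) \<and> tfst x \<bullet> n = x \<bullet> \<beta>"
proof -
  assume a: "x \<in> G" "n \<in> N"
  let ?r = "r0((0, two) := x, (0, Num) := n)"
  let ?t = "lam (Suc 0, Num) (cond_tm \<cdot> Var (Suc 0, Num) \<cdot> zero \<cdot> Var (0, Num))"
  show ?thesis using a
    by (intro bexI[of _ "ev ?r ?t"] conjI) (simp_all add: tfst_tm_def Let_def)
qed

lemma tsnd_eq: "x \<in> G \<Longrightarrow> \<alpha> \<in> F \<Longrightarrow>
  \<exists>\<beta>\<in>F. (\<forall>j\<in>N. \<beta> \<bullet> j = cd j One (\<alpha> \<bullet> pre j)) \<and> tsnd x \<bullet> \<alpha> = x \<bullet> \<beta>"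
proof -
  assume a: "x \<in> G" "\<alpha> \<in> F"
  let ?r = "r0((0, two) := x, (0, one) := \<alpha>)"
  let ?t = "lam (Suc 0, Num) (cond_tm \<cdot> Var (Suc 0, Num) \<cdot> succ zero \<cdot> (Var (0, one) \<cdot> (pred_tm \<cdot> Var (Suc 0, Num))))"
  show ?thesis using a
    by (intro bexI[of _ "ev ?r ?t"] conjI) (simp_all add: tsnd_tm_def Let_def)
qed

lemma tfst_tpair: "T \<in> F \<Longrightarrow> g \<in> G \<Longrightarrow> tfst (tpair T g) = T"
proof (rule function_ext[of _ Num Num])
  fix n assume a: "T \<in> F" "g \<in> G" "n \<in> N"
  then obtain \<beta> where \<beta>: "\<beta> \<in> F" "\<forall>j\<in>N. \<beta> \<bullet> j = cd j Z n" "tfst (tpair T g) \<bullet> n = tpair T g \<bullet> \<beta>"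
    using tfst_eq[of "tpair T g" n] by auto
  then obtain \<gamma> where "\<gamma> \<in> F" "tpair T g \<bullet> \<beta> = cd (\<beta> \<bullet> Z) (T \<bullet> (\<beta> \<bullet> One)) (g \<bullet> \<gamma>)"
    using tpair_eq[of T g \<beta>] a by auto
  then show "tfst (tpair T g) \<bullet> n = T \<bullet> n" using \<beta> a by simp
qed simp_all

lemma tsnd_tpair: "T \<in> F \<Longrightarrow> g \<in> G \<Longrightarrow> tsnd (tpair T g) = g"
proof (rule function_ext[of _ one Num])
  fix \<alpha> assume a: "T \<in> F" "g \<in> G" "\<alpha> \<in> F"
  then obtain \<beta> where \<beta>: "\<beta> \<in> F" "\<forall>j\<in>N. \<beta> \<bullet> j = cd j One (\<alpha> \<bullet> pre j)"
      "tsnd (tpair T g) \<bullet> \<alpha> = tpair T g \<bullet> \<beta>"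
    using tsnd_eq[of "tpair T g" \<alpha>] by auto
  then obtain \<gamma> where \<gamma>: "\<gamma> \<in> F" "\<forall>j\<in>N. \<gamma> \<bullet> j = \<beta> \<bullet> Sc j"
      "tpair T g \<bullet> \<beta> = cd (\<beta> \<bullet> Z) (T \<bullet> (\<beta> \<bullet> One)) (g \<bullet> \<gamma>)"
    using tpair_eq[of T g \<beta>] a by auto
  have "\<gamma> = \<alpha>" using \<beta> \<gamma> a by - (rule function_ext[of _ Num Num], simp_all)
  then show "tsnd (tpair T g) \<bullet> \<alpha> = g \<bullet> \<alpha>" using \<beta> \<gamma> a by simp
qed simp_all

lemma wit1_eq: "x \<in> G \<Longrightarrow> y \<in> F \<Longrightarrow> cl wit1_tm \<bullet> x \<bullet> y = wit (tfst x) (tsnd x) (y \<bullet> Z) (star y)"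
  by (simp add: wit1_tm_def Let_def)

lemma wit0_eq: "x \<in> G \<Longrightarrow> y \<in> N \<Longrightarrow> cl wit0_tm \<bullet> x \<bullet> y = wit (tfst x) (tsnd x) y (dec y)"
  by (simp add: wit0_tm_def Let_def)

abbreviation "slen \<sigma> s \<equiv> I (CLen \<sigma>) \<bullet> s"
abbreviation "sget \<sigma> s i \<equiv> I (CGet \<sigma>) \<bullet> s \<bullet> i"

lemma pick_rec: "p \<in> F \<Longrightarrow> s \<in> D (Seq Num) \<Longrightarrow> pick p s Z = Z"
  "p \<in> F \<Longrightarrow> s \<in> D (Seq Num) \<Longrightarrow> j \<in> N \<Longrightarrow>
    pick p s (Sc j) = cd (p \<bullet> sget Num s j) (pick p s j) (sget Num s j)"
  by (simp_all add: pick_tm_def Let_def ev_upd_idle)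

lemma pick:
  assumes p: "p \<in> F" "s \<in> D (Seq Num)" "i \<in> N" "j \<in> N" and i: "p \<bullet> sget Num s i \<noteq> Z" "less i j"
  shows "p \<bullet> pick p s j \<noteq> Z"
proof -
  have "less i j \<longrightarrow> p \<bullet> pick p s j \<noteq> Z"
  proof (rule induct_Q[where P = "\<lambda>j. less i j \<longrightarrow> p \<bullet> pick p s j \<noteq> Z", OF _ _ _ p(4)])
    show "Q (\<lambda>j. less i j \<longrightarrow> p \<bullet> pick p s j \<noteq> Z)" using p
      by - (rule Q_rules cl_D[OF pick_tm(1,2)] | assumption)+
    fix j assume j: "j \<in> N" "less i j \<longrightarrow> p \<bullet> pick p s j \<noteq> Z"
    show "less i (Sc j) \<longrightarrow> p \<bullet> pick p s (Sc j) \<noteq> Z"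
    proof
      assume "less i (Sc j)"
      then have "less i j \<or> i = j" using less_Sc p j by auto
      then show "p \<bullet> pick p s (Sc j) \<noteq> Z" using p j i by (auto simp: pick_rec cd_Z)
    qed
  qed (use p in simp)
  then show ?thesis using i by blast
qed

lemma modulus_eq: "H \<in> D (one \<rightarrow> Seq Num) \<Longrightarrow> T \<in> F \<Longrightarrow> \<alpha> \<in> F \<Longrightarrow>
  \<exists>p\<in>F. (\<forall>n\<in>N. p \<bullet> n = eqv (T \<bullet> br (star \<alpha>) n) One) \<and>
    cl modulus_tm \<bullet> H \<bullet> T \<bullet> \<alpha> = pick p (H \<bullet> \<alpha>) (slen Num (H \<bullet> \<alpha>))"
proof -
  assume a: "H \<in> D (one \<rightarrow> Seq Num)" "T \<in> F" "\<alpha> \<in> F"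
  let ?r = "r0((0, one \<rightarrow> Seq Num) := H, (0, one) := T, (1, one) := \<alpha>)"
  let ?p = "ev ?r (lam (0, Num) (eq_tm \<cdot> (Var (0, one) \<cdot> bar (star_tm \<cdot> Var (1, one)) (Var (0, Num))) \<cdot> succ zero))"
  show ?thesis using a
    by (intro bexI[of _ ?p] conjI) (simp_all add: modulus_tm_def Let_def)
qed

lemma collect_eq: "H \<in> D (two \<rightarrow> Seq one) \<Longrightarrow> T \<in> F \<Longrightarrow> g \<in> G \<Longrightarrow>
  \<exists>f\<in>F. (\<forall>i\<in>N. f \<bullet> i = sget one (H \<bullet> tpair T g) i \<bullet> Z) \<and>
    cl collect_tm \<bullet> H \<bullet> T \<bullet> g = sig f (slen one (H \<bullet> tpair T g))"
proof -
  assume a: "H \<in> D (two \<rightarrow> Seq one)" "T \<in> F" "g \<in> G"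
  have H: "H \<bullet> tpair T g \<in> D (Seq one)" using a by (intro typed1[OF a(1)]) simp
  let ?r = "r0((0, two \<rightarrow> Seq one) := H, (0, one) := T, (0, two) := g)"
  let ?f = "ev ?r (lam (0, Num) (get one (Var (0, two \<rightarrow> Seq one) \<cdot> (tpair_tm \<cdot> Var (0, one) \<cdot> Var (0, two))) (Var (0, Num)) \<cdot> zero))"
  show ?thesis using a H
    by (intro bexI[of _ ?f] conjI) (simp_all add: collect_tm_def Let_def)
qed

end


text \<open>Through \<open>star_tm\<close> an exit is sought for every sequence, so the choice
  principles can be applied to all \<alpha> without the premise that \<alpha> is binary.\<close>

definition miss_tm :: trm where
  "miss_tm = (let T = (0, one); \<alpha> = (1, one); n = (0, Num) in
     lam T (lam \<alpha> (lam n (in_tm \<cdot> Var T \<cdot> bar (star_tm \<cdot> Var \<alpha>) (Var n)))))"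

lemma miss_tm [simp]: "wt L miss_tm" "ty miss_tm = one \<rightarrow> one \<rightarrow> Num \<rightarrow> Num" "fvt miss_tm = {}"
  by (auto simp: miss_tm_def Let_def)

context model
begin

section \<open>Standard objects\<close>

definition Sd :: "ftyp \<Rightarrow> 'e \<Rightarrow> bool" where
  "Sd \<sigma> x \<longleftrightarrow> x \<in> D \<sigma> \<and> ST x"

lemma Sd_D: "Sd \<sigma> x \<Longrightarrow> x \<in> D \<sigma>"
  by (simp add: Sd_def)

lemma sat_core': "\<psi> \<in> RCA0Omega_core L \<Longrightarrow> wff L \<psi> \<Longrightarrow> typed \<rho> \<Longrightarrow> sem \<rho> \<psi>"
  using sat_core by (simp add: typed_def)

lemma Sd_cl: "wt L t \<Longrightarrow> ty t = \<sigma> \<Longrightarrow> fvt t = {} \<Longrightarrow> Sd \<sigma> (cl t)"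
  using sat_core'[OF RCA0Omega_core.st_closed _ typed_r0, of t] by (simp add: Sd_def cl_def)

lemma Sd_app: "Sd (\<sigma> \<rightarrow> \<tau>) f \<Longrightarrow> Sd \<sigma> x \<Longrightarrow> Sd \<tau> (f \<bullet> x)"
proof -
  assume a: "Sd (\<sigma> \<rightarrow> \<tau>) f" "Sd \<sigma> x"
  then have fx: "f \<in> D (\<sigma> \<rightarrow> \<tau>)" "x \<in> D \<sigma>" by (simp_all add: Sd_def)
  obtain r where r: "typed r" "r (0, \<sigma> \<rightarrow> \<tau>) = f" "r (1, \<sigma>) = x" by (rule val3[OF fx fx(2)]) auto
  then have "ST (f \<bullet> x)"
    using sat_core'[OF RCA0Omega_core.st_app[of L "Var (0, \<sigma> \<rightarrow> \<tau>)" "Var (1, \<sigma>)"] _ r(1)] a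
    by (simp add: Sd_def)
  then show ?thesis using ap_typed fx by (simp add: Sd_def)
qed

lemma Sd_le: "Sd Num n \<Longrightarrow> m \<in> N \<Longrightarrow> le m n \<Longrightarrow> Sd Num m"
proof -
  assume a: "Sd Num n" "m \<in> N" "le m n"
  then have n: "n \<in> N" by (simp add: Sd_def)
  obtain r where r: "typed r" "r (0, Num) = m" "r (1, Num) = n" by (rule val3[OF a(2) n n]) auto
  then show ?thesis
    using sat_core'[OF RCA0Omega_core.st_le[of "Var (0, Num)" L "Var (1, Num)"] _ r(1)] a
    by (simp add: Sd_def Tm_def)
qed

lemma Sd_const: "Sd Num Z" "Sd one (I CSucc)" "Sd (Seq \<sigma> \<rightarrow> Num) (I (CLen \<sigma>))"
  "Sd (Seq \<sigma> \<rightarrow> Num \<rightarrow> \<sigma>) (I (CGet \<sigma>))" "Sd (\<sigma> \<rightarrow> \<tau> \<rightarrow> \<sigma>) (I (CK \<sigma> \<tau>))"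
  using Sd_cl[of zero] Sd_cl[of "Con CSucc"] Sd_cl[of "Con (CLen \<sigma>)"] Sd_cl[of "Con (CGet \<sigma>)"]
    Sd_cl[of "Con (CK \<sigma> \<tau>)"] by (simp_all add: cl_def)

lemmas Sd_tms = Sd_const Sd_cl[OF plus_tm] Sd_cl[OF monus_tm] Sd_cl[OF pair_tm] Sd_cl[OF bar_tm]
  Sd_cl[OF star_tm] Sd_cl[OF dec_tm] Sd_cl[OF bnd_tm] Sd_cl[OF tpair_tm] Sd_cl[OF tfst_tm]
  Sd_cl[OF tsnd_tm] Sd_cl[OF modulus_tm] Sd_cl[OF collect_tm] Sd_cl[OF paths_tm]

lemmas Sd_rules = Sd_app Sd_tms

lemma Sd_types [dest]: "Sd Num x \<Longrightarrow> x \<in> N" "Sd one x \<Longrightarrow> x \<in> F" "Sd two x \<Longrightarrow> x \<in> G"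
  by (rule Sd_D; assumption)+

text \<open>The only free variable must carry all data. Applied to a negated formula, the rule says
  that a parameter-free internal property that holds of some object holds of a standard one.\<close>

lemma transfer:
  assumes \<phi>: "wff L \<phi>" "internal \<phi>" "fv \<phi> \<subseteq> {v}"
    and st: "\<And>a. Sd (snd v) a \<Longrightarrow> sem (r0(v := a)) \<phi>" and a: "a \<in> D (snd v)"
  shows "sem (r0(v := a)) \<phi>"
  using sat_core'[OF RCA0Omega_core.pf_tp[OF \<phi>] _ typed_r0] \<phi> st a
  by (simp add: Sd_def)

lemma EQ_eq': "x \<in> D \<sigma> \<Longrightarrow> y \<in> D \<sigma> \<Longrightarrow> EQ \<sigma> x y \<Longrightarrow> x = y"
  using EQ_eq by blast

lemma hac:
  assumes W: "W \<in> D (\<rho> \<rightarrow> \<tau> \<rightarrow> Num)"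
    and ex: "\<And>x. Sd \<rho> x \<Longrightarrow> \<exists>y. Sd \<tau> y \<and> W \<bullet> x \<bullet> y = Z"
  shows "\<exists>H. Sd (\<rho> \<rightarrow> Seq \<tau>) H \<and>
    (\<forall>x. Sd \<rho> x \<longrightarrow> (\<exists>i\<in>N. less i (slen \<tau> (H \<bullet> x)) \<and> W \<bullet> x \<bullet> sget \<tau> (H \<bullet> x) i = Z))"
proof -
  let ?x = "(0, \<rho>)" and ?y = "(1, \<tau>)" and ?W = "(2, \<rho> \<rightarrow> \<tau> \<rightarrow> Num)" and ?F = "(3, \<rho> \<rightarrow> Seq \<tau>)"
  let ?\<phi> = "Var ?W \<cdot> Var ?x \<cdot> Var ?y \<doteq> zero"
  let ?r = "r0(?W := W)"
  let ?\<psi> = "AllSt ?x (ExSt ?y ?\<phi>) \<^bold>\<longrightarrow>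
      ExSt ?F (AllSt ?x (Ex ?y (mem \<tau> (Var ?y) (Var ?F \<cdot> Var ?x) \<^bold>\<and> ?\<phi>)))"
  have "wff L ?\<psi>"
    by (simp add: mem_def Let_def Tm_def fresh_def wff_eqn)
  moreover have "?\<psi> \<in> RCA0Omega_core L"
    by (rule RCA0Omega_core.hac_int) (simp_all add: Tm_def)
  ultimately have "sem ?r ?\<psi>" using W by (intro sat_core') simp_all
  then obtain H where H: "H \<in> D (\<rho> \<rightarrow> Seq \<tau>)" "ST H"
    and *: "\<And>x. x \<in> D \<rho> \<Longrightarrow> ST x \<Longrightarrow> \<exists>y\<in>D \<tau>. W \<bullet> x \<bullet> y = Z \<and>
      (\<exists>i\<in>N. less i (slen \<tau> (H \<bullet> x)) \<and> EQ \<tau> (sget \<tau> (H \<bullet> x) i) y)"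
    using ex by (fastforce simp: Sd_def mem_def Let_def fresh_def sat_eqn_EQ)
  have "\<exists>i\<in>N. less i (slen \<tau> (H \<bullet> x)) \<and> W \<bullet> x \<bullet> sget \<tau> (H \<bullet> x) i = Z" if x: "Sd \<rho> x" for x
  proof -
    obtain y i where y: "y \<in> D \<tau>" "W \<bullet> x \<bullet> y = Z" "i \<in> N" "less i (slen \<tau> (H \<bullet> x))"
      "EQ \<tau> (sget \<tau> (H \<bullet> x) i) y"
      using *[of x] x by (auto simp: Sd_def)
    \<comment> \<open>Membership in the list is extensional equality with an entry; in a model this
      is identity, so the entry itself is a witness.\<close>
    have "H \<bullet> x \<in> D (Seq \<tau>)" using ap_typed[OF H(1)] x by (simp add: Sd_def)
    then have "sget \<tau> (H \<bullet> x) i = y" using EQ_eq'[OF _ y(1,5)] y(3) by simp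
    then show ?thesis using y by blast
  qed
  then show ?thesis using H by (auto simp: Sd_def)
qed

lemma qfac:
  assumes ax: "\<And>\<psi> \<rho>. \<psi> \<in> QFAC L \<sigma> Num \<Longrightarrow> wff L \<psi> \<Longrightarrow> typed \<rho> \<Longrightarrow> sem \<rho> \<psi>"
    and W: "W \<in> D (\<sigma> \<rightarrow> one)" and ex: "\<And>x. x \<in> D \<sigma> \<Longrightarrow> \<exists>y\<in>N. W \<bullet> x \<bullet> y = Z"
  shows "\<exists>Y\<in>D (\<sigma> \<rightarrow> Num). \<forall>x\<in>D \<sigma>. W \<bullet> x \<bullet> (Y \<bullet> x) = Z"
proof -
  let ?x = "(0, \<sigma>)" and ?y = "(1, Num)" and ?W = "(2, \<sigma> \<rightarrow> one)" and ?F = "(3, \<sigma> \<rightarrow> Num)"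
  let ?\<phi> = "Var ?W \<cdot> Var ?x \<cdot> Var ?y \<doteq> zero"
  let ?\<psi> = "All ?x (Ex ?y ?\<phi>) \<^bold>\<longrightarrow> Ex ?F (All ?x (subst ?y (Var ?F \<cdot> Var ?x) ?\<phi>))"
  have "?\<psi> \<in> QFAC L \<sigma> Num"
    unfolding QFAC_def by (intro CollectI exI[of _ ?x] exI[of _ ?y] exI[of _ ?F] exI[of _ ?\<phi>])
      (simp add: Tm_def)
  moreover have "wff L ?\<psi>" by (simp add: Tm_def)
  ultimately have "sem (r0(?W := W)) ?\<psi>" using W by (intro ax) simp_all
  then show ?thesis using ex by auto
qed

lemma qfac1:
  "W \<in> D (one \<rightarrow> one) \<Longrightarrow> (\<And>x. x \<in> F \<Longrightarrow> \<exists>y\<in>N. W \<bullet> x \<bullet> y = Z) \<Longrightarrow>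
    \<exists>Y\<in>G. \<forall>x\<in>F. W \<bullet> x \<bullet> (Y \<bullet> x) = Z"
  using qfac[of one W] sat_base RCA0omega.qf_ac by blast


section \<open>The principles in the model\<close>

definition bin_st :: "'e \<Rightarrow> bool" where
  "bin_st \<alpha> \<longleftrightarrow> (\<forall>i. Sd Num i \<longrightarrow> le (\<alpha> \<bullet> i) One)"

definition tree_st :: "'e \<Rightarrow> bool" where
  "tree_st T \<longleftrightarrow> bin_st T \<and> (\<forall>s a. Sd Num s \<longrightarrow> Sd Num a \<longrightarrow> clos T s a)"

definition leaves_st :: "'e \<Rightarrow> bool" where
  "leaves_st T \<longleftrightarrow> (\<forall>\<alpha>. Sd one \<alpha> \<longrightarrow> bin_st \<alpha> \<longrightarrow> (\<exists>n. Sd Num n \<and> T \<bullet> br \<alpha> n \<noteq> One))"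

definition leaves :: "'e \<Rightarrow> bool" where
  "leaves T \<longleftrightarrow> (\<forall>\<alpha>\<in>F. bin_seq \<alpha> \<longrightarrow> (\<exists>n\<in>N. T \<bullet> br \<alpha> n \<noteq> One))"

definition mod_st :: "'e \<Rightarrow> 'e \<Rightarrow> bool" where
  "mod_st T g \<longleftrightarrow> (\<forall>\<alpha>. Sd one \<alpha> \<longrightarrow> bin_st \<alpha> \<longrightarrow> T \<bullet> br \<alpha> (g \<bullet> \<alpha>) \<noteq> One)"

definition is_mod :: "'e \<Rightarrow> 'e \<Rightarrow> bool" where
  "is_mod T g \<longleftrightarrow> (\<forall>\<alpha>\<in>F. bin_seq \<alpha> \<longrightarrow> T \<bullet> br \<alpha> (g \<bullet> \<alpha>) \<noteq> One)"

definition fan_st :: bool where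
  "fan_st \<longleftrightarrow> (\<forall>T. Sd one T \<longrightarrow> tree_st T \<longrightarrow> leaves_st T \<longrightarrow> (\<exists>k. Sd Num k \<and> paths T k = Z))"

definition ufan_st :: bool where
  "ufan_st \<longleftrightarrow> (\<exists>\<Phi>. Sd (one \<rightarrow> two \<rightarrow> Num) \<Phi> \<and> (\<forall>T g. Sd one T \<longrightarrow> Sd two g \<longrightarrow>
     tree_st T \<longrightarrow> mod_st T g \<longrightarrow> paths T (\<Phi> \<bullet> T \<bullet> g) = Z))"

definition fan :: bool where
  "fan \<longleftrightarrow> (\<forall>T\<in>F. is_tree T \<longrightarrow> leaves T \<longrightarrow> (\<exists>k\<in>N. paths T k = Z))"

definition ufan :: bool where
  "ufan \<longleftrightarrow> (\<exists>\<Phi>\<in>D (one \<rightarrow> two \<rightarrow> Num). \<forall>T\<in>F. \<forall>g\<in>G. is_tree T \<longrightarrow> is_mod T g \<longrightarrow>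
     paths T (\<Phi> \<bullet> T \<bullet> g) = Z)"

lemma bin_seq_st: "bin_seq \<alpha> \<Longrightarrow> bin_st \<alpha>"
  by (auto simp: bin_seq_def bin_st_def)

section \<open>Bounds, exits and truncated trees\<close>

lemma mo_le: "k \<in> N \<Longrightarrow> j \<in> N \<Longrightarrow> le (mo k j) k"
proof -
  assume k: "k \<in> N" "j \<in> N"
  show ?thesis
  proof (cases "le k j")
    case False
    then obtain d where d: "d \<in> N" "k = pl j d" using le_total[OF k] le_ex k by blast
    then have "mo k j = d" by (simp only:) (rule pl_mo, use k d in simp_all)
    then show ?thesis using d k by simp
  qed (use k in simp)
qed

text \<open>Trees are closed under removing one entry, so the induction descends from
  \<open>k\<close> through the lengths \<open>mo k j\<close>. The closure is asked only along
  \<beta> and up to \<open>k\<close>; hence the lemma also serves trees whose conditions are known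
  at standard arguments only.\<close>

lemma down:
  assumes T: "T \<in> F" "\<beta> \<in> F" "k \<in> N" "n \<in> N" "le n k"
    and clos: "\<And>m. m \<in> N \<Longrightarrow> le m k \<Longrightarrow> clos T (br \<beta> m) (\<beta> \<bullet> m)"
    and k: "T \<bullet> br \<beta> k = One"
  shows "T \<bullet> br \<beta> n = One"
proof -
  have *: "T \<bullet> br \<beta> (mo k j) = One" if j: "j \<in> N" for j
  proof (rule induct_Q[where P = "\<lambda>j. T \<bullet> br \<beta> (mo k j) = One", OF _ _ _ j])
    have "One \<in> N" by simp
    then show "Q (\<lambda>j. T \<bullet> br \<beta> (mo k j) = One)" using T by - (rule Q_rules | assumption)+
    fix j assume j: "j \<in> N" "T \<bullet> br \<beta> (mo k j) = One"
    have "mo k j \<in> N" using j T by simp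
    then show "T \<bullet> br \<beta> (mo k (Sc j)) = One"
    proof (cases "mo k j" rule: N_cases)
      case 1
      then show ?thesis using j T by (simp add: mo_rec)
    next
      case (2 m)
      have "le (mo k j) k" using T(3) j(1) by (rule mo_le)
      then have "le m k" using 2 le_trans[of m "Sc m" k] T by simp
      then show ?thesis using clos[of m] 2 j T by (simp add: mo_rec clos_def)
    qed
  qed (use T k in simp)
  have "mo k (mo k n) = n"
  proof -
    obtain d where "d \<in> N" "k = pl n d" using le_ex T by auto
    then show ?thesis using pl_mo[of n d] pl_mo[of d n] pl_comm[of n d] T by simp
  qed
  then show ?thesis using *[of "mo k n"] T by simp
qed

lemma paths_exit:
  "T \<in> F \<Longrightarrow> k \<in> N \<Longrightarrow> paths T k = Z \<Longrightarrow> \<beta> \<in> F \<Longrightarrow> bin_seq \<beta> \<Longrightarrow> \<exists>n\<in>N. le n k \<and> T \<bullet> br \<beta> n \<noteq> One"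
  using paths_Z by (intro bexI[of _ k]) auto

lemma exit_paths:
  assumes T: "T \<in> F" "is_tree T" "k \<in> N"
    and exit: "\<And>\<beta>. \<beta> \<in> F \<Longrightarrow> bin_seq \<beta> \<Longrightarrow> \<exists>n\<in>N. le n k \<and> T \<bullet> br \<beta> n \<noteq> One"
  shows "paths T k = Z"
  using down[of T _ k] exit T by (fastforce simp: paths_Z is_tree_def)

text \<open>Nothing is known of \<alpha> at nonstandard indices, where \<open>star \<alpha>\<close>
  may differ from it. A segment of standard length reads only standard indices.\<close>

lemma br_star_st: "Sd one \<alpha> \<Longrightarrow> bin_st \<alpha> \<Longrightarrow> Sd Num n \<Longrightarrow> br (star \<alpha>) n = br \<alpha> n"
proof (rule bar_cong[of _ _ n])
  fix i assume a: "Sd one \<alpha>" "bin_st \<alpha>" "Sd Num n" "i \<in> N" "less i n"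
  then have "le i n" using less_Sc[of i n] by auto
  then have "Sd Num i" using Sd_le a by blast
  then show "star \<alpha> \<bullet> i = \<alpha> \<bullet> i" using a by (auto simp: bin_st_def intro!: star_at)
qed auto

lemma Sd_star: "Sd one \<alpha> \<Longrightarrow> Sd one (star \<alpha>)"
  by (assumption | rule Sd_rules)+

lemma Sd_dec: "Sd Num t \<Longrightarrow> Sd one (dec t)"
  by (assumption | rule Sd_rules)+

lemma Sd_br: "Sd one \<alpha> \<Longrightarrow> Sd Num n \<Longrightarrow> Sd Num (br \<alpha> n)"
  by (assumption | rule Sd_rules)+

lemma exit_paths_st:
  assumes T: "Sd one T" "tree_st T" "Sd Num k"
    and exit: "\<And>\<beta>. Sd one \<beta> \<Longrightarrow> bin_seq \<beta> \<Longrightarrow> \<exists>n\<in>N. le n k \<and> T \<bullet> br \<beta> n \<noteq> One"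
  shows "paths T k = Z"
proof (subst paths_Z)
  show F: "T \<in> F" "k \<in> N" using T by auto
  show "\<forall>\<beta>\<in>F. bin_seq \<beta> \<longrightarrow> T \<bullet> br \<beta> k \<noteq> One"
  proof (intro ballI impI notI)
    fix \<beta> assume \<beta>: "\<beta> \<in> F" "bin_seq \<beta>" "T \<bullet> br \<beta> k = One"
    let ?t = "enc \<beta> k"
    have t: "?t \<in> N" using \<beta> F by simp
    have "Sd Num (bnd k)" using T(3) by - (assumption | rule Sd_rules)+
    then have "Sd Num ?t" using Sd_le enc_bound \<beta> F t by blast
    then have st: "Sd one (dec ?t)" by (rule Sd_dec)
    then obtain n where n: "n \<in> N" "le n k" "T \<bullet> br (dec ?t) n \<noteq> One"
      using exit dec_bin[OF t] by blast
    \<comment> \<open>The conditions of \<open>tree_st\<close> suffice here: every \<open>m\<close>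
      up to \<open>k\<close> is standard, and so are the node and the next entry of the standard
      sequence \<open>dec ?t\<close>.\<close>
    have "T \<bullet> br (dec ?t) n = One"
    proof (rule down[OF F(1) _ F(2) n(1,2)])
      fix m assume m: "m \<in> N" "le m k"
      then have m': "Sd Num m" using Sd_le T by blast
      have "Sd Num (dec ?t \<bullet> m)" using st m' by (rule Sd_app)
      then show "clos T (br (dec ?t) m) (dec ?t \<bullet> m)"
        using Sd_br[OF st m'] T by (simp add: tree_st_def)
    qed (use \<beta> F t bar_dec_enc[of \<beta> k k] in simp_all)
    then show False using n by blast
  qed
qed

lemma trunc_tree: "T \<in> F \<Longrightarrow> is_tree T \<longleftrightarrow> (\<forall>k\<in>N. trunc T k = Z)"
proof
  assume T: "T \<in> F" "\<forall>k\<in>N. trunc T k = Z"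
  \<comment> \<open>A single truncation level has to cover both arguments; their sum does.\<close>
  have "clos T s a" if "s \<in> N" "a \<in> N" for s a
    using T trunc_Z[of T "pl s a"] that le_pl by auto
  moreover have "le (T \<bullet> i) One" if "i \<in> N" for i
    using T trunc_Z[of T i] that by auto
  ultimately show "is_tree T" by (simp add: is_tree_def bin_seq_def)
qed (auto simp: trunc_Z is_tree_def bin_seq_def)

lemma trunc_tree_st: "Sd one T \<Longrightarrow> tree_st T \<longleftrightarrow> (\<forall>k. Sd Num k \<longrightarrow> trunc T k = Z)"
proof
  assume T: "Sd one T" "\<forall>k. Sd Num k \<longrightarrow> trunc T k = Z"
  have "clos T s a" if s: "Sd Num s" "Sd Num a" for s a
  proof -
    have "Sd Num (pl s a)" using s by - (assumption | rule Sd_rules)+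
    then have "trunc T (pl s a) = Z" using T by blast
    moreover have "T \<in> F" "s \<in> N" "a \<in> N" using T s by auto
    ultimately show ?thesis using trunc_Z[of T "pl s a"] le_pl by auto
  qed
  moreover have "le (T \<bullet> i) One" if "Sd Num i" for i
    using T trunc_Z[of T i] that Sd_types(1)[OF that] Sd_types(2)[OF T(1)] by auto
  ultimately show "tree_st T" by (simp add: tree_st_def bin_st_def)
next
  assume T: "Sd one T" "tree_st T"
  show "\<forall>k. Sd Num k \<longrightarrow> trunc T k = Z"
  proof (intro allI impI)
    fix k assume k: "Sd Num k"
    have st: "Sd Num i" if "i \<in> N" "le i k" for i using Sd_le[OF k that] .
    have "T \<in> F" "k \<in> N" using T k by auto
    then show "trunc T k = Z"
      using T st by (simp add: trunc_Z tree_st_def bin_st_def)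
  qed
qed

lemma miss_Z: "T \<in> F \<Longrightarrow> \<alpha> \<in> F \<Longrightarrow> n \<in> N \<Longrightarrow> cl miss_tm \<bullet> T \<bullet> \<alpha> \<bullet> n = Z \<longleftrightarrow> T \<bullet> br (star \<alpha>) n \<noteq> One"
  by (simp add: miss_tm_def Let_def)

lemma miss_typed: "T \<in> F \<Longrightarrow> cl miss_tm \<bullet> T \<in> D (one \<rightarrow> one)"
  by (rule ap_typed[OF cl_D]) simp_all

section \<open>The equivalence of \<open>FAN\<close> and \<open>UFAN2\<close> relative to standard
  objects\<close>

theorem fan_st_ufan_st:
  assumes fan_st
  shows ufan_st
proof -
  have "\<exists>y. Sd one y \<and> cl wit1_tm \<bullet> x \<bullet> y = Z" if x: "Sd two x" for x
  proof -
    let ?T = "tfst x" and ?g = "tsnd x"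
    have st: "Sd one ?T" "Sd two ?g" using x by - (assumption | rule Sd_rules)+
    then have F: "?T \<in> F" "?g \<in> G" "x \<in> G" using x by auto
    \<comment> \<open>A number is carried by the constant sequence with that value, since
      \<open>wit1_tm\<close> reads its number at argument 0.\<close>
    have const: ?thesis if k: "Sd Num k" "paths ?T k = Z \<or> trunc ?T k \<noteq> Z" for k
    proof -
      let ?y = "I (CK Num Num) \<bullet> k"
      have y: "Sd one ?y" using k by - (assumption | rule Sd_rules)+
      have "?y \<bullet> Z = k" using k by (intro K_eq[of _ Num _ Num]) auto
      moreover have "k \<in> N" "?y \<in> F" using k y by auto
      ultimately show ?thesis using y k(2) F by (intro exI[of _ ?y]) (auto simp: wit1_eq wit_Z)
    qed
    show ?thesis
    proof (cases "tree_st ?T")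
      case False
      then show ?thesis using const trunc_tree_st[OF st(1)] by blast
    next
      case tree: True
      show ?thesis
      proof (cases "\<exists>\<alpha>. Sd one \<alpha> \<and> bin_seq \<alpha> \<and> ?T \<bullet> br \<alpha> (?g \<bullet> \<alpha>) = One")
        case True
        then obtain \<alpha> where \<alpha>: "Sd one \<alpha>" "bin_seq \<alpha>" "?T \<bullet> br \<alpha> (?g \<bullet> \<alpha>) = One" by blast
        then have "\<alpha> \<in> F" by auto
        \<comment> \<open>The counterexample itself is the witness. It is binary and thus fixed by
          \<open>star\<close>; its value at 0 is then harmless, as the third alternative of
          \<open>wit_Z\<close> holds.\<close>
        then show ?thesis using \<alpha> F
          by (intro exI[of _ \<alpha>]) (simp add: wit1_eq wit_Z star_id)
      next
        case False
        \<comment> \<open>The sequence \<open>star \<alpha>\<close> is binary throughout, so the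
          absence of a standard counterexample applies to it, and the standard \<open>?g\<close>
          assigns it a standard exit length.\<close>
        have "leaves_st ?T" unfolding leaves_st_def
        proof (intro allI impI)
          fix \<alpha> assume \<alpha>: "Sd one \<alpha>" "bin_st \<alpha>"
          have s: "Sd one (star \<alpha>)" using \<alpha> Sd_star by blast
          have n: "Sd Num (?g \<bullet> star \<alpha>)" using st(2) s by (rule Sd_app)
          have "?T \<bullet> br (star \<alpha>) (?g \<bullet> star \<alpha>) \<noteq> One"
            using False s star_bin[of \<alpha>] \<alpha> by blast
          then show "\<exists>n. Sd Num n \<and> ?T \<bullet> br \<alpha> n \<noteq> One" using n br_star_st[OF \<alpha> n] by auto
        qed
        then obtain k where "Sd Num k" "paths ?T k = Z"
          using assms st tree unfolding fan_st_def by blast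
        then show ?thesis using const by blast
      qed
    qed
  qed
  from hac[OF cl_D[OF wit1_tm(1,2)] this] obtain H where H: "Sd (two \<rightarrow> Seq one) H"
    "\<And>x. Sd two x \<Longrightarrow> \<exists>i\<in>N. less i (slen one (H \<bullet> x)) \<and> cl wit1_tm \<bullet> x \<bullet> sget one (H \<bullet> x) i = Z"
    by blast
  let ?\<Phi> = "cl collect_tm \<bullet> H"
  have \<Phi>: "Sd (one \<rightarrow> two \<rightarrow> Num) ?\<Phi>" using H(1) by - (assumption | rule Sd_rules)+
  have "paths T (?\<Phi> \<bullet> T \<bullet> g) = Z" if T: "Sd one T" "Sd two g" "tree_st T" "mod_st T g" for T g
  proof -
    let ?x = "tpair T g"
    have F: "T \<in> F" "g \<in> G" "?x \<in> G" using T by (auto simp: Sd_D)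
    have x: "Sd two ?x" using T by - (assumption | rule Sd_rules)+
    obtain i where i: "i \<in> N" "less i (slen one (H \<bullet> ?x))" "cl wit1_tm \<bullet> ?x \<bullet> sget one (H \<bullet> ?x) i = Z"
      using H(2)[OF x] by blast
    let ?l = "slen one (H \<bullet> ?x)" and ?y = "sget one (H \<bullet> ?x) i"
    have l: "Sd Num ?l" using H(1) x by - (assumption | rule Sd_rules)+
    have lN: "?l \<in> N" using l by blast
    have "le i ?l" using less_Sc[OF i(1) lN] i(2) by blast
    then have "Sd Num i" using Sd_le l i by blast
    then have y: "Sd one ?y" using H(1) x by - (assumption | rule Sd_rules)+
    have yF: "?y \<in> F" using y by blast
    have k: "Sd Num (?y \<bullet> Z)" using y by - (assumption | rule Sd_rules)+
    \<comment> \<open>The entry \<open>?y\<close> is standard, so the hypotheses on \<open>T\<close>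
      and \<open>g\<close> exclude two of the three alternatives, and only the bound
      remains.\<close>
    have "wit T g (?y \<bullet> Z) (star ?y) = Z"
      using i(3) wit1_eq[OF F(3) yF] F by (simp add: tfst_tpair tsnd_tpair)
    moreover have "trunc T (?y \<bullet> Z) = Z" using trunc_tree_st T k by blast
    moreover have "T \<bullet> br (star ?y) (g \<bullet> star ?y) \<noteq> One"
      using T(4) Sd_star[OF y] star_bin[OF yF] bin_seq_st by (simp add: mod_st_def)
    ultimately have p: "paths T (?y \<bullet> Z) = Z" using F yF by (simp add: wit_Z)
    have bound: "Sd Num (?\<Phi> \<bullet> T \<bullet> g)" using \<Phi> T(1,2) by - (assumption | rule Sd_rules)+
    obtain f where f: "f \<in> F" "\<forall>i\<in>N. f \<bullet> i = sget one (H \<bullet> ?x) i \<bullet> Z" "?\<Phi> \<bullet> T \<bullet> g = sig f ?l"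
      using collect_eq[OF Sd_D[OF H(1)] F(1,2)] by blast
    have "le (?y \<bullet> Z) (?\<Phi> \<bullet> T \<bullet> g)" using Sum_le[OF f(1) i(1) lN i(2)] f i by simp
    then show ?thesis
      using p paths_Z[of T "?y \<bullet> Z"] F yF
      by (intro exit_paths_st[OF T(1,3) bound]) (auto intro!: bexI[of _ "?y \<bullet> Z"])
  qed
  then show ?thesis unfolding ufan_st_def using \<Phi> by blast
qed

text \<open>The premise of \<open>FAN\<close> gives each \<alpha> an exit length, while
  \<open>UFAN2\<close> needs a functional of type 2. The lists from \<open>HAC_int\<close> contain a
  correct length for each standard \<alpha>, and as membership in \<open>T\<close> can be tested,
  \<open>pick_tm\<close> finds one.\<close>

theorem ufan_st_fan_st:
  assumes ufan_st
  shows fan_st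
  unfolding fan_st_def
proof (intro allI impI)
  fix T assume T: "Sd one T" "tree_st T" "leaves_st T"
  have F: "T \<in> F" using T by blast
  have "\<exists>n. Sd Num n \<and> cl miss_tm \<bullet> T \<bullet> \<alpha> \<bullet> n = Z" if \<alpha>: "Sd one \<alpha>" for \<alpha>
  proof -
    have "\<alpha> \<in> F" using \<alpha> by blast
    moreover obtain n where n: "Sd Num n" "T \<bullet> br (star \<alpha>) n \<noteq> One"
      using T(3) Sd_star[OF \<alpha>] bin_seq_st[OF star_bin] calculation by (auto simp: leaves_st_def)
    moreover have "n \<in> N" using n by blast
    ultimately show ?thesis using F by (intro exI[of _ n]) (simp add: miss_Z)
  qed
  from hac[OF miss_typed[OF F] this] obtain H where H: "Sd (one \<rightarrow> Seq Num) H"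
    "\<And>\<alpha>. Sd one \<alpha> \<Longrightarrow> \<exists>i\<in>N. less i (slen Num (H \<bullet> \<alpha>)) \<and> cl miss_tm \<bullet> T \<bullet> \<alpha> \<bullet> sget Num (H \<bullet> \<alpha>) i = Z"
    by blast
  let ?g = "cl modulus_tm \<bullet> H \<bullet> T"
  have g: "Sd two ?g" using H(1) T(1) by - (assumption | rule Sd_rules)+
  have "mod_st T ?g" unfolding mod_st_def
  proof (intro allI impI)
    fix \<alpha> assume \<alpha>: "Sd one \<alpha>" "bin_st \<alpha>"
    have \<alpha>F: "\<alpha> \<in> F" using \<alpha> by blast
    let ?s = "H \<bullet> \<alpha>"
    have s: "?s \<in> D (Seq Num)" using ap_typed[OF Sd_D[OF H(1)] \<alpha>F] .
    obtain i where i: "i \<in> N" "less i (slen Num ?s)" "cl miss_tm \<bullet> T \<bullet> \<alpha> \<bullet> sget Num ?s i = Z"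
      using H(2)[OF \<alpha>(1)] by blast
    obtain p where p: "p \<in> F" "\<forall>n\<in>N. p \<bullet> n = eqv (T \<bullet> br (star \<alpha>) n) One"
      "?g \<bullet> \<alpha> = pick p ?s (slen Num ?s)"
      using modulus_eq[OF Sd_D[OF H(1)] F \<alpha>F] by blast
    have l: "slen Num ?s \<in> N" using s by simp
    have "p \<bullet> sget Num ?s i \<noteq> Z" using i p s F \<alpha>F by (simp add: miss_Z)
    from pick[OF p(1) s i(1) l this i(2)] have "p \<bullet> (?g \<bullet> \<alpha>) \<noteq> Z" using p by simp
    moreover have n: "Sd Num (?g \<bullet> \<alpha>)" using g \<alpha>(1) by (rule Sd_app)
    ultimately have "T \<bullet> br (star \<alpha>) (?g \<bullet> \<alpha>) \<noteq> One" using p(2) F \<alpha>F Sd_types(1)[OF n] by simp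
    then show "T \<bullet> br \<alpha> (?g \<bullet> \<alpha>) \<noteq> One" using br_star_st[OF \<alpha> n] by simp
  qed
  then obtain \<Phi> where \<Phi>: "Sd (one \<rightarrow> two \<rightarrow> Num) \<Phi>" "paths T (\<Phi> \<bullet> T \<bullet> ?g) = Z"
    using assms T g unfolding ufan_st_def by blast
  moreover have "Sd Num (\<Phi> \<bullet> T \<bullet> ?g)" using \<Phi>(1) T(1) g by (blast intro: Sd_app)
  ultimately show "\<exists>k. Sd Num k \<and> paths T k = Z" by blast
qed

end


section \<open>Terms for Grilliot's trick and for the leftmost path\<close>

definition curry_tm :: trm where
  "curry_tm = (let Y = (0, two \<rightarrow> Num); T = (0, one); g = (0, two) in
     lam Y (lam T (lam g (Var Y \<cdot> (tpair_tm \<cdot> Var T \<cdot> Var g)))))"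

text \<open>\<open>cut_tm g \<alpha> f\<close> is \<open>\<alpha>\<close> if \<open>f\<close> has no zero, and \<open>\<alpha>\<close> cut off at \<open>g \<alpha> + i\<close> if \<open>i\<close> is the first
  zero.\<close>

definition cut_tm :: trm where
  "cut_tm = (let g = (0, two); \<alpha> = (0, one); f = (1, one); j = (0, Num); i = (1, Num) in
     lam g (lam \<alpha> (lam f (lam j (cond_tm \<cdot> (sum_tm \<cdot> lam i (cond_tm \<cdot>
       (plus_tm \<cdot> (monus_tm \<cdot> (Var g \<cdot> Var \<alpha>) \<cdot> Var i) \<cdot> (Var f \<cdot> (monus_tm \<cdot> Var i \<cdot> (Var g \<cdot> Var \<alpha>)))) \<cdot>
       succ zero \<cdot> zero) \<cdot> succ (Var j)) \<cdot> (Var \<alpha> \<cdot> Var j) \<cdot> zero)))))"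

lemma curry_tm [simp]: "wt L curry_tm" "ty curry_tm = (two \<rightarrow> Num) \<rightarrow> one \<rightarrow> two \<rightarrow> Num" "fvt curry_tm = {}"
  by (auto simp: curry_tm_def Let_def)

lemma cut_tm [simp]: "wt L cut_tm" "ty cut_tm = two \<rightarrow> one \<rightarrow> one \<rightarrow> one" "fvt cut_tm = {}"
  by (auto simp: cut_tm_def Let_def)

definition jump_tm :: trm where
  "jump_tm = (let g = (0, two); \<alpha> = (0, one); f = (1, one); n = (0, Num) in
     lam g (lam \<alpha> (lam f (lam n (cond_tm \<cdot> (Var f \<cdot> Var n) \<cdot> zero \<cdot>
       (eq_tm \<cdot> (Var g \<cdot> (cut_tm \<cdot> Var g \<cdot> Var \<alpha> \<cdot> Var f)) \<cdot> (Var g \<cdot> Var \<alpha>)))))))"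

lemma jump_tm [simp]: "wt L jump_tm" "ty jump_tm = two \<rightarrow> one \<rightarrow> one \<rightarrow> one" "fvt jump_tm = {}"
  by (auto simp: jump_tm_def Let_def)

definition search_tm :: trm where
  "search_tm = (let m = (0, two); T = (0, one); g = (1, two) in
     lam m (lam T (lam g (Var m \<cdot> (paths_tm \<cdot> Var T)))))"

definition nontree_tm :: trm where
  "nontree_tm = (let T = (0, one); k = (0, Num) in
     lam T (lam k (cond_tm \<cdot> (tree_tm \<cdot> Var T \<cdot> Var k) \<cdot> succ zero \<cdot> zero)))"

text \<open>\<open>ext_tm T s n k\<close> is 0 iff the node \<open>s\<close> of length \<open>n\<close> has no binary extension of length
  \<open>n + k\<close> in \<open>T\<close>.\<close>

definition ext_tm :: trm where
  "ext_tm = (let T = (0, one); s = (0, Num); n = (1, Num); k = (2, Num); t = (3, Num) in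
     lam T (lam s (lam n (lam k (sum_tm \<cdot> lam t (cond_tm \<cdot> (eq_tm \<cdot> bar (dec_tm \<cdot> Var t) (Var n) \<cdot> Var s) \<cdot>
       (in_tm \<cdot> Var T \<cdot> bar (dec_tm \<cdot> Var t) (plus_tm \<cdot> Var n \<cdot> Var k)) \<cdot> zero) \<cdot>
       succ (bnd_tm \<cdot> (plus_tm \<cdot> Var n \<cdot> Var k)))))))"

lemma search_tm [simp]: "wt L search_tm" "ty search_tm = two \<rightarrow> one \<rightarrow> two \<rightarrow> Num" "fvt search_tm = {}"
  by (auto simp: search_tm_def Let_def)

lemma nontree_tm [simp]: "wt L nontree_tm" "ty nontree_tm = one \<rightarrow> one" "fvt nontree_tm = {}"
  by (auto simp: nontree_tm_def Let_def)

lemma ext_tm [simp]: "wt L ext_tm" "ty ext_tm = one \<rightarrow> Num \<rightarrow> Num \<rightarrow> one" "fvt ext_tm = {}"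
  by (auto simp: ext_tm_def Let_def)

text \<open>For a search functional \<open>m\<close>, the number \<open>f (m f)\<close> is 0 iff
  \<open>f\<close> has a zero, that is, iff the extensions of the left child in \<open>T\<close> die
  out at some length. Only then does the path turn right.\<close>

definition turn_tm :: trm where
  "turn_tm = (let m = (0, two); T = (0, one); s = (0, Num); n = (1, Num) in
     let f = ext_tm \<cdot> Var T \<cdot> snoc (Var s) zero \<cdot> succ (Var n) in
     lam m (lam T (lam s (lam n (cond_tm \<cdot> (f \<cdot> (Var m \<cdot> f)) \<cdot> succ zero \<cdot> zero)))))"

lemma turn_tm [simp]: "wt L turn_tm" "ty turn_tm = two \<rightarrow> one \<rightarrow> Num \<rightarrow> Num \<rightarrow> Num" "fvt turn_tm = {}"
  by (auto simp: turn_tm_def Let_def)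

definition node_tm :: trm where
  "node_tm = (let m = (0, two); T = (0, one); n = (0, Num); a = (1, Num); b = (2, Num) in
     lam m (lam T (lam n (Con CRec \<cdot> Var n \<cdot> zero \<cdot>
       lam a (lam b (snoc (Var a) (turn_tm \<cdot> Var m \<cdot> Var T \<cdot> Var a \<cdot> Var b)))))))"

lemma node_tm [simp]: "wt L node_tm" "ty node_tm = two \<rightarrow> one \<rightarrow> Num \<rightarrow> Num" "fvt node_tm = {}"
  by (auto simp: node_tm_def Let_def)

definition path_tm :: trm where
  "path_tm = (let m = (0, two); T = (0, one); n = (0, Num) in
     lam m (lam T (lam n (turn_tm \<cdot> Var m \<cdot> Var T \<cdot> (node_tm \<cdot> Var m \<cdot> Var T \<cdot> Var n) \<cdot> Var n))))"

lemma path_tm [simp]: "wt L path_tm" "ty path_tm = two \<rightarrow> one \<rightarrow> one" "fvt path_tm = {}"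
  by (auto simp: path_tm_def Let_def)

context model
begin

lemmas ev_tms_mu [simp] =
  ev_closed[OF curry_tm(3)] ev_closed[OF cut_tm(3)] ev_closed[OF jump_tm(3)] ev_closed[OF search_tm(3)]
  ev_closed[OF nontree_tm(3)] ev_closed[OF ext_tm(3)] ev_closed[OF turn_tm(3)]
  ev_closed[OF node_tm(3)] ev_closed[OF path_tm(3)] ev_closed[OF miss_tm(3)]

lemmas types_mu [simp] =
  typed3[OF cl_D[OF cut_tm(1,2)]] typed1[OF cl_D[OF nontree_tm(1,2)]]
  typed3[OF cl_D[OF ext_tm(1,2)]] ap_typed[OF typed3[OF cl_D[OF turn_tm(1,2)]]]
  typed3[OF cl_D[OF node_tm(1,2)]] typed2[OF cl_D[OF path_tm(1,2)]]
  typed1[OF cl_D[OF paths_tm(1,2)]]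

section \<open>Transfer of FAN\<close>

lemma modulus_exists: "T \<in> F \<Longrightarrow> leaves T \<Longrightarrow> \<exists>g\<in>G. is_mod T g"
proof -
  assume T: "T \<in> F" "leaves T"
  have "\<exists>n\<in>N. cl miss_tm \<bullet> T \<bullet> \<alpha> \<bullet> n = Z" if "\<alpha> \<in> F" for \<alpha>
    using T that star_bin[OF that] by (simp add: miss_Z leaves_def)
  from qfac1[OF miss_typed[OF T(1)] this] obtain g where
    g: "g \<in> G" "\<forall>\<alpha>\<in>F. cl miss_tm \<bullet> T \<bullet> \<alpha> \<bullet> (g \<bullet> \<alpha>) = Z" by blast
  then have g': "T \<bullet> br (star \<alpha>) (g \<bullet> \<alpha>) \<noteq> One" if "\<alpha> \<in> F" for \<alpha>
    using that T by (simp add: miss_Z)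
  have "is_mod T g" unfolding is_mod_def using g' by (metis star_id)
  then show ?thesis using g by blast
qed

theorem ufan_fan: "ufan \<Longrightarrow> fan"
  unfolding fan_def
proof (intro ballI impI)
  fix T assume u: ufan and T: "T \<in> F" "is_tree T" "leaves T"
  obtain g where g: "g \<in> G" "is_mod T g" using modulus_exists T by blast
  obtain \<Phi> where "\<Phi> \<in> D (one \<rightarrow> two \<rightarrow> Num)" "paths T (\<Phi> \<bullet> T \<bullet> g) = Z"
    using u g T unfolding ufan_def by blast
  then show "\<exists>k\<in>N. paths T k = Z" using T g typed2[of \<Phi>] by blast
qed

text \<open>An internal premise gives a standard \<alpha> some exit length, not evidently a standard
  one. With a modulus packed beside the tree, a standard pair has a standard modulus, whose values
  at standard sequences are standard, and \<open>leaves_st\<close> follows.\<close>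

theorem fan_st_fan:
  assumes fan_st
  shows fan
  unfolding fan_def
proof (intro ballI impI)
  fix T assume T: "T \<in> F" "is_tree T" "leaves T"
  obtain g where g: "g \<in> G" "is_mod T g" using modulus_exists T by blast
  let ?x = "(0, two)" and ?k = "(0, Num)" and ?\<alpha> = "(0, one)"
  let ?\<phi> = "All ?k (tree_tm \<cdot> (tfst_tm \<cdot> Var ?x) \<cdot> Var ?k \<doteq> zero) \<^bold>\<longrightarrow>
    All ?\<alpha> (\<^bold>\<not> (tfst_tm \<cdot> Var ?x \<cdot> bar (star_tm \<cdot> Var ?\<alpha>) (tsnd_tm \<cdot> Var ?x \<cdot> (star_tm \<cdot> Var ?\<alpha>)) \<doteq> succ zero)) \<^bold>\<longrightarrow>
    Ex ?k (paths_tm \<cdot> (tfst_tm \<cdot> Var ?x) \<cdot> Var ?k \<doteq> zero)"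
  have sem: "sem (r0(?x := x)) ?\<phi> \<longleftrightarrow> ((\<forall>k\<in>N. trunc (tfst x) k = Z) \<longrightarrow>
      (\<forall>\<alpha>\<in>F. tfst x \<bullet> br (star \<alpha>) (tsnd x \<bullet> star \<alpha>) \<noteq> One) \<longrightarrow> (\<exists>k\<in>N. paths (tfst x) k = Z))" for x
    by simp
  have "sem (r0(?x := tpair T g)) ?\<phi>"
  proof (rule transfer)
    show "wff L ?\<phi>" "internal ?\<phi>" "fv ?\<phi> \<subseteq> {?x}" by (auto simp: Tm_def)
    show "tpair T g \<in> D (snd ?x)" using T g by simp
    fix x assume "Sd (snd ?x) x"
    then have x: "Sd two x" by simp
    let ?T = "tfst x" and ?g = "tsnd x"
    have st: "Sd one ?T" "Sd two ?g" using x by - (assumption | rule Sd_rules)+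
    show "sem (r0(?x := x)) ?\<phi>" unfolding sem
    proof (intro impI)
      assume a: "\<forall>k\<in>N. trunc ?T k = Z" "\<forall>\<alpha>\<in>F. ?T \<bullet> br (star \<alpha>) (?g \<bullet> star \<alpha>) \<noteq> One"
      have "tree_st ?T" using a trunc_tree_st[OF st(1)] by blast
      moreover have "leaves_st ?T" unfolding leaves_st_def
      proof (intro allI impI)
        fix \<alpha> assume \<alpha>: "Sd one \<alpha>" "bin_st \<alpha>"
        have n: "Sd Num (?g \<bullet> star \<alpha>)" using st(2) Sd_star[OF \<alpha>(1)] by (rule Sd_app)
        then show "\<exists>n. Sd Num n \<and> ?T \<bullet> br \<alpha> n \<noteq> One"
          using a(2)[rule_format, OF Sd_types(2)[OF \<alpha>(1)]] br_star_st[OF \<alpha> n]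
          by (intro exI[of _ "?g \<bullet> star \<alpha>"]) simp
      qed
      ultimately show "\<exists>k\<in>N. paths ?T k = Z" using assms st(1) unfolding fan_st_def by blast
    qed
  qed
  then show "\<exists>k\<in>N. paths T k = Z"
    using T g trunc_tree[of T] star_bin unfolding sem by (simp add: tfst_tpair tsnd_tpair is_mod_def)
qed


section \<open>The case of a discontinuous functional\<close>

text \<open>Grilliot's trick: if \<open>g\<close> is discontinuous at \<open>\<alpha>\<close> along the sequences that cut off \<open>\<alpha>\<close>, then
  \<open>g\<close> decides whether a given \<open>f\<close> has a zero.\<close>

definition disc :: "'e \<Rightarrow> 'e \<Rightarrow> bool" where
  "disc g \<alpha> \<longleftrightarrow> (\<forall>M\<in>N. le (g \<bullet> \<alpha>) M \<longrightarrow> g \<bullet> dec (enc \<alpha> M) \<noteq> g \<bullet> \<alpha>)"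

definition is_mu :: "'e \<Rightarrow> bool" where
  "is_mu m \<longleftrightarrow> (\<forall>f\<in>F. \<forall>n\<in>N. f \<bullet> n = Z \<longrightarrow> f \<bullet> (m \<bullet> f) = Z)"

abbreviation "cutoff g \<alpha> f \<equiv> cl cut_tm \<bullet> g \<bullet> \<alpha> \<bullet> f"

text \<open>The function \<open>h\<close> has the zeros of \<open>f\<close> shifted by
  \<open>g \<alpha>\<close>, so cuts occur only at or beyond \<open>g \<alpha>\<close>, the range of
  which \<open>disc\<close> speaks.\<close>

lemma cut_eq:
  assumes g: "g \<in> G" "\<alpha> \<in> F" "f \<in> F"
  obtains h where "h \<in> F" "\<And>i. i \<in> N \<Longrightarrow> h \<bullet> i = Z \<longleftrightarrow> le (g \<bullet> \<alpha>) i \<and> f \<bullet> mo i (g \<bullet> \<alpha>) = Z"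
    "\<And>j. j \<in> N \<Longrightarrow> cutoff g \<alpha> f \<bullet> j = (if \<exists>i\<in>N. le i j \<and> h \<bullet> i = Z then Z else \<alpha> \<bullet> j)"
proof -
  let ?t = "plus_tm \<cdot> (monus_tm \<cdot> (Var (0, two) \<cdot> Var (0, one)) \<cdot> Var (Suc 0, Num)) \<cdot>
      (Var (1, one) \<cdot> (monus_tm \<cdot> Var (Suc 0, Num) \<cdot> (Var (0, two) \<cdot> Var (0, one))))"
  let ?r = "r0((0, two) := g, (0, one) := \<alpha>, (Suc 0, one) := f)"
  define h where "h = ev ?r (lam (Suc 0, Num) ?t)"
  have h: "h \<in> F" "\<And>i. i \<in> N \<Longrightarrow> h \<bullet> i = pl (mo (g \<bullet> \<alpha>) i) (f \<bullet> mo i (g \<bullet> \<alpha>))"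
    using g by (simp_all add: h_def)
  have "cutoff g \<alpha> f \<bullet> j = (if \<exists>i\<in>N. le i j \<and> h \<bullet> i = Z then Z else \<alpha> \<bullet> j)" if j: "j \<in> N" for j
  proof -
    define q where "q = ev (?r((0, Num) := j)) (lam (Suc 0, Num) (cond_tm \<cdot> ?t \<cdot> succ zero \<cdot> zero))"
    have q: "q \<in> F" "\<And>i. i \<in> N \<Longrightarrow> q \<bullet> i = cd (h \<bullet> i) One Z"
      using g j h by (simp_all add: q_def)
    have "cutoff g \<alpha> f \<bullet> j = cd (sig q (Sc j)) (\<alpha> \<bullet> j) Z"
      using g j by (simp add: cut_tm_def Let_def q_def del: Sum_rec)
    moreover have "sig q (Sc j) = Z \<longleftrightarrow> \<not> (\<exists>i\<in>N. le i j \<and> h \<bullet> i = Z)"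
      using Sum_Z_Sc[OF q(1) j] q(2) h(1) by (auto simp: cd_Z)
    moreover have "sig q (Sc j) \<in> N" using q j by (simp del: Sum_rec)
    ultimately show ?thesis using g j by (auto simp: cd_Z)
  qed
  then show ?thesis using h g by (intro that[of h]) auto
qed

lemma cut_no_zero:
  assumes "g \<in> G" "\<alpha> \<in> F" "f \<in> F" "\<forall>n\<in>N. f \<bullet> n \<noteq> Z"
  shows "cutoff g \<alpha> f = \<alpha>"
proof (rule function_ext[of _ Num Num])
  fix j assume j: "j \<in> N"
  obtain h where h: "h \<in> F" "\<And>i. i \<in> N \<Longrightarrow> h \<bullet> i = Z \<longleftrightarrow> le (g \<bullet> \<alpha>) i \<and> f \<bullet> mo i (g \<bullet> \<alpha>) = Z"
    "\<And>j. j \<in> N \<Longrightarrow> cutoff g \<alpha> f \<bullet> j = (if \<exists>i\<in>N. le i j \<and> h \<bullet> i = Z then Z else \<alpha> \<bullet> j)"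
    using cut_eq[OF assms(1-3)] by blast
  have "h \<bullet> i \<noteq> Z" if "i \<in> N" for i
    using h(2)[OF that] assms(4)[rule_format, of "mo i (g \<bullet> \<alpha>)"] that assms(1,2) by simp
  then show "cutoff g \<alpha> f \<bullet> j = \<alpha> \<bullet> j" using h(3)[OF j] by auto
qed (use assms in simp_all)

lemma cut_zero:
  assumes g: "g \<in> G" "\<alpha> \<in> F" "bin_seq \<alpha>" "f \<in> F" and n: "n \<in> N" "f \<bullet> n = Z"
  obtains M where "M \<in> N" "le (g \<bullet> \<alpha>) M" "cutoff g \<alpha> f = dec (enc \<alpha> M)"
proof -
  obtain h where h: "h \<in> F" "\<And>i. i \<in> N \<Longrightarrow> h \<bullet> i = Z \<longleftrightarrow> le (g \<bullet> \<alpha>) i \<and> f \<bullet> mo i (g \<bullet> \<alpha>) = Z"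
    "\<And>j. j \<in> N \<Longrightarrow> cutoff g \<alpha> f \<bullet> j = (if \<exists>i\<in>N. le i j \<and> h \<bullet> i = Z then Z else \<alpha> \<bullet> j)"
    using cut_eq[OF g(1,2,4)] by blast
  have "h \<bullet> pl (g \<bullet> \<alpha>) n = Z" using h(2) g n by (simp add: pl_mo)
  then obtain M where M: "M \<in> N" "h \<bullet> M = Z" "\<And>i. i \<in> N \<Longrightarrow> less i M \<Longrightarrow> h \<bullet> i \<noteq> Z"
    using least[OF h(1), of "pl (g \<bullet> \<alpha>) n"] g n by auto
  have "cutoff g \<alpha> f = dec (enc \<alpha> M)"
  proof (rule function_ext[of _ Num Num])
    fix j assume j: "j \<in> N"
    have "(\<exists>i\<in>N. le i j \<and> h \<bullet> i = Z) \<longleftrightarrow> le M j"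
    proof
      assume "\<exists>i\<in>N. le i j \<and> h \<bullet> i = Z"
      then obtain i where i: "i \<in> N" "le i j" "h \<bullet> i = Z" by blast
      then have "le M i" using M not_le[of M i] by blast
      then show "le M j" using le_trans i j M by blast
    qed (use M in blast)
    moreover have "less j M \<longleftrightarrow> \<not> le M j" using not_le[of M j] j M by blast
    ultimately show "cutoff g \<alpha> f \<bullet> j = dec (enc \<alpha> M) \<bullet> j" using h(3)[OF j] dec_enc[of \<alpha> M j] g M j by simp
  qed (use g M in simp_all)
  moreover have "le (g \<bullet> \<alpha>) M" using h(2)[OF M(1)] M(2) by blast
  ultimately show ?thesis using that M by blast
qed

text \<open>For every \<open>f\<close> some number meets the matrix: a zero of \<open>f\<close>, or
  any number if there is none, since the cut-off is then \<alpha> itself. If \<open>f\<close> has a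
  zero, \<open>disc\<close> makes the values of \<open>g\<close> differ, so the chosen number has to
  be a zero.\<close>

lemma disc_mu:
  assumes g: "g \<in> G" "\<alpha> \<in> F" "bin_seq \<alpha>" "disc g \<alpha>"
  shows "\<exists>m\<in>G. is_mu m"
proof -
  let ?W = "cl jump_tm \<bullet> g \<bullet> \<alpha>"
  have W: "?W \<in> D (one \<rightarrow> one)" using g by (intro typed2[OF cl_D[OF jump_tm(1,2)]])
  have W_Z: "?W \<bullet> f \<bullet> n = Z \<longleftrightarrow> f \<bullet> n = Z \<or> g \<bullet> cutoff g \<alpha> f = g \<bullet> \<alpha>" if "f \<in> F" "n \<in> N" for f n
    using g that by (simp add: jump_tm_def Let_def cd_Z)
  have "\<exists>n\<in>N. ?W \<bullet> f \<bullet> n = Z" if f: "f \<in> F" for f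
  proof (cases "\<exists>n\<in>N. f \<bullet> n = Z")
    case False
    then have "cutoff g \<alpha> f = \<alpha>" using cut_no_zero g f by blast
    then show ?thesis using W_Z[OF f, of Z] by (intro bexI[of _ Z]) auto
  qed (use W_Z f in blast)
  from qfac1[OF W this] obtain m where m: "m \<in> G" "\<forall>f\<in>F. ?W \<bullet> f \<bullet> (m \<bullet> f) = Z" by blast
  have "f \<bullet> (m \<bullet> f) = Z" if f: "f \<in> F" "n \<in> N" "f \<bullet> n = Z" for f n
  proof -
    obtain M where "M \<in> N" "le (g \<bullet> \<alpha>) M" "cutoff g \<alpha> f = dec (enc \<alpha> M)"
      using cut_zero[OF g(1-3) f] by blast
    then have "g \<bullet> cutoff g \<alpha> f \<noteq> g \<bullet> \<alpha>" using g(4) by (simp add: disc_def)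
    moreover have "m \<bullet> f \<in> N" using m f by simp
    ultimately show ?thesis using W_Z[OF f(1)] m(2) f(1) by blast
  qed
  then show ?thesis using m by (auto simp: is_mu_def)
qed

lemma mu_st: "m \<in> G \<Longrightarrow> is_mu m \<Longrightarrow> \<exists>m. Sd two m \<and> is_mu m"
proof (rule ccontr)
  assume m: "m \<in> G" "is_mu m" "\<not> (\<exists>m. Sd two m \<and> is_mu m)"
  let ?m = "(0, two)" and ?f = "(0, one)" and ?n = "(0, Num)"
  let ?\<phi> = "\<^bold>\<not> (All ?f (All ?n (Var ?f \<cdot> Var ?n \<doteq> zero \<^bold>\<longrightarrow> Var ?f \<cdot> (Var ?m \<cdot> Var ?f) \<doteq> zero)))"
  have sem: "sem (r0(?m := m)) ?\<phi> \<longleftrightarrow> \<not> is_mu m" for m by (simp add: is_mu_def)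
  have "sem (r0(?m := m)) ?\<phi>"
    by (rule transfer) (use m sem in \<open>auto simp: Tm_def\<close>)
  then show False using m sem by blast
qed

lemma mu_ufan: "m \<in> G \<Longrightarrow> is_mu m \<Longrightarrow> fan \<Longrightarrow> ufan"
proof -
  assume m: "m \<in> G" "is_mu m" fan
  let ?\<Phi> = "cl search_tm \<bullet> m"
  have \<Phi>: "?\<Phi> \<in> D (one \<rightarrow> two \<rightarrow> Num)" using m by (intro typed1[OF cl_D[OF search_tm(1,2)]])
  have eq: "?\<Phi> \<bullet> T \<bullet> g = m \<bullet> (cl paths_tm \<bullet> T)" if "T \<in> F" "g \<in> G" for T g
    using that m by (simp add: search_tm_def Let_def)
  have "paths T (?\<Phi> \<bullet> T \<bullet> g) = Z" if T: "T \<in> F" "g \<in> G" "is_tree T" "is_mod T g" for T g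
  proof -
    have "leaves T" using T by (auto simp: leaves_def is_mod_def)
    then obtain k where "k \<in> N" "paths T k = Z" using m T unfolding fan_def by blast
    moreover have "cl paths_tm \<bullet> T \<in> F" using T by simp
    ultimately have "paths T (m \<bullet> (cl paths_tm \<bullet> T)) = Z" using m(2) unfolding is_mu_def by blast
    then show ?thesis using eq[OF T(1,2)] by simp
  qed
  then show ?thesis unfolding ufan_def using \<Phi> by blast
qed


section \<open>The leftmost path of an infinite tree\<close>

abbreviation "ext T s n \<equiv> cl ext_tm \<bullet> T \<bullet> s \<bullet> n"
abbreviation "turn m T s n \<equiv> cl turn_tm \<bullet> m \<bullet> T \<bullet> s \<bullet> n"
abbreviation "node m T n \<equiv> cl node_tm \<bullet> m \<bullet> T \<bullet> n"
abbreviation "path m T \<equiv> cl path_tm \<bullet> m \<bullet> T"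

lemma ext_Z:
  assumes T: "T \<in> F" "s \<in> N" "n \<in> N" "k \<in> N"
  shows "ext T s n \<bullet> k = Z \<longleftrightarrow>
    (\<forall>\<beta>\<in>F. bin_seq \<beta> \<longrightarrow> br \<beta> n = s \<longrightarrow> T \<bullet> br \<beta> (pl n k) \<noteq> One)"
proof -
  let ?r = "r0((0, one) := T, (0, Num) := s, (Suc 0, Num) := n, (2, Num) := k)"
  define f where "f = ev ?r (lam (3, Num) (cond_tm \<cdot> (eq_tm \<cdot> bar (dec_tm \<cdot> Var (3, Num)) (Var (Suc 0, Num)) \<cdot> Var (0, Num)) \<cdot>
       (in_tm \<cdot> Var (0, one) \<cdot> bar (dec_tm \<cdot> Var (3, Num)) (plus_tm \<cdot> Var (Suc 0, Num) \<cdot> Var (2, Num))) \<cdot> zero))"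
  let ?M = "pl n k"
  have M: "?M \<in> N" using T by simp
  have f: "f \<in> F" "\<And>t. t \<in> N \<Longrightarrow> f \<bullet> t = Z \<longleftrightarrow> (br (dec t) n = s \<longrightarrow> T \<bullet> br (dec t) ?M \<noteq> One)"
    using T by (simp_all add: f_def cd_Z)
  have "ext T s n \<bullet> k = sig f (Sc (bnd ?M))"
    using T by (simp add: ext_tm_def Let_def f_def del: Sum_rec)
  then have "ext T s n \<bullet> k = Z \<longleftrightarrow>
      (\<forall>t\<in>N. le t (bnd ?M) \<longrightarrow> br (dec t) n = s \<longrightarrow> T \<bullet> br (dec t) ?M \<noteq> One)"
    using Sum_Z_Sc[OF f(1), of "bnd ?M"] f(2) M by simp
  also have "\<dots> \<longleftrightarrow> (\<forall>\<beta>\<in>F. bin_seq \<beta> \<longrightarrow> br \<beta> n = s \<longrightarrow> T \<bullet> br \<beta> ?M \<noteq> One)"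
  proof (intro iffI ballI impI)
    fix \<beta> assume *: "\<forall>t\<in>N. le t (bnd ?M) \<longrightarrow> br (dec t) n = s \<longrightarrow> T \<bullet> br (dec t) ?M \<noteq> One"
      and \<beta>: "\<beta> \<in> F" "bin_seq \<beta>" "br \<beta> n = s"
    have "br (dec (enc \<beta> ?M)) ?M = br \<beta> ?M" "br (dec (enc \<beta> ?M)) n = br \<beta> n"
      using bar_dec_enc[OF \<beta>(1,2) M] M T by simp_all
    then show "T \<bullet> br \<beta> ?M \<noteq> One"
      using *[rule_format, OF _ enc_bound[OF \<beta>(1,2) M]] \<beta> M by simp
  qed (use dec_bin in auto)
  finally show ?thesis .
qed

lemma turn_eq:
  "m \<in> G \<Longrightarrow> T \<in> F \<Longrightarrow> s \<in> N \<Longrightarrow> n \<in> N \<Longrightarrow> turn m T s n =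
    cd (ext T (sn s Z) (Sc n) \<bullet> (m \<bullet> ext T (sn s Z) (Sc n))) One Z"
  by (simp add: turn_tm_def Let_def)

lemma node_rec: "m \<in> G \<Longrightarrow> T \<in> F \<Longrightarrow> node m T Z = Z"
  "m \<in> G \<Longrightarrow> T \<in> F \<Longrightarrow> n \<in> N \<Longrightarrow> node m T (Sc n) = sn (node m T n) (turn m T (node m T n) n)"
  by (simp_all add: node_tm_def Let_def ev_upd_idle)

lemma path_eq: "m \<in> G \<Longrightarrow> T \<in> F \<Longrightarrow> n \<in> N \<Longrightarrow> path m T \<bullet> n = turn m T (node m T n) n"
  by (simp add: path_tm_def Let_def)

lemma path_bin: "m \<in> G \<Longrightarrow> T \<in> F \<Longrightarrow> bin_seq (path m T)"
  by (simp add: bin_seq_def le_One path_eq turn_eq cd_Z)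

lemma br_path: "m \<in> G \<Longrightarrow> T \<in> F \<Longrightarrow> n \<in> N \<Longrightarrow> br (path m T) n = node m T n"
proof -
  assume m: "m \<in> G" "T \<in> F" and n: "n \<in> N"
  show ?thesis
  proof (rule induct_eq[where f = "\<lambda>n. br (path m T) n" and g = "\<lambda>n. node m T n", OF _ _ _ _ n])
    show "R Num (\<lambda>n. br (path m T) n)" "R Num (\<lambda>n. node m T n)" using m
      by - (rule R_rules cl_D[OF path_tm(1,2)] cl_D[OF node_tm(1,2)] | assumption)+
  qed (use m in \<open>simp_all add: node_rec path_eq\<close>)
qed

text \<open>That a node has extensions of every length is a universal statement, which the available
  induction does not cover. By means of \<open>m\<close> it becomes
  \<open>?e n \<bullet> (m \<bullet> ?e n) \<noteq> Z\<close>, a predicate in \<open>Q\<close>, and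
  can be carried along the path.\<close>

lemma leftmost_path:
  assumes m: "m \<in> G" "is_mu m" and T: "T \<in> F" "is_tree T" and inf: "\<And>k. k \<in> N \<Longrightarrow> paths T k \<noteq> Z"
    and n: "n \<in> N"
  shows "T \<bullet> br (path m T) n = One"
proof -
  let ?s = "node m T"
  let ?e = "\<lambda>n. ext T (?s n) n"
  have mu: "(\<forall>k\<in>N. f \<bullet> k \<noteq> Z) \<longleftrightarrow> f \<bullet> (m \<bullet> f) \<noteq> Z" if "f \<in> F" for f
    using m that by (auto simp: is_mu_def)
  have inf_ext: "?e n \<bullet> (m \<bullet> ?e n) \<noteq> Z" if n: "n \<in> N" for n
  proof (rule induct_Q[where P = "\<lambda>n. ?e n \<bullet> (m \<bullet> ?e n) \<noteq> Z", OF _ _ _ n])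
    show "Q (\<lambda>n. ?e n \<bullet> (m \<bullet> ?e n) \<noteq> Z)" using m(1) T(1)
      by - (rule Q_rules cl_D[OF ext_tm(1,2)] cl_D[OF node_tm(1,2)] | assumption)+
    have "?e Z \<bullet> k \<noteq> Z" if "k \<in> N" for k
      using inf[OF that] that T m by (auto simp: ext_Z node_rec paths_Z)
    then show "?e Z \<bullet> (m \<bullet> ?e Z) \<noteq> Z" using mu[of "?e Z"] T m by simp
    fix n assume n: "n \<in> N" "?e n \<bullet> (m \<bullet> ?e n) \<noteq> Z"
    have sN: "?s n \<in> N" using m T n by simp
    have alive: "?e n \<bullet> k \<noteq> Z" if "k \<in> N" for k using mu[of "?e n"] n m T that sN by simp
    let ?f = "ext T (sn (?s n) Z) (Sc n)"
    have fF: "?f \<in> F" using T n sN by simp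
    have "?e (Sc n) \<bullet> k \<noteq> Z" if k: "k \<in> N" for k
    proof (cases "?f \<bullet> (m \<bullet> ?f) = Z")
      case False
      then have "?e (Sc n) = ?f" using m T n sN by (simp add: node_rec turn_eq cd_Z)
      moreover have "?f \<bullet> k \<noteq> Z" using mu[OF fF] False k by blast
      ultimately show ?thesis by simp
    next
      case True
      let ?k0 = "m \<bullet> ?f"
      have k0: "?k0 \<in> N" using m fF by simp
      \<comment> \<open>The left child has no extension of length n + 1 + \<open>?k0\<close>. A
        \<beta> that stays in the tree up to length n + 1 + \<open>?k0\<close> + k must therefore
        turn right, and it still extends the right child by k entries.\<close>
      obtain \<beta> where \<beta>: "\<beta> \<in> F" "bin_seq \<beta>" "br \<beta> n = ?s n" "T \<bullet> br \<beta> (pl n (Sc (pl ?k0 k))) = One"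
        using alive[of "Sc (pl ?k0 k)"] ext_Z[OF T(1) sN n(1)] k k0 by auto
      let ?M = "pl (Sc n) (pl ?k0 k)"
      have M: "?M \<in> N" "T \<bullet> br \<beta> ?M = One" using \<beta> n k k0 by simp_all
      have down': "T \<bullet> br \<beta> i = One" if "i \<in> N" "le i ?M" for i
        using down[OF T(1) \<beta>(1) M(1) that _ M(2)] T(2) \<beta>(1) by (simp add: is_tree_def)
      have le: "le (pl (Sc n) ?k0) ?M" "le (pl (Sc n) k) ?M"
        using pl_mono[of "Sc n" "Sc n" ?k0 "pl ?k0 k"] pl_mono[of "Sc n" "Sc n" k "pl ?k0 k"] n k k0
        by simp_all
      have "\<beta> \<bullet> n \<noteq> Z"
      proof
        assume "\<beta> \<bullet> n = Z"
        then have "br \<beta> (Sc n) = sn (?s n) Z" using \<beta> n by simp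
        moreover have "T \<bullet> br \<beta> (pl (Sc n) ?k0) = One" using down' le(1) n k0 by simp
        ultimately show False using True ext_Z[OF T(1), of "sn (?s n) Z" "Sc n" ?k0] \<beta> sN n k0 by simp
      qed
      then have "\<beta> \<bullet> n = One" using bin_seqD \<beta> n by blast
      then have "br \<beta> (Sc n) = ?s (Sc n)" using \<beta> n m T sN True by (simp add: node_rec turn_eq)
      moreover have "T \<bullet> br \<beta> (pl (Sc n) k) = One" using down' le(2) n k by simp
      moreover have "?s (Sc n) \<in> N" using m T n by simp
      ultimately show ?thesis using ext_Z[OF T(1), of "?s (Sc n)" "Sc n" k] \<beta> n k by auto
    qed
    then show "?e (Sc n) \<bullet> (m \<bullet> ?e (Sc n)) \<noteq> Z" using mu[of "?e (Sc n)"] T m n by simp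
  qed
  have sN: "?s n \<in> N" using m T n by simp
  have "?e n \<bullet> Z \<noteq> Z" using mu[of "?e n"] inf_ext[OF n] T m n sN by simp
  then obtain \<beta> where "br \<beta> n = ?s n" "T \<bullet> br \<beta> n = One"
    using ext_Z[OF T(1) sN n, of Z] n by auto
  then show ?thesis using br_path[OF m(1) T(1) n] by simp
qed

text \<open>A standard search functional takes a standard function with any zero to a standard zero.
  It thus acts as a transfer principle with standard parameters: it makes \<open>T\<close> a tree at
  all arguments and a given bound standard. If there is no bound, the leftmost path is standard,
  being computed from \<open>T\<close> and \<open>m\<close>, and contradicts
  \<open>leaves_st\<close>.\<close>

lemma mu_fan_st:
  assumes m: "Sd two m" "is_mu m"
  shows fan_st
  unfolding fan_st_def
proof (intro allI impI)
  fix T assume T: "Sd one T" "tree_st T" "leaves_st T"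
  have F: "T \<in> F" "m \<in> G" using T m by auto
  have mu: "Sd Num (m \<bullet> f) \<and> f \<bullet> (m \<bullet> f) = Z" if "Sd one f" "n \<in> N" "f \<bullet> n = Z" for f n
    using m that Sd_app[OF m(1) that(1)] by (auto simp: is_mu_def)
  have tree: "is_tree T" unfolding trunc_tree[OF F(1)]
  proof (intro ballI, rule ccontr)
    fix k assume k: "k \<in> N" "trunc T k \<noteq> Z"
    let ?f = "cl nontree_tm \<bullet> T"
    have f: "?f \<bullet> k = Z \<longleftrightarrow> trunc T k \<noteq> Z" if "k \<in> N" for k
      using that F by (simp add: nontree_tm_def Let_def cd_Z)
    have "Sd one ?f" using T(1) by - (assumption | rule Sd_rules Sd_cl[OF nontree_tm])+
    then have "Sd Num (m \<bullet> ?f)" "?f \<bullet> (m \<bullet> ?f) = Z" using mu f k by blast+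
    then show False using f T trunc_tree_st by blast
  qed
  show "\<exists>k. Sd Num k \<and> paths T k = Z"
  proof (cases "\<exists>k\<in>N. paths T k = Z")
    case True
    have "Sd one (cl paths_tm \<bullet> T)" using T(1) by - (assumption | rule Sd_rules)+
    then show ?thesis using mu True by blast
  next
    case False
    have "Sd one (path m T)" using T(1) m(1) by - (assumption | rule Sd_rules Sd_cl[OF path_tm])+
    then obtain n where "Sd Num n" "T \<bullet> br (path m T) n \<noteq> One"
      using T(3) bin_seq_st[OF path_bin[OF F(2,1)]] unfolding leaves_st_def by blast
    then show ?thesis using leftmost_path[OF F(2) m(2) F(1) tree] False by blast
  qed
qed


section \<open>The case of continuous functionals\<close>

lemma continuous_case:
  assumes ax: "\<And>\<psi> \<rho>. \<psi> \<in> QFAC L two Num \<Longrightarrow> wff L \<psi> \<Longrightarrow> typed \<rho> \<Longrightarrow> sem \<rho> \<psi>"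
    and cont: "\<And>g \<alpha>. g \<in> G \<Longrightarrow> \<alpha> \<in> F \<Longrightarrow> bin_seq \<alpha> \<Longrightarrow> \<not> disc g \<alpha>" and fan
  shows "ufan \<and> ufan_st"
proof -
  let ?W = "cl wit0_tm"
  have "\<exists>y\<in>N. ?W \<bullet> x \<bullet> y = Z" if x: "x \<in> G" for x
  proof -
    let ?T = "tfst x" and ?g = "tsnd x"
    have F: "?T \<in> F" "?g \<in> G" using x by simp_all
    have W: "?W \<bullet> x \<bullet> y = Z \<longleftrightarrow> paths ?T y = Z \<or> trunc ?T y \<noteq> Z \<or> ?T \<bullet> br (dec y) (?g \<bullet> dec y) = One"
      if "y \<in> N" for y using x F that by (simp add: wit0_eq wit_Z)
    show ?thesis
    proof (cases "is_tree ?T \<and> leaves ?T")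
      case True
      then show ?thesis using \<open>fan\<close> F W unfolding fan_def by blast
    next
      case False
      show ?thesis
      proof (cases "is_tree ?T")
        case True
        then obtain \<alpha> where \<alpha>: "\<alpha> \<in> F" "bin_seq \<alpha>" "\<forall>n\<in>N. ?T \<bullet> br \<alpha> n = One"
          using False by (auto simp: leaves_def)
        \<comment> \<open>As \<open>M\<close> is at least the value of \<open>?g\<close> at
          \<alpha>, the cut-off agrees with \<alpha> up to that length, which is also the value of
          \<open>?g\<close> at the cut-off; so the segment tested there is still in the
          tree.\<close>
        obtain M where M: "M \<in> N" "le (?g \<bullet> \<alpha>) M" "?g \<bullet> dec (enc \<alpha> M) = ?g \<bullet> \<alpha>"
          using cont[OF F(2) \<alpha>(1,2)] by (auto simp: disc_def)
        have n: "?g \<bullet> \<alpha> \<in> N" "enc \<alpha> M \<in> N" using F \<alpha> M by simp_all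
        have "?T \<bullet> br (dec (enc \<alpha> M)) (?g \<bullet> dec (enc \<alpha> M)) = One"
          using bar_dec_enc[OF \<alpha>(1,2) M(1) n(1) M(2)] \<alpha>(3) n M(3) by simp
        then show ?thesis using W[OF n(2)] n(2) by blast
      qed (use trunc_tree[OF F(1)] W in blast)
    qed
  qed
  from qfac[OF ax cl_D[OF wit0_tm(1,2)] this] obtain Y where
    Y: "Y \<in> D (two \<rightarrow> Num)" "\<forall>x\<in>G. ?W \<bullet> x \<bullet> (Y \<bullet> x) = Z" by blast
  have curry: "cl curry_tm \<bullet> Y \<bullet> T \<bullet> g = Y \<bullet> tpair T g" if "Y \<in> D (two \<rightarrow> Num)" "T \<in> F" "g \<in> G" for Y T g
    using that typed1[OF that(1)] by (simp add: curry_tm_def Let_def)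
  have W: "paths T (Y \<bullet> tpair T g) = Z \<or> trunc T (Y \<bullet> tpair T g) \<noteq> Z \<or>
      T \<bullet> br (dec (Y \<bullet> tpair T g)) (g \<bullet> dec (Y \<bullet> tpair T g)) = One"
    if "Y \<in> D (two \<rightarrow> Num)" "\<forall>x\<in>G. ?W \<bullet> x \<bullet> (Y \<bullet> x) = Z" "T \<in> F" "g \<in> G" for Y T g
  proof -
    have x: "tpair T g \<in> G" "Y \<bullet> tpair T g \<in> N" using that typed1[OF that(1), of "tpair T g"] by simp_all
    then have "?W \<bullet> tpair T g \<bullet> (Y \<bullet> tpair T g) = Z" using that by blast
    then show ?thesis using x that by (simp add: wit0_eq wit_Z tfst_tpair tsnd_tpair)
  qed
  have ufan
  proof -
    have \<Phi>: "cl curry_tm \<bullet> Y \<in> D (one \<rightarrow> two \<rightarrow> Num)" using Y by (intro typed1[OF cl_D[OF curry_tm(1,2)]])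
    have "paths T (cl curry_tm \<bullet> Y \<bullet> T \<bullet> g) = Z" if T: "T \<in> F" "g \<in> G" "is_tree T" "is_mod T g" for T g
    proof -
      have y: "Y \<bullet> tpair T g \<in> N" using typed1[OF Y(1), of "tpair T g"] T by simp
      then have "trunc T (Y \<bullet> tpair T g) = Z" using trunc_tree T by blast
      moreover have "T \<bullet> br (dec (Y \<bullet> tpair T g)) (g \<bullet> dec (Y \<bullet> tpair T g)) \<noteq> One"
        using T(4) dec_bin[OF y] y by (simp add: is_mod_def)
      ultimately show ?thesis using W[OF Y T(1,2)] curry[OF Y(1) T(1,2)] by simp
    qed
    then show ?thesis unfolding ufan_def using \<Phi> by blast
  qed
  \<comment> \<open>The chosen functional need not be standard. Its defining property has no
    parameters, so transferring the negation provides a standard one.\<close>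
  moreover have "\<exists>Y. Sd (two \<rightarrow> Num) Y \<and> (\<forall>x\<in>G. ?W \<bullet> x \<bullet> (Y \<bullet> x) = Z)"
  proof (rule ccontr)
    assume no: "\<not> ?thesis"
    let ?Y = "(0, two \<rightarrow> Num)" and ?x = "(0, two)"
    let ?\<phi> = "\<^bold>\<not> (All ?x (wit0_tm \<cdot> Var ?x \<cdot> (Var ?Y \<cdot> Var ?x) \<doteq> zero))"
    have sem: "sem (r0(?Y := Y)) ?\<phi> \<longleftrightarrow> \<not> (\<forall>x\<in>G. ?W \<bullet> x \<bullet> (Y \<bullet> x) = Z)" for Y by simp
    have "sem (r0(?Y := Y)) ?\<phi>"
      by (rule transfer) (use Y no sem in \<open>auto simp: Tm_def\<close>)
    then show False using Y sem by blast
  qed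
  then obtain Y where Y: "Sd (two \<rightarrow> Num) Y" "\<forall>x\<in>G. ?W \<bullet> x \<bullet> (Y \<bullet> x) = Z" by blast
  have ufan_st
  proof -
    have \<Phi>: "Sd (one \<rightarrow> two \<rightarrow> Num) (cl curry_tm \<bullet> Y)"
      using Y(1) by - (assumption | rule Sd_rules Sd_cl[OF curry_tm])+
    have "paths T (cl curry_tm \<bullet> Y \<bullet> T \<bullet> g) = Z"
      if T: "Sd one T" "Sd two g" "tree_st T" "mod_st T g" for T g
    proof -
      have F: "T \<in> F" "g \<in> G" using T by auto
      have y: "Sd Num (Y \<bullet> tpair T g)" using Y(1) T(1,2) by - (assumption | rule Sd_rules)+
      then have "trunc T (Y \<bullet> tpair T g) = Z" using trunc_tree_st T by blast
      moreover have "T \<bullet> br (dec (Y \<bullet> tpair T g)) (g \<bullet> dec (Y \<bullet> tpair T g)) \<noteq> One"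
        using T(4) bin_seq_st[OF dec_bin] Sd_dec[OF y] y by (auto simp: mod_st_def)
      ultimately show ?thesis using W[OF Sd_D[OF Y(1)] Y(2) F] curry[OF Sd_D[OF Y(1)] F] by simp
    qed
    then show ?thesis unfolding ufan_st_def using \<Phi> by blast
  qed
  ultimately show ?thesis by blast
qed

theorem fan_ufan_fan_st:
  assumes ax: "\<And>\<psi> \<rho>. \<psi> \<in> QFAC L two Num \<Longrightarrow> wff L \<psi> \<Longrightarrow> typed \<rho> \<Longrightarrow> sem \<rho> \<psi>"
    and fan
  shows "ufan \<and> fan_st"
proof (cases "\<exists>g\<in>G. \<exists>\<alpha>\<in>F. bin_seq \<alpha> \<and> disc g \<alpha>")
  case True
  then obtain m where "m \<in> G" "is_mu m" using disc_mu by blast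
  then show ?thesis using mu_ufan \<open>fan\<close> mu_st mu_fan_st by blast
next
  case False
  then show ?thesis using continuous_case[OF ax _ \<open>fan\<close>] ufan_st_fan_st by blast
qed


section \<open>Satisfaction of the principles\<close>

lemma sat_bin: "snd v = one \<Longrightarrow> sem \<rho> (bin v) \<longleftrightarrow> bin_seq (\<rho> v)"
  "snd v = one \<Longrightarrow> sem \<rho> (rel (bin v)) \<longleftrightarrow> bin_st (\<rho> v)"
  by (auto simp: bin_def bin_seq_def bin_st_def Let_def Sd_def)

lemma sat_tree: "sem \<rho> (tree (0, one)) \<longleftrightarrow> is_tree (\<rho> (0, one))"
  "sem \<rho> (rel (tree (0, one))) \<longleftrightarrow> tree_st (\<rho> (0, one))"
  by (auto simp: tree_def is_tree_def tree_st_def clos_def Let_def Sd_def sat_bin)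

lemma sat_leave: "sem \<rho> (all_paths_leave (0, one)) \<longleftrightarrow> leaves (\<rho> (0, one))"
  "sem \<rho> (rel (all_paths_leave (0, one))) \<longleftrightarrow> leaves_st (\<rho> (0, one))"
  by (auto simp: all_paths_leave_def leaves_def leaves_st_def Let_def Sd_def sat_bin)

definition exits :: "'e \<Rightarrow> 'e \<Rightarrow> bool" where
  "exits T k \<longleftrightarrow> (\<forall>\<alpha>\<in>F. bin_seq \<alpha> \<longrightarrow> (\<exists>n\<in>N. le n k \<and> T \<bullet> br \<alpha> n \<noteq> One))"

definition exits_st :: "'e \<Rightarrow> 'e \<Rightarrow> bool" where
  "exits_st T k \<longleftrightarrow> (\<forall>\<alpha>. Sd one \<alpha> \<longrightarrow> bin_st \<alpha> \<longrightarrow> (\<exists>n\<in>N. le n k \<and> T \<bullet> br \<alpha> n \<noteq> One))"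

lemma sat_leave_by:
  assumes "(1, one) \<notin> fvt k" "(0, Num) \<notin> fvt k"
  shows "sem \<rho> (all_paths_leave_by (0, one) k) \<longleftrightarrow> exits (\<rho> (0, one)) (ev \<rho> k)"
    "sem \<rho> (rel (all_paths_leave_by (0, one) k)) \<longleftrightarrow> exits_st (\<rho> (0, one)) (ev \<rho> k)"
  using assms
  by (auto simp: all_paths_leave_by_def exits_def exits_st_def Let_def Sd_def sat_bin ev_upd_idle)

lemma exits_paths: "T \<in> F \<Longrightarrow> is_tree T \<Longrightarrow> k \<in> N \<Longrightarrow> exits T k \<longleftrightarrow> paths T k = Z"
  using exit_paths paths_exit unfolding exits_def by blast

lemma exits_paths_st:
  assumes T: "Sd one T" "tree_st T" "Sd Num k"
  shows "exits T k \<longleftrightarrow> paths T k = Z" "exits_st T k \<longleftrightarrow> paths T k = Z"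
proof -
  have F: "T \<in> F" "k \<in> N" using T by auto
  show "exits T k \<longleftrightarrow> paths T k = Z"
    using exit_paths_st[OF T] paths_exit[OF F] unfolding exits_def by blast
  have "exits_st T k" if p: "paths T k = Z" unfolding exits_st_def
  proof (intro allI impI)
    fix \<alpha> assume \<alpha>: "Sd one \<alpha>" "bin_st \<alpha>"
    then have "\<alpha> \<in> F" by blast
    \<comment> \<open>Here \<alpha> is known to be binary at standard indices only, while
      \<open>paths_Z\<close> speaks of sequences that are binary throughout; hence the detour
      through \<open>star\<close>.\<close>
    then have "T \<bullet> br (star \<alpha>) k \<noteq> One" using p paths_Z[OF F] star_bin by simp
    then show "\<exists>n\<in>N. le n k \<and> T \<bullet> br \<alpha> n \<noteq> One"
      using br_star_st[OF \<alpha> T(3)] F by (intro bexI[of _ k]) auto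
  qed
  then show "exits_st T k \<longleftrightarrow> paths T k = Z"
    using exit_paths_st[OF T] bin_seq_st unfolding exits_st_def by blast
qed

lemma sat_FAN: "sem \<rho> FAN \<longleftrightarrow> fan"
  by (simp add: FAN_def Let_def sat_tree sat_leave sat_leave_by fan_def) (metis exits_paths)

lemma sat_rel_FAN: "sem \<rho> (rel FAN) \<longleftrightarrow> fan_st"
proof -
  have "sem \<rho> (rel FAN) \<longleftrightarrow> (\<forall>T. Sd one T \<longrightarrow> tree_st T \<longrightarrow> leaves_st T \<longrightarrow> (\<exists>k. Sd Num k \<and> exits_st T k))"
    by (auto simp: FAN_def Let_def sat_tree sat_leave sat_leave_by Sd_def)
  then show ?thesis unfolding fan_st_def using exits_paths_st by blast
qed

lemma sat_FAN_star: "sem \<rho> FAN_star \<longleftrightarrow> fan_st"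
proof -
  have "sem \<rho> FAN_star \<longleftrightarrow> (\<forall>T. Sd one T \<longrightarrow> tree_st T \<longrightarrow> leaves_st T \<longrightarrow> (\<exists>k. Sd Num k \<and> exits T k))"
    by (auto simp: FAN_star_def Let_def sat_tree sat_leave sat_leave_by Sd_def)
  then show ?thesis unfolding fan_st_def using exits_paths_st by blast
qed

lemma sat_UFAN2: "sem \<rho> UFAN2 \<longleftrightarrow> ufan"
proof -
  have "sem \<rho> UFAN2 \<longleftrightarrow> (\<exists>\<Phi>\<in>D (one \<rightarrow> two \<rightarrow> Num). \<forall>T\<in>F. \<forall>g\<in>G. is_tree T \<longrightarrow> is_mod T g \<longrightarrow>
      exits T (\<Phi> \<bullet> T \<bullet> g))"
    by (simp add: UFAN2_def Let_def sat_tree sat_bin sat_leave_by is_mod_def) blast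
  moreover have "\<Phi> \<bullet> T \<bullet> g \<in> N" if "\<Phi> \<in> D (one \<rightarrow> two \<rightarrow> Num)" "T \<in> F" "g \<in> G" for \<Phi> T g
    using typed2[OF that] .
  ultimately show ?thesis by (simp add: ufan_def exits_paths cong: imp_cong)
qed

lemma sat_rel_UFAN2: "sem \<rho> (rel UFAN2) \<longleftrightarrow> ufan_st"
proof -
  have "sem \<rho> (rel UFAN2) \<longleftrightarrow> (\<exists>\<Phi>. Sd (one \<rightarrow> two \<rightarrow> Num) \<Phi> \<and> (\<forall>T g. Sd one T \<longrightarrow> Sd two g \<longrightarrow>
      tree_st T \<longrightarrow> mod_st T g \<longrightarrow> exits_st T (\<Phi> \<bullet> T \<bullet> g)))"
    by (simp add: UFAN2_def Let_def sat_tree sat_bin sat_leave_by mod_st_def Sd_def) blast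
  moreover have "Sd Num (\<Phi> \<bullet> T \<bullet> g)" if "Sd (one \<rightarrow> two \<rightarrow> Num) \<Phi>" "Sd one T" "Sd two g" for \<Phi> T g
    using that by (blast intro: Sd_app)
  ultimately show ?thesis unfolding ufan_st_def using exits_paths_st(2) by blast
qed

end

section \<open>From truth in all models to provability\<close>

lemma sentence_principles: "sentence L FAN" "sentence L (rel FAN)" "sentence L FAN_star"
  "sentence L UFAN2" "sentence L (rel UFAN2)"
  by (auto simp: sentence_def FAN_def FAN_star_def UFAN2_def tree_def bin_def all_paths_leave_def
      all_paths_leave_by_def Let_def Tm_def)

lemma sentence_imp: "sentence L (\<phi> \<^bold>\<longrightarrow> \<psi>) \<longleftrightarrow> sentence L \<phi> \<and> sentence L \<psi>"
  by (auto simp: sentence_def)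

lemma sentence_Bot: "sentence L Bot"
  by (simp add: sentence_def)

theorem corollary5p5:
  fixes S :: spec
  assumes "admissible S"
  shows "prv (spec_lang S) (RCA0Omega S)
           ((rel FAN \<^bold>\<longleftrightarrow> rel UFAN2) \<^bold>\<and> (rel UFAN2 \<^bold>\<longleftrightarrow> FAN_star))
       \<and> prv (spec_lang S) (RCA0Omega S \<union> QFAC (spec_lang S) two Num)
           ((rel FAN \<^bold>\<longleftrightarrow> FAN) \<^bold>\<and> (FAN \<^bold>\<longleftrightarrow> UFAN2))"
proof
  let ?L = "spec_lang S"
  show "prv ?L (RCA0Omega S) ((rel FAN \<^bold>\<longleftrightarrow> rel UFAN2) \<^bold>\<and> (rel UFAN2 \<^bold>\<longleftrightarrow> FAN_star))"
  proof (rule completeness)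
    show "RCA0Omega_core ?L \<subseteq> RCA0Omega S" by (auto simp: RCA0Omega_def)
    show "sentence ?L ((rel FAN \<^bold>\<longleftrightarrow> rel UFAN2) \<^bold>\<and> (rel UFAN2 \<^bold>\<longleftrightarrow> FAN_star))"
      by (simp add: sentence_imp sentence_Bot sentence_principles)
    fix D ap ST and I :: "const \<Rightarrow> trm" and \<rho>
    assume "model ?L D ap I ST"
    then interpret model ?L D ap I ST .
    show "sat D ap I (=) ST \<rho> ((rel FAN \<^bold>\<longleftrightarrow> rel UFAN2) \<^bold>\<and> (rel UFAN2 \<^bold>\<longleftrightarrow> FAN_star))"
      using fan_st_ufan_st ufan_st_fan_st by (auto simp: sat_rel_FAN sat_rel_UFAN2 sat_FAN_star)
  qed
  show "prv ?L (RCA0Omega S \<union> QFAC ?L two Num) ((rel FAN \<^bold>\<longleftrightarrow> FAN) \<^bold>\<and> (FAN \<^bold>\<longleftrightarrow> UFAN2))"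
  proof (rule completeness)
    show "RCA0Omega_core ?L \<subseteq> RCA0Omega S \<union> QFAC ?L two Num" by (auto simp: RCA0Omega_def)
    show "sentence ?L ((rel FAN \<^bold>\<longleftrightarrow> FAN) \<^bold>\<and> (FAN \<^bold>\<longleftrightarrow> UFAN2))"
      by (simp add: sentence_imp sentence_Bot sentence_principles)
    fix D ap ST and I :: "const \<Rightarrow> trm" and \<rho>
    assume "model ?L D ap I ST"
      and ax: "\<And>\<psi> \<rho>. \<psi> \<in> RCA0Omega S \<union> QFAC ?L two Num \<Longrightarrow> wff ?L \<psi> \<Longrightarrow>
        \<forall>v. \<rho> v \<in> D (snd v) \<Longrightarrow> sat D ap I (=) ST \<rho> \<psi>"
    then interpret model ?L D ap I ST by simp
    have "sat D ap I (=) ST \<rho> \<psi>" if "\<psi> \<in> QFAC ?L two Num" "wff ?L \<psi>" "typed \<rho>" for \<psi> \<rho>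
      using ax that by (simp add: typed_def)
    then have "fan \<Longrightarrow> ufan \<and> fan_st" by (rule fan_ufan_fan_st)
    then have "fan_st \<longleftrightarrow> fan" "fan \<longleftrightarrow> ufan" using fan_st_fan ufan_fan by blast+
    then show "sat D ap I (=) ST \<rho> ((rel FAN \<^bold>\<longleftrightarrow> FAN) \<^bold>\<and> (FAN \<^bold>\<longleftrightarrow> UFAN2))"
      by (simp add: sat_rel_FAN sat_FAN sat_UFAN2)
  qed
qed

end
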